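(* Let $f$ be a piecewise smooth function with rational discontinuities (defined in the context) and let $q\in\mathbb{Q}$. Then for almost every $\alpha\in[0,1)$ there is a constant $C=C(\alpha,f,q)>0$ such that both sets $$\Big\{N\in\mathbb{N}: S_N(f,\alpha,q)\ge C\sum_{i=1}^{K(N)}a_i\Big\},\qquad \Big\{N\in\mathbb{N}: S_N(f,\alpha,q)\le -C\sum_{i=1}^{K(N)}a_i\Big\}$$ have positive upper density.
   Context: For irrational $\alpha=[a_0;a_1,a_2,\dots]$ (continued fraction expansion) with convergent denominators $q_0=1,q_1=a_1,q_{k+1}=a_{k+1}q_k+q_{k-1}$, and $N\in\mathbb{N}$, $K(N)$ denotes the integer $K$ with $q_{K-1}\le N<q_K$. For $1$-periodic integrable $f$, $S_N(f,\alpha,q):=\sum_{n=1}^N f(n\alpha+q)-N\int_0^1 f(x)\,dx$. A $1$-periodic $f:\mathbb{R}\to\mathbb{R}$ is a piecewise smooth function with rational discontinuities if there exist $\nu\ge1$ and rationals $0\le x_1<\dots<x_\nu<1$ such that $f$ is differentiable on $[0,1)\setminus\{x_1,\dots,x_\nu\}$, the restriction of $f'$ to $[0,1)$ extends to a function of bounded variation on $[0,1)$, and $\lim_{\delta\to0}[f(x_i-\delta)-f(x_i+\delta)]\ne0$ for some $i$. The upper density of $A\subseteq\mathbb{N}$ is $\limsup_{M\to\infty}|\{N\le M:N\in A\}|/M$. *)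

theory Defs
  imports "HOL-Analysis.Analysis"
begin

fun cf_rem :: "real \<Rightarrow> nat \<Rightarrow> real" where
  "cf_rem \<alpha> 0 = frac \<alpha>"
| "cf_rem \<alpha> (Suc n) = frac (1 / cf_rem \<alpha> n)"

fun cf_a :: "real \<Rightarrow> nat \<Rightarrow> int" where
  "cf_a \<alpha> 0 = \<lfloor>\<alpha>\<rfloor>"
| "cf_a \<alpha> (Suc n) = \<lfloor>1 / cf_rem \<alpha> n\<rfloor>"

fun cf_q :: "real \<Rightarrow> nat \<Rightarrow> int" where
  "cf_q \<alpha> 0 = 1"
| "cf_q \<alpha> (Suc 0) = cf_a \<alpha> 1"
| "cf_q \<alpha> (Suc (Suc k)) = cf_a \<alpha> (Suc (Suc k)) * cf_q \<alpha> (Suc k) + cf_q \<alpha> k"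

definition cf_K :: "real \<Rightarrow> nat \<Rightarrow> nat" where
  "cf_K \<alpha> N = (LEAST K. 1 \<le> K \<and> cf_q \<alpha> (K - 1) \<le> int N \<and> int N < cf_q \<alpha> K)"

definition S_N :: "(real \<Rightarrow> real) \<Rightarrow> real \<Rightarrow> real \<Rightarrow> nat \<Rightarrow> real" where
  "S_N f \<alpha> q N = (\<Sum>n=1..N. f (real n * \<alpha> + q)) - real N * integral {0..1} f"

definition bounded_variation_on :: "(real \<Rightarrow> real) \<Rightarrow> real set \<Rightarrow> bool" where
  "bounded_variation_on g S \<longleftrightarrow>
     (\<exists>B. \<forall>ts::real list. sorted ts \<and> set ts \<subseteq> S \<longrightarrow>
        (\<Sum>i<length ts - 1. \<bar>g (ts ! Suc i) - g (ts ! i)\<bar>) \<le> B)"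

definition piecewise_smooth_rat_disc :: "(real \<Rightarrow> real) \<Rightarrow> bool" where
  "piecewise_smooth_rat_disc f \<longleftrightarrow>
     (\<forall>x. f (x + 1) = f x) \<and>
     (\<exists>X::real set. finite X \<and> X \<noteq> {} \<and> X \<subseteq> \<rat> \<inter> {0..<1} \<and>
        (\<exists>g. bounded_variation_on g {0..<1} \<and>
             (\<forall>x\<in>{0..<1} - X. (f has_real_derivative g x) (at x))) \<and>
        (\<exists>x\<in>X. \<exists>L. L \<noteq> 0 \<and>
             ((\<lambda>\<delta>. f (x - \<delta>) - f (x + \<delta>)) \<longlongrightarrow> L) (at_right 0)))"

definition upper_density :: "nat set \<Rightarrow> ereal" where
  "upper_density A = limsup (\<lambda>M. ereal (real (card {N \<in> A. N \<le> M}) / real M))"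

end

theory Submission
  imports Defs
begin

text \<open>
  Write \<open>f = h + (\<Sum>i. c i * saw (x - i))\<close> with \<open>h\<close> continuous, \<open>h'\<close> of bounded variation and
  \<open>saw x = frac x - 1/2\<close>. Over \<open>b * q k\<close> steps, \<open>b \<le> a (k + 1)\<close>, the orbit consists of \<open>q k\<close> slowly
  drifting points near the lattice of mesh \<open>1 / q k\<close>. Lattice sums of \<open>h\<close> are negligible, whereas those of
  \<open>saw\<close> reproduce \<open>saw\<close> at \<open>q k * x\<close>. Hence if \<open>q k \<equiv> 1\<close> modulo a common denominator of the discontinuities
  shifted by \<open>q\<close>, the Birkhoff sum is close to \<open>a (k + 1) * (\<plusminus> (K (\<plusminus> b / a (k + 1)) - K 0))\<close>, where
  \<open>K\<close> is a nonconstant combination of integrated sawtooth functions and the sign is the parity of \<open>k\<close>. For one of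
  the two parities the main term is positive on an interval of ratios \<open>b / a (k + 1)\<close>. By Denjoy-Koksma and the Ostrowski
  expansion the remaining terms are \<open>O(a 1 + \<dots> + a k)\<close>, so it suffices to have
  \<open>a (k + 1) \<ge> A * (a 1 + \<dots> + a k)\<close> for infinitely many \<open>k\<close> with prescribed parity and residue of \<open>q k\<close>.

  For almost every \<open>\<alpha>\<close> this holds: with \<open>S n = 1 + a 1 + \<dots> + a n\<close>, such a \<open>k\<close> occurs within the next four digits
  with conditional probability at least \<open>p / S n\<close>, while \<open>ln (1 + ln (S n))\<close> increases by at most
  \<open>16 / S n\<close> in conditional mean. So a function \<open>1 + c * ln (1 + ln (S n))\<close>, killed at the first success, is a
  supermartingale along every fourth index; as it tends to infinity on the surviving set, that set is null.
\<close>

section \<open>Continued fractions\<close>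

text \<open>The metric obstacle is that digits have infinite mean, while success probabilities of
  order \<open>1 / cf_S n\<close> have a sum that barely diverges, so Borel-Cantelli would first
  call for growth bounds on digit sums. The potential \<open>lnln\<close> avoids them: given the
  first \<open>n\<close> digits, the next digit truncated at \<open>s = cf_S n\<close> has mean of
  order \<open>1 + ln s\<close>, and \<open>lnln\<close> has derivative
  \<open>1 / (s * (1 + ln s))\<close>; its mean increment is thus of order \<open>1 / s\<close>,
  just like the success probability. Of the growth of the digit sums only
  \<open>1 + n \<le> cf_S n\<close> enters. In a group of four digits, two or three small ones steer
  residue and parity, and the next one may be large. One parity is enough for positive sums: if
  \<open>K 0 < K t\<close>, even \<open>k\<close> and ratio \<open>t\<close> serve; if
  \<open>K t < K 0\<close>, odd \<open>k\<close> and ratio \<open>1 - t\<close> do, by periodicity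
  of \<open>K\<close>. Negative sums come from the same result for the negated function.\<close>

definition irr :: "real set" where
  "irr = {0<..<1} - \<rat>"

lemma irrI: "0 < x \<Longrightarrow> x < 1 \<Longrightarrow> x \<notin> \<rat> \<Longrightarrow> x \<in> irr"
  by (simp add: irr_def)

lemma irrD: "x \<in> irr \<Longrightarrow> 0 < x" "x \<in> irr \<Longrightarrow> x < 1" "x \<in> irr \<Longrightarrow> x \<notin> \<rat>"
  by (auto simp: irr_def)

lemma frac_in_Rats_iff: "frac x \<in> \<rat> \<longleftrightarrow> x \<in> (\<rat> :: real set)"
proof
  assume "frac x \<in> \<rat>"
  then have "frac x + of_int \<lfloor>x\<rfloor> \<in> \<rat>"
    by (intro Rats_add Rats_of_int)
  then show "x \<in> \<rat>" by (simp add: frac_def)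
qed (auto simp: frac_def)

lemma frac_in_irr: "x \<notin> \<rat> \<Longrightarrow> frac x \<in> irr"
proof (rule irrI)
  assume x: "x \<notin> \<rat>"
  then have "x \<notin> \<int>" using Ints_subset_Rats by blast
  then show "0 < frac x" by simp
  show "frac x < 1" by (rule frac_lt_1)
  show "frac x \<notin> \<rat>" using x by (simp add: frac_in_Rats_iff)
qed

lemma inverse_notin_Rats: "x \<notin> \<rat> \<Longrightarrow> 1 / x \<notin> (\<rat> :: real set)"
  using Rats_divide[of 1 "1 / x"] by auto

lemma cf_rem_irr: "\<alpha> \<in> irr \<Longrightarrow> cf_rem \<alpha> n \<in> irr"
proof (induction n)
  case 0
  then show ?case by (auto intro!: frac_in_irr dest: irrD)
next
  case (Suc n)
  then show ?case by (auto intro!: frac_in_irr inverse_notin_Rats dest: irrD)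
qed

lemma cf_rem_0: "\<alpha> \<in> irr \<Longrightarrow> cf_rem \<alpha> 0 = \<alpha>"
  using irrD[of \<alpha>] by (simp add: frac_eq)

lemma cf_rem_inverse: "1 / cf_rem \<alpha> n = real_of_int (cf_a \<alpha> (Suc n)) + cf_rem \<alpha> (Suc n)"
  by (simp add: frac_def)

lemma cf_rem_Suc_mult:
  assumes "\<alpha> \<in> irr"
  shows "cf_rem \<alpha> n * (real_of_int (cf_a \<alpha> (Suc n)) + cf_rem \<alpha> (Suc n)) = 1"
  using irrD(1)[OF cf_rem_irr[OF assms], of n]
  by (simp flip: cf_rem_inverse del: cf_rem.simps cf_a.simps)

lemma cf_a_ge_1: "\<alpha> \<in> irr \<Longrightarrow> 1 \<le> cf_a \<alpha> (Suc n)"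
  using irrD[OF cf_rem_irr[of \<alpha> n]] by simp

lemma cf_q_ge_1: "\<alpha> \<in> irr \<Longrightarrow> 1 \<le> cf_q \<alpha> n"
proof (induction n rule: induct_nat_012)
  case 1
  then show ?case using cf_a_ge_1[of \<alpha> 0] by simp
next
  case (ge2 n)
  then have "1 * 1 \<le> cf_a \<alpha> (Suc (Suc n)) * cf_q \<alpha> (Suc n)"
    by (intro mult_mono cf_a_ge_1) (auto intro: order_trans[OF _ cf_a_ge_1])
  then show ?case using ge2 by simp
qed simp

lemma cf_q_mono_Suc: "\<alpha> \<in> irr \<Longrightarrow> cf_q \<alpha> n \<le> cf_q \<alpha> (Suc n)"
proof (cases n)
  case 0
  assume "\<alpha> \<in> irr" then show ?thesis using 0 cf_a_ge_1[of \<alpha> 0] by simp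
next
  case (Suc m)
  assume \<alpha>: "\<alpha> \<in> irr"
  have "1 * cf_q \<alpha> n \<le> cf_a \<alpha> (Suc n) * cf_q \<alpha> n"
    using cf_a_ge_1[OF \<alpha>, of n] cf_q_ge_1[OF \<alpha>, of n] by (intro mult_right_mono) auto
  then show ?thesis using Suc cf_q_ge_1[OF \<alpha>, of m] by simp
qed

lemma cf_q_mono: "\<alpha> \<in> irr \<Longrightarrow> m \<le> n \<Longrightarrow> cf_q \<alpha> m \<le> cf_q \<alpha> n"
  by (rule lift_Suc_mono_le) (auto intro: cf_q_mono_Suc)

lemma cf_q_ge_index: "\<alpha> \<in> irr \<Longrightarrow> int n \<le> cf_q \<alpha> n"
proof (induction n rule: induct_nat_012)
  case 1
  then show ?case using cf_a_ge_1[of \<alpha> 0] by simp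
next
  case (ge2 n)
  have "1 * cf_q \<alpha> (Suc n) \<le> cf_a \<alpha> (Suc (Suc n)) * cf_q \<alpha> (Suc n)"
    using cf_a_ge_1[of \<alpha> "Suc n"] cf_q_ge_1[of \<alpha> "Suc n"] ge2.prems by (intro mult_right_mono) auto
  then show ?case
    unfolding cf_q.simps using ge2.IH(2)[OF ge2.prems] cf_q_ge_1[OF ge2.prems, of n] by linarith
qed simp

lemma cf_q_Suc_bounds:
  assumes "\<alpha> \<in> irr"
  shows "cf_a \<alpha> (Suc n) * cf_q \<alpha> n \<le> cf_q \<alpha> (Suc n)"
    and "cf_q \<alpha> (Suc n) \<le> (cf_a \<alpha> (Suc n) + 1) * cf_q \<alpha> n"
  using cf_q_ge_1[OF assms, of "n - 1"] cf_q_mono_Suc[OF assms, of "n - 1"]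
  by (cases n; simp add: algebra_simps)+

section \<open>Convergents and their signed approximation errors\<close>

text \<open>Numerators of the convergents of a number in \<open>irr\<close>: the integer part 0 is
  built into the initial values 0 and 1.\<close>

fun cf_p :: "real \<Rightarrow> nat \<Rightarrow> int" where
  "cf_p \<alpha> 0 = 0"
| "cf_p \<alpha> (Suc 0) = 1"
| "cf_p \<alpha> (Suc (Suc k)) = cf_a \<alpha> (Suc (Suc k)) * cf_p \<alpha> (Suc k) + cf_p \<alpha> k"

text \<open>On \<open>irr\<close> this is the distance
  \<open>\<bar>q k * \<alpha> - p k\<bar>\<close>, written as a product of Gauss map iterates:
  positivity and the recursion are then immediate, and the sign \<open>(-1) ^ k\<close> is split
  off.\<close>

definition cf_rho :: "real \<Rightarrow> nat \<Rightarrow> real" where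
  "cf_rho \<alpha> k = (\<Prod>i\<le>k. cf_rem \<alpha> i)"

lemma cf_rho_Suc: "cf_rho \<alpha> (Suc k) = cf_rho \<alpha> k * cf_rem \<alpha> (Suc k)"
  by (simp add: cf_rho_def)

lemma cf_rho_pos: "\<alpha> \<in> irr \<Longrightarrow> 0 < cf_rho \<alpha> k"
  unfolding cf_rho_def by (intro prod_pos) (auto intro: irrD cf_rem_irr)

lemma cf_approx:
  assumes "\<alpha> \<in> irr"
  shows "real_of_int (cf_q \<alpha> k) * \<alpha> - real_of_int (cf_p \<alpha> k) = (-1) ^ k * cf_rho \<alpha> k"
proof (induction k rule: induct_nat_012)
  case 0
  then show ?case using cf_rem_0[OF assms] by (simp add: cf_rho_def del: cf_rem.simps)
next
  case 1
  then show ?case using cf_rem_0[OF assms] cf_rem_Suc_mult[OF assms, of 0]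
    by (simp add: cf_rho_def algebra_simps del: cf_rem.simps cf_a.simps)
next
  case (ge2 k)
  let ?a = "real_of_int (cf_a \<alpha> (Suc (Suc k)))"
  have "real_of_int (cf_q \<alpha> (Suc (Suc k))) * \<alpha> - real_of_int (cf_p \<alpha> (Suc (Suc k)))
      = ?a * (real_of_int (cf_q \<alpha> (Suc k)) * \<alpha> - real_of_int (cf_p \<alpha> (Suc k)))
        + (real_of_int (cf_q \<alpha> k) * \<alpha> - real_of_int (cf_p \<alpha> k))"
    by (simp add: algebra_simps del: cf_a.simps)
  also have "\<dots> = ?a * ((-1) ^ Suc k * cf_rho \<alpha> (Suc k)) + (-1) ^ k * cf_rho \<alpha> k"
    using ge2 by presburger
  \<comment> \<open>Substituting this cancels the digit terms and leaves \<open>(-1) ^ k * cf_rho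
    \<alpha> (Suc k) * cf_rem \<alpha> (Suc (Suc k))\<close>.\<close>
  also have "cf_rho \<alpha> k = cf_rho \<alpha> (Suc k) * (?a + cf_rem \<alpha> (Suc (Suc k)))"
    using cf_rem_Suc_mult[OF assms, of "Suc k"] by (simp add: cf_rho_Suc mult.assoc del: cf_rem.simps cf_a.simps)
  finally show ?case by (simp add: cf_rho_Suc[of \<alpha> "Suc k"] algebra_simps del: cf_rem.simps cf_a.simps)
qed

text \<open>Amounts to the determinant identity combined with the alternating signs of consecutive
  errors. It is the source of both bounds on \<open>cf_rho\<close>.\<close>

lemma cf_q_rho:
  assumes "\<alpha> \<in> irr"
  shows "real_of_int (cf_q \<alpha> (Suc k)) * cf_rho \<alpha> k + real_of_int (cf_q \<alpha> k) * cf_rho \<alpha> (Suc k) = 1"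
proof (induction k)
  case 0
  then show ?case using cf_rem_Suc_mult[OF assms, of 0]
    by (simp add: cf_rho_def algebra_simps del: cf_rem.simps cf_a.simps)
next
  case (Suc k)
  let ?a = "real_of_int (cf_a \<alpha> (Suc (Suc k)))"
  have "cf_rho \<alpha> k = cf_rho \<alpha> (Suc k) * (?a + cf_rem \<alpha> (Suc (Suc k)))"
    using cf_rem_Suc_mult[OF assms, of "Suc k"] by (simp add: cf_rho_Suc mult.assoc del: cf_rem.simps cf_a.simps)
  with Suc show ?case
    by (simp add: cf_rho_Suc[of \<alpha> "Suc k"] algebra_simps del: cf_rem.simps cf_a.simps)
qed

lemma cf_det: "cf_p \<alpha> (Suc k) * cf_q \<alpha> k - cf_p \<alpha> k * cf_q \<alpha> (Suc k) = (-1) ^ k"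
  by (induction k) (simp_all add: algebra_simps del: cf_a.simps)

lemma coprime_cf: "coprime (cf_p \<alpha> k) (cf_q \<alpha> k)"
proof (rule coprimeI)
  fix c assume "c dvd cf_p \<alpha> k" "c dvd cf_q \<alpha> k"
  then have "c dvd cf_p \<alpha> (Suc k) * cf_q \<alpha> k - cf_p \<alpha> k * cf_q \<alpha> (Suc k)"
    by (intro dvd_diff dvd_mult dvd_mult2)
  then show "is_unit c" unfolding cf_det by (rule dvd_unit_imp_unit) simp
qed

lemma coprime_cf_q: "coprime (cf_q \<alpha> (Suc k)) (cf_q \<alpha> k)"
proof (rule coprimeI)
  fix c assume "c dvd cf_q \<alpha> (Suc k)" "c dvd cf_q \<alpha> k"
  then have "c dvd cf_p \<alpha> (Suc k) * cf_q \<alpha> k - cf_p \<alpha> k * cf_q \<alpha> (Suc k)"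
    by (intro dvd_diff dvd_mult dvd_mult2)
  then show "is_unit c" unfolding cf_det by (rule dvd_unit_imp_unit) simp
qed

text \<open>Since \<open>a (k + 1) * q k \<le> q (k + 1)\<close>, these bounds confine
  \<open>q k * cf_rho \<alpha> k\<close> to the range from \<open>1 / (a (k + 1) + 2)\<close> to
  \<open>1 / a (k + 1)\<close>. Hence the drift after \<open>b\<close> blocks, measured in lattice
  cells, is comparable to \<open>b / a (k + 1)\<close>.\<close>

lemma cf_rho_bounds:
  assumes "\<alpha> \<in> irr"
  shows "real_of_int (cf_q \<alpha> (Suc k)) * cf_rho \<alpha> k \<le> 1"
    and "1 \<le> (real_of_int (cf_a \<alpha> (Suc k)) + 2) * (real_of_int (cf_q \<alpha> k) * cf_rho \<alpha> k)"
proof -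
  have q: "0 < real_of_int (cf_q \<alpha> k)" "0 < cf_rho \<alpha> k" "0 < cf_rho \<alpha> (Suc k)"
    using cf_q_ge_1[OF assms, of k] cf_rho_pos[OF assms] by auto
  then have "0 \<le> real_of_int (cf_q \<alpha> k) * cf_rho \<alpha> (Suc k)" by simp
  then show "real_of_int (cf_q \<alpha> (Suc k)) * cf_rho \<alpha> k \<le> 1"
    using cf_q_rho[OF assms, of k] by linarith
  have "cf_rho \<alpha> (Suc k) \<le> cf_rho \<alpha> k"
    using irrD(2)[OF cf_rem_irr[OF assms], of "Suc k"] q by (simp add: cf_rho_Suc del: cf_rem.simps)
  then have 1: "real_of_int (cf_q \<alpha> k) * cf_rho \<alpha> (Suc k) \<le> real_of_int (cf_q \<alpha> k) * cf_rho \<alpha> k"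
    using q by simp
  have "real_of_int (cf_q \<alpha> (Suc k)) \<le> real_of_int ((cf_a \<alpha> (Suc k) + 1) * cf_q \<alpha> k)"
    using cf_q_Suc_bounds(2)[OF assms, of k] by linarith
  then have "real_of_int (cf_q \<alpha> (Suc k)) * cf_rho \<alpha> k \<le> (real_of_int (cf_a \<alpha> (Suc k)) + 1) * real_of_int (cf_q \<alpha> k) * cf_rho \<alpha> k"
    using q by (intro mult_right_mono) auto
  with 1 cf_q_rho[OF assms, of k]
  show "1 \<le> (real_of_int (cf_a \<alpha> (Suc k)) + 2) * (real_of_int (cf_q \<alpha> k) * cf_rho \<alpha> k)"
    by (simp add: algebra_simps del: cf_a.simps)
qed

lemma cf_K_eq:
  assumes "\<alpha> \<in> irr" "cf_q \<alpha> k \<le> int N" "int N < cf_q \<alpha> (Suc k)"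
  shows "cf_K \<alpha> N = Suc k"
  unfolding cf_K_def
proof (rule Least_equality)
  fix K assume K: "1 \<le> K \<and> cf_q \<alpha> (K - 1) \<le> int N \<and> int N < cf_q \<alpha> K"
  show "Suc k \<le> K"
  proof (rule ccontr)
    assume "\<not> Suc k \<le> K"
    then have "cf_q \<alpha> K \<le> cf_q \<alpha> k" by (intro cf_q_mono assms) auto
    with K assms(2) show False by linarith
  qed
qed (use assms in auto)

section \<open>Cylinders\<close>

declare cf_rem.simps(2) [simp del] cf_a.simps(2) [simp del]

definition cf_agree :: "nat \<Rightarrow> real \<Rightarrow> real \<Rightarrow> bool" where
  "cf_agree n \<alpha> \<beta> \<longleftrightarrow> (\<forall>i\<in>{1..n}. cf_a \<alpha> i = cf_a \<beta> i)"

text \<open>Cylinders are indexed by one of their points instead of a word of digits, so that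
  \<open>cf_q \<beta>\<close> and \<open>cf_p \<beta>\<close> directly supply their data.\<close>

definition cyl :: "nat \<Rightarrow> real \<Rightarrow> real set" where
  "cyl n \<beta> = {\<alpha> \<in> irr. cf_agree n \<alpha> \<beta>}"

lemma cf_agree_Suc: "cf_agree (Suc n) \<alpha> \<beta> \<longleftrightarrow> cf_agree n \<alpha> \<beta> \<and> cf_a \<alpha> (Suc n) = cf_a \<beta> (Suc n)"
  unfolding cf_agree_def by (auto simp: le_Suc_eq)

lemma cf_agree_mono: "cf_agree n \<alpha> \<beta> \<Longrightarrow> m \<le> n \<Longrightarrow> cf_agree m \<alpha> \<beta>"
  by (auto simp: cf_agree_def)

lemma cf_agree_sym: "cf_agree n \<alpha> \<beta> \<Longrightarrow> cf_agree n \<beta> \<alpha>"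
  by (auto simp: cf_agree_def)

lemma cf_agree_trans: "cf_agree n \<alpha> \<beta> \<Longrightarrow> cf_agree n \<beta> \<gamma> \<Longrightarrow> cf_agree n \<alpha> \<gamma>"
  by (auto simp: cf_agree_def)

lemma cf_agree_a: "cf_agree n \<alpha> \<beta> \<Longrightarrow> 1 \<le> i \<Longrightarrow> i \<le> n \<Longrightarrow> cf_a \<alpha> i = cf_a \<beta> i"
  by (simp add: cf_agree_def)

lemma cf_agree_q: "cf_agree n \<alpha> \<beta> \<Longrightarrow> m \<le> n \<Longrightarrow> cf_q \<alpha> m = cf_q \<beta> m"
  by (induction m rule: induct_nat_012) (auto simp: cf_agree_a)

lemma cf_agree_p: "cf_agree n \<alpha> \<beta> \<Longrightarrow> m \<le> n \<Longrightarrow> cf_p \<alpha> m = cf_p \<beta> m"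
  by (induction m rule: induct_nat_012) (auto simp: cf_agree_a)

lemma of_int_add_notin_Rats: "t \<notin> \<rat> \<Longrightarrow> real_of_int a + t \<notin> \<rat>"
  using Rats_diff[of "real_of_int a + t" "real_of_int a"] by auto

lemma null_Rats: "(\<rat> :: real set) \<in> null_sets lborel"
  by (intro countable_imp_null_set_lborel countable_rat)

lemma irr_sets: "irr \<in> sets lborel"
  using null_setsD2[OF null_Rats] by (auto simp: irr_def)

text \<open>An inverse branch of an iterated Gauss map: it prepends the first digits of
  \<open>\<beta>\<close> to a prescribed remainder \<open>t\<close>. The induction absorbs one more
  digit by replacing \<open>t\<close> with \<open>1 / (a + t)\<close>.\<close>

lemma moebius_in_cyl:
  assumes "\<beta> \<in> irr" "t \<in> irr"
    and "\<alpha> = (real_of_int (cf_p \<beta> (Suc n)) + real_of_int (cf_p \<beta> n) * t)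
           / (real_of_int (cf_q \<beta> (Suc n)) + real_of_int (cf_q \<beta> n) * t)"
  shows "\<alpha> \<in> cyl (Suc n) \<beta> \<and> cf_rem \<alpha> (Suc n) = t"
  using assms(2,3)
proof (induction n arbitrary: t)
  case 0
  let ?a = "cf_a \<beta> 1"
  have a: "1 \<le> ?a" using cf_a_ge_1[OF assms(1), of 0] by simp
  have \<alpha>: "\<alpha> = 1 / (real_of_int ?a + t)" using 0 by simp
  have t: "0 < t" "t < 1" "t \<notin> \<rat>" using irrD[OF 0(1)] .
  have "\<alpha> \<in> irr"
  proof (rule irrI)
    show "0 < \<alpha>" "\<alpha> < 1" using a t unfolding \<alpha> by (auto simp: field_simps)
    have "real_of_int ?a + t \<notin> \<rat>"
      by (rule of_int_add_notin_Rats[OF t(3)])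
    then show "\<alpha> \<notin> \<rat>" unfolding \<alpha> by (rule inverse_notin_Rats)
  qed
  moreover from this have r: "1 / cf_rem \<alpha> 0 = t + real_of_int ?a"
    using cf_rem_0[of \<alpha>] \<alpha> by simp
  have "cf_a \<alpha> (Suc 0) = ?a"
    unfolding cf_a.simps r using t by (simp add: floor_eq_iff)
  moreover have "cf_rem \<alpha> (Suc 0) = t"
    unfolding cf_rem.simps(2) r using t by (simp add: frac_eq)
  ultimately show ?case by (auto simp: cyl_def cf_agree_def le_Suc_eq)
next
  case (Suc n)
  let ?a = "cf_a \<beta> (Suc (Suc n))"
  have a: "1 \<le> ?a" by (rule cf_a_ge_1[OF assms(1)])
  have t: "0 < t" "t < 1" "t \<notin> \<rat>" using irrD[OF Suc.prems(1)] .
  define t' where "t' = 1 / (real_of_int ?a + t)"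
  have at: "0 < real_of_int ?a + t" using a t by simp
  have "t' \<in> irr"
  proof (rule irrI)
    show "0 < t'" "t' < 1" using a t unfolding t'_def by (auto simp: field_simps)
    have "real_of_int ?a + t \<notin> \<rat>"
      by (rule of_int_add_notin_Rats[OF t(3)])
    then show "t' \<notin> \<rat>" unfolding t'_def by (rule inverse_notin_Rats)
  qed
  moreover have "\<alpha> = (real_of_int (cf_p \<beta> (Suc n)) + real_of_int (cf_p \<beta> n) * t')
           / (real_of_int (cf_q \<beta> (Suc n)) + real_of_int (cf_q \<beta> n) * t')"
  proof -
    have "real_of_int (cf_p \<beta> (Suc n)) + real_of_int (cf_p \<beta> n) * t'
        = (real_of_int (cf_p \<beta> (Suc (Suc n))) + real_of_int (cf_p \<beta> (Suc n)) * t) / (real_of_int ?a + t)"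
      using at unfolding t'_def by (simp add: field_simps)
    moreover have "real_of_int (cf_q \<beta> (Suc n)) + real_of_int (cf_q \<beta> n) * t'
        = (real_of_int (cf_q \<beta> (Suc (Suc n))) + real_of_int (cf_q \<beta> (Suc n)) * t) / (real_of_int ?a + t)"
      using at unfolding t'_def by (simp add: field_simps)
    ultimately show ?thesis using at Suc.prems(2) by simp
  qed
  ultimately have IH: "\<alpha> \<in> cyl (Suc n) \<beta>" "cf_rem \<alpha> (Suc n) = t'"
    using Suc.IH by auto
  have r: "1 / cf_rem \<alpha> (Suc n) = t + real_of_int ?a" unfolding IH t'_def by simp
  have "cf_a \<alpha> (Suc (Suc n)) = ?a"
    unfolding cf_a.simps r using t by (simp add: floor_eq_iff)
  moreover have "cf_rem \<alpha> (Suc (Suc n)) = t"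
    unfolding cf_rem.simps(2)[of _ "Suc n"] r using t by (simp add: frac_eq)
  ultimately show ?case using IH(1) by (auto simp: cyl_def cf_agree_Suc)
qed

text \<open>Both inequalities say that the remainder \<open>- A \<alpha> / B \<alpha>\<close> lies
  strictly between 0 and 1; the factor \<open>(-1) ^ n\<close> makes \<open>B\<close> positive on
  the cylinder for either orientation.\<close>

lemma cyl_Suc_iff:
  fixes \<beta> :: real and n :: nat
  defines "A \<equiv> (\<lambda>\<alpha>. (-1) ^ n * (real_of_int (cf_q \<beta> (Suc n)) * \<alpha> - real_of_int (cf_p \<beta> (Suc n))))"
    and "B \<equiv> (\<lambda>\<alpha>. (-1) ^ n * (real_of_int (cf_q \<beta> n) * \<alpha> - real_of_int (cf_p \<beta> n)))"
  assumes \<beta>: "\<beta> \<in> irr"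
  shows "\<alpha> \<in> cyl (Suc n) \<beta> \<longleftrightarrow> \<alpha> \<notin> \<rat> \<and> A \<alpha> < 0 \<and> 0 < A \<alpha> + B \<alpha>"
proof
  assume "\<alpha> \<in> cyl (Suc n) \<beta>"
  then have \<alpha>: "\<alpha> \<in> irr" and agree: "cf_agree (Suc n) \<alpha> \<beta>" by (auto simp: cyl_def)
  have A: "A \<alpha> = - cf_rho \<alpha> (Suc n)"
    using cf_approx[OF \<alpha>, of "Suc n"] cf_agree_p[OF agree, of "Suc n"] cf_agree_q[OF agree, of "Suc n"]
    unfolding A_def by (simp del: cf_p.simps cf_q.simps)
  have B: "B \<alpha> = cf_rho \<alpha> n"
    using cf_approx[OF \<alpha>, of n] cf_agree_p[OF agree, of n] cf_agree_q[OF agree, of n]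
    unfolding B_def by simp
  show "\<alpha> \<notin> \<rat> \<and> A \<alpha> < 0 \<and> 0 < A \<alpha> + B \<alpha>"
    using irrD[OF \<alpha>] cf_rho_pos[OF \<alpha>, of n] cf_rho_pos[OF \<alpha>, of "Suc n"]
      irrD(2)[OF cf_rem_irr[OF \<alpha>], of "Suc n"]
    unfolding A B by (simp add: cf_rho_Suc)
next
  assume *: "\<alpha> \<notin> \<rat> \<and> A \<alpha> < 0 \<and> 0 < A \<alpha> + B \<alpha>"
  define t where "t = - A \<alpha> / B \<alpha>"
  have Bp: "0 < B \<alpha>" using * by linarith
  have t01: "0 < t" "t < 1" using * Bp unfolding t_def by (auto simp: field_simps)
  have "A \<alpha> + t * B \<alpha> = 0" using Bp by (simp add: t_def)
  then have "(-1) ^ n * ((real_of_int (cf_q \<beta> (Suc n)) + real_of_int (cf_q \<beta> n) * t) * \<alpha>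
      - (real_of_int (cf_p \<beta> (Suc n)) + real_of_int (cf_p \<beta> n) * t)) = 0"
    unfolding A_def B_def by (simp add: algebra_simps del: cf_p.simps cf_q.simps)
  then have "(real_of_int (cf_q \<beta> (Suc n)) + real_of_int (cf_q \<beta> n) * t) * \<alpha>
      = real_of_int (cf_p \<beta> (Suc n)) + real_of_int (cf_p \<beta> n) * t" by simp
  moreover have "0 < real_of_int (cf_q \<beta> (Suc n)) + real_of_int (cf_q \<beta> n) * t"
    using cf_q_ge_1[OF \<beta>, of "Suc n"] cf_q_ge_1[OF \<beta>, of n] t01 by (intro add_pos_pos mult_pos_pos) auto
  ultimately have \<alpha>: "\<alpha> = (real_of_int (cf_p \<beta> (Suc n)) + real_of_int (cf_p \<beta> n) * t)
           / (real_of_int (cf_q \<beta> (Suc n)) + real_of_int (cf_q \<beta> n) * t)"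
    by (metis nonzero_eq_divide_eq less_irrefl mult.commute)
  have "t \<notin> \<rat>"
  proof
    assume "t \<in> \<rat>"
    then have "\<alpha> \<in> \<rat>" unfolding \<alpha> by (intro Rats_divide Rats_add Rats_mult Rats_of_int)
    with * show False by simp
  qed
  with t01 have "t \<in> irr" by (intro irrI)
  with moebius_in_cyl[OF \<beta> _ \<alpha>] show "\<alpha> \<in> cyl (Suc n) \<beta>" by blast
qed

text \<open>The endpoints are the values of the inverse branch at \<open>t = 0\<close> and
  \<open>t = 1\<close>, a convergent and a mediant. Their order alternates with \<open>n\<close>,
  whence \<open>min\<close> and \<open>max\<close>; their distance comes from the
  determinant.\<close>

lemma cyl_Suc_eq:
  fixes \<beta> :: real and n :: nat
  defines "u \<equiv> real_of_int (cf_p \<beta> (Suc n)) / real_of_int (cf_q \<beta> (Suc n))"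
    and "v \<equiv> real_of_int (cf_p \<beta> (Suc n) + cf_p \<beta> n) / real_of_int (cf_q \<beta> (Suc n) + cf_q \<beta> n)"
  assumes \<beta>: "\<beta> \<in> irr"
  shows "cyl (Suc n) \<beta> = {min u v<..<max u v} - \<rat>"
    and "\<bar>u - v\<bar> = 1 / (real_of_int (cf_q \<beta> (Suc n)) * real_of_int (cf_q \<beta> (Suc n) + cf_q \<beta> n))"
proof -
  define q q' p p' where "q = real_of_int (cf_q \<beta> (Suc n))" and "q' = real_of_int (cf_q \<beta> n)"
    and "p = real_of_int (cf_p \<beta> (Suc n))" and "p' = real_of_int (cf_p \<beta> n)"
  note defs = q_def q'_def p_def p'_def
  have q: "q \<ge> 1" "q' \<ge> 1" using cf_q_ge_1[OF \<beta>] unfolding defs by (auto simp del: cf_q.simps)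
  have u: "u = p / q" and v: "v = (p + p') / (q + q')" by (simp_all add: u_def v_def defs)
  have "real_of_int (cf_p \<beta> (Suc n) * cf_q \<beta> n - cf_p \<beta> n * cf_q \<beta> (Suc n)) = real_of_int ((-1) ^ n)"
    unfolding cf_det ..
  then have det: "p * q' - p' * q = (-1) ^ n" by (simp add: defs)
  have uv: "u - v = (-1) ^ n / (q * (q + q'))"
    using q det unfolding u v by (simp add: field_simps)
  then show "\<bar>u - v\<bar> = 1 / (real_of_int (cf_q \<beta> (Suc n)) * real_of_int (cf_q \<beta> (Suc n) + cf_q \<beta> n))"
    using q by (simp add: abs_mult defs)
  have iff: "\<alpha> \<in> cyl (Suc n) \<beta> \<longleftrightarrow> \<alpha> \<notin> \<rat> \<and> (-1) ^ n * (q * \<alpha> - p) < 0 \<and>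
      0 < (-1) ^ n * (q * \<alpha> - p) + (-1) ^ n * (q' * \<alpha> - p')" for \<alpha>
    unfolding cyl_Suc_iff[OF \<beta>] defs ..
  have pos: "0 < q * (q + q')" using q by simp
  show "cyl (Suc n) \<beta> = {min u v<..<max u v} - \<rat>"
  proof (cases "even n")
    case True
    then have "0 < u - v" unfolding uv using pos by simp
    then have "v < u" by simp
    then show ?thesis using True q
      unfolding set_eq_iff iff u v by (auto simp: field_simps min_def max_def)
  next
    case False
    then have "u - v < 0" unfolding uv using pos by (simp add: divide_neg_pos)
    then have "u < v" by simp
    then show ?thesis using False q
      unfolding set_eq_iff iff u v by (auto simp: field_simps min_def max_def)
  qed
qed

lemma emeasure_cyl_Suc:
  assumes "\<beta> \<in> irr"
  shows "emeasure lborel (cyl (Suc n) \<beta>)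
    = ennreal (1 / (real_of_int (cf_q \<beta> (Suc n)) * real_of_int (cf_q \<beta> (Suc n) + cf_q \<beta> n)))"
proof -
  have null: "emeasure lborel ({a<..<b} - \<rat>) = emeasure lborel {a<..<b}" for a b :: real
    by (rule emeasure_Diff_null_set[OF null_Rats]) simp
  have minmax: "max u v - min u v = \<bar>u - v\<bar>" "min u v \<le> max u v" for u v :: real by auto
  show ?thesis
    unfolding cyl_Suc_eq(1)[OF assms] null
    by (simp only: emeasure_lborel_Ioo[OF minmax(2)] minmax(1) cyl_Suc_eq(2)[OF assms])
qed

lemma cyl_subset_irr: "cyl n \<beta> \<subseteq> irr"
  by (auto simp: cyl_def)

lemma cyl_measurable: "\<beta> \<in> irr \<Longrightarrow> cyl n \<beta> \<in> sets lborel"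
proof (cases n)
  case 0
  then have "cyl n \<beta> = irr" by (auto simp: cyl_def cf_agree_def)
  then show ?thesis using irr_sets by simp
next
  case (Suc m)
  assume "\<beta> \<in> irr"
  then show ?thesis
    unfolding Suc cyl_Suc_eq(1)[OF \<open>\<beta> \<in> irr\<close>] using null_setsD2[OF null_Rats] by auto
qed

lemma irr_nonempty: "irr \<noteq> {}"
proof
  assume "irr = {}"
  then have "{0<..<1::real} \<subseteq> \<rat>" by (auto simp: irr_def)
  then have "countable {0<..<1::real}" using countable_rat countable_subset by blast
  then show False using uncountable_open_interval[of "0::real" 1] by simp
qed

lemma cyl_extend:
  assumes \<beta>: "\<beta> \<in> irr" and b: "1 \<le> b"
  obtains \<gamma> where "\<gamma> \<in> cyl (Suc n) \<beta>" "cf_a \<gamma> (Suc (Suc n)) = b"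
proof -
  obtain s where "s \<in> irr" using irr_nonempty by blast
  then have s: "0 < s" "s < 1" "s \<notin> \<rat>" using irrD by blast+
  define t where "t = 1 / (s + real_of_int b)"
  have "t \<in> irr"
  proof (rule irrI)
    show "0 < t" "t < 1" using b s unfolding t_def by (auto simp: field_simps)
    have "s + real_of_int b \<notin> \<rat>" using of_int_add_notin_Rats[OF s(3), of b] by (simp add: add.commute)
    then show "t \<notin> \<rat>" unfolding t_def by (rule inverse_notin_Rats)
  qed
  define \<gamma> where "\<gamma> = (real_of_int (cf_p \<beta> (Suc n)) + real_of_int (cf_p \<beta> n) * t)
           / (real_of_int (cf_q \<beta> (Suc n)) + real_of_int (cf_q \<beta> n) * t)"
  have \<gamma>: "\<gamma> \<in> cyl (Suc n) \<beta>" "cf_rem \<gamma> (Suc n) = t"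
    using moebius_in_cyl[OF \<beta> \<open>t \<in> irr\<close> \<gamma>_def] by auto
  have "cf_a \<gamma> (Suc (Suc n)) = b"
    using s by (simp add: cf_a.simps(2) \<gamma>(2) t_def floor_eq_iff)
  with \<gamma>(1) that show thesis by blast
qed

lemma cyl_digit_eq:
  assumes "\<gamma> \<in> cyl n \<beta>"
  shows "{\<alpha> \<in> cyl n \<beta>. cf_a \<alpha> (Suc n) = cf_a \<gamma> (Suc n)} = cyl (Suc n) \<gamma>"
  using assms unfolding cyl_def cf_agree_Suc
  by (auto intro: cf_agree_trans cf_agree_sym)

text \<open>By the length formula this compares two rational expressions in \<open>q\<close> and
  \<open>q'\<close>, and the comparison uses only \<open>1 \<le> q'\<close> and
  \<open>q' \<le> q\<close>. The constants are therefore uniform in the previous digits, which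
  replaces independence.\<close>

lemma cyl_digit_measure:
  fixes \<beta> :: real and b :: int and n :: nat
  assumes \<beta>: "\<beta> \<in> irr" and b: "1 \<le> b"
  defines "X \<equiv> {\<alpha> \<in> cyl (Suc n) \<beta>. cf_a \<alpha> (Suc (Suc n)) = b}"
  shows "X \<in> sets lborel"
    and "emeasure lborel X \<le> ennreal (2 / (b * (b + 1))) * emeasure lborel (cyl (Suc n) \<beta>)"
    and "ennreal (1 / (6 * b\<^sup>2)) * emeasure lborel (cyl (Suc n) \<beta>) \<le> emeasure lborel X"
proof -
  obtain \<gamma> where \<gamma>: "\<gamma> \<in> cyl (Suc n) \<beta>" "cf_a \<gamma> (Suc (Suc n)) = b"
    using cyl_extend[OF \<beta> b] .
  have \<gamma>i: "\<gamma> \<in> irr" and agree: "cf_agree (Suc n) \<gamma> \<beta>" using \<gamma>(1) by (auto simp: cyl_def)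
  have X: "X = cyl (Suc (Suc n)) \<gamma>" using cyl_digit_eq[OF \<gamma>(1)] \<gamma>(2) by (simp add: X_def)
  show "X \<in> sets lborel" unfolding X by (rule cyl_measurable[OF \<gamma>i])
  define q q' B where "q = real_of_int (cf_q \<beta> (Suc n))" and "q' = real_of_int (cf_q \<beta> n)" and "B = real_of_int b"
  have q: "1 \<le> q'" "q' \<le> q" using cf_q_ge_1[OF \<beta>, of n] cf_q_mono_Suc[OF \<beta>, of n]
    by (auto simp: q_def q'_def)
  have B: "1 \<le> B" using b by (simp add: B_def)
  have q2: "real_of_int (cf_q \<gamma> (Suc (Suc n))) = B * q + q'"
    using \<gamma>(2) cf_agree_q[OF agree, of "Suc n"] cf_agree_q[OF agree, of n] by (simp add: q_def q'_def B_def)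
  have mX: "emeasure lborel X = ennreal (1 / ((B * q + q') * ((B + 1) * q + q')))"
    unfolding X emeasure_cyl_Suc[OF \<gamma>i] of_int_add q2
    using cf_agree_q[OF agree, of "Suc n"] by (simp add: q_def algebra_simps del: cf_q.simps)
  have mC: "emeasure lborel (cyl (Suc n) \<beta>) = ennreal (1 / (q * (q + q')))"
    unfolding emeasure_cyl_Suc[OF \<beta>] by (simp add: q_def q'_def)
  have pos: "0 < q * (q + q')" "0 < (B * q + q') * ((B + 1) * q + q')" "0 < B * (B + 1)" "0 < 6 * B\<^sup>2"
    using q B by (auto intro!: mult_pos_pos add_pos_pos)
  have "(B * q) * ((B + 1) * (q + q')) \<le> (B * q + q') * (2 * ((B + 1) * q + q'))"
  proof (rule mult_mono)
    have "(B + 1) * (q + q') \<le> (B + 1) * (2 * q)" using q B by (intro mult_left_mono) auto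
    then show "(B + 1) * (q + q') \<le> 2 * ((B + 1) * q + q')" using q by (simp add: algebra_simps)
  qed (use q B in auto)
  then have "B * (B + 1) * (q * (q + q')) \<le> 2 * ((B * q + q') * ((B + 1) * q + q'))"
    by (simp only: mult_ac)
  then have "1 / ((B * q + q') * ((B + 1) * q + q')) \<le> 2 / (B * (B + 1)) * (1 / (q * (q + q')))"
    using pos by (simp add: divide_simps)
  then show "emeasure lborel X \<le> ennreal (2 / (b * (b + 1))) * emeasure lborel (cyl (Suc n) \<beta>)"
    unfolding mX mC using pos B by (subst ennreal_mult[symmetric]) (auto simp: B_def intro!: ennreal_leI)
  have "(B * q + q') * ((B + 1) * q + q') \<le> (2 * B * q) * (3 * B * (q + q'))"
  proof (rule mult_mono)
    have "1 * q' \<le> B * q" using q B by (intro mult_mono) auto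
    then show "B * q + q' \<le> 2 * B * q" by simp
    have "1 * q \<le> B * q" "1 * q' \<le> B * q'" "0 \<le> B * q" using q B by (auto intro!: mult_right_mono)
    moreover have "3 * B * (q + q') = 3 * (B * q) + 3 * (B * q')" "(B + 1) * q = B * q + q"
      by (simp_all add: algebra_simps)
    ultimately show "(B + 1) * q + q' \<le> 3 * B * (q + q')" using q by linarith
  qed (use q B in auto)
  then have "(B * q + q') * ((B + 1) * q + q') \<le> 6 * B\<^sup>2 * (q * (q + q'))"
    by (simp add: power2_eq_square mult_ac)
  then have "1 / (6 * B\<^sup>2) * (1 / (q * (q + q'))) \<le> 1 / ((B * q + q') * ((B + 1) * q + q'))"
    using pos by (simp add: divide_simps)
  then show "ennreal (1 / (6 * b\<^sup>2)) * emeasure lborel (cyl (Suc n) \<beta>) \<le> emeasure lborel X"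
    unfolding mX mC using pos B by (subst ennreal_mult[symmetric]) (auto simp: B_def intro!: ennreal_leI)
qed

section \<open>Measurability and digit functions\<close>

text \<open>An injective numbering of digit words, so that series and unions over all cylinders of
  one level run over natural numbers.\<close>

fun cf_code :: "nat \<Rightarrow> real \<Rightarrow> nat" where
  "cf_code 0 \<alpha> = 0"
| "cf_code (Suc n) \<alpha> = to_nat (cf_code n \<alpha>, cf_a \<alpha> (Suc n))"

lemma cf_code_eq_iff: "cf_code n \<alpha> = cf_code n \<beta> \<longleftrightarrow> cf_agree n \<alpha> \<beta>"
  by (induction n) (auto simp: cf_agree_Suc, simp add: cf_agree_def)

lemma measurable_cf_rem [measurable]: "(\<lambda>\<alpha>. cf_rem \<alpha> n) \<in> borel_measurable borel"
  by (induction n) (simp_all add: cf_rem.simps frac_def)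

lemma measurable_cf_a [measurable]: "(\<lambda>\<alpha>. cf_a \<alpha> n) \<in> measurable borel (count_space UNIV)"
  by (cases n) (simp_all add: cf_a.simps)

lemma measurable_cf_code [measurable]: "cf_code n \<in> measurable borel (count_space UNIV)"
proof (induction n)
  case 0
  then show ?case by (simp add: cf_code.simps[abs_def])
next
  case (Suc n)
  have "(\<lambda>\<alpha>. (\<lambda>i \<alpha>. to_nat (i, cf_a \<alpha> (Suc n))) (cf_code n \<alpha>) \<alpha>) \<in> measurable borel (count_space UNIV)"
    by (rule measurable_compose_countable[OF _ Suc]) measurable
  then show ?case by (simp add: cf_code.simps[abs_def])
qed

definition irr_measure :: "real measure" where
  "irr_measure = restrict_space lborel irr"

lemma space_irr_measure [simp]: "space irr_measure = irr"
  by (simp add: irr_measure_def space_restrict_space)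

lemma sets_irr_measure: "A \<in> sets irr_measure \<longleftrightarrow> A \<subseteq> irr \<and> A \<in> sets lborel"
  using irr_sets unfolding irr_measure_def by (subst sets_restrict_space_iff) auto

lemma emeasure_irr_measure: "A \<subseteq> irr \<Longrightarrow> emeasure irr_measure A = emeasure lborel A"
  using irr_sets unfolding irr_measure_def by (subst emeasure_restrict_space) auto

lemma cyl_sets [measurable]: "\<beta> \<in> irr \<Longrightarrow> cyl n \<beta> \<in> sets irr_measure"
  unfolding sets_irr_measure using cyl_measurable cyl_subset_irr by blast

text \<open>Stands in for measurability with respect to the sigma-algebra of the first
  \<open>n\<close> digits, that is, for adaptedness to the digit filtration.\<close>

definition digit_fun :: "nat \<Rightarrow> (real \<Rightarrow> 'b) \<Rightarrow> bool" where
  "digit_fun n u \<longleftrightarrow> (\<forall>\<alpha>\<in>irr. \<forall>\<beta>\<in>irr. cf_agree n \<alpha> \<beta> \<longrightarrow> u \<alpha> = u \<beta>)"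

lemma digit_funI: "(\<And>\<alpha> \<beta>. \<alpha> \<in> irr \<Longrightarrow> \<beta> \<in> irr \<Longrightarrow> cf_agree n \<alpha> \<beta> \<Longrightarrow> u \<alpha> = u \<beta>) \<Longrightarrow> digit_fun n u"
  by (simp add: digit_fun_def)

lemma digit_funD: "digit_fun n u \<Longrightarrow> \<alpha> \<in> irr \<Longrightarrow> \<beta> \<in> irr \<Longrightarrow> cf_agree n \<alpha> \<beta> \<Longrightarrow> u \<alpha> = u \<beta>"
  by (simp add: digit_fun_def)

lemma digit_fun_mono: "digit_fun n u \<Longrightarrow> n \<le> m \<Longrightarrow> digit_fun m u"
  unfolding digit_fun_def by (blast intro: cf_agree_mono)

lemma cf_code_measurable_irr [measurable]: "cf_code n \<in> measurable irr_measure (count_space UNIV)"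
  unfolding irr_measure_def by (rule measurable_restrict_space1) simp

text \<open>Such a function factors through the code, which takes countably many values, and on a
  countable discrete space every map is measurable.\<close>

lemma digit_fun_measurable:
  assumes "digit_fun n u" "\<And>\<alpha>. \<alpha> \<in> irr \<Longrightarrow> u \<alpha> \<in> space N"
  shows "u \<in> measurable irr_measure N"
proof (cases "irr = {}")
  case False
  then obtain \<beta> where \<beta>: "\<beta> \<in> irr" by auto
  \<comment> \<open>The default \<open>u \<beta>\<close> for codes that no point of
    \<open>irr\<close> attains keeps every value of \<open>V\<close> inside
    \<open>space N\<close>.\<close>
  define V where "V i = (if \<exists>\<alpha>\<in>irr. cf_code n \<alpha> = i then u (SOME \<alpha>. \<alpha> \<in> irr \<and> cf_code n \<alpha> = i) else u \<beta>)" for i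
  have Vu: "V (cf_code n \<alpha>) = u \<alpha>" if "\<alpha> \<in> irr" for \<alpha>
  proof -
    have ex: "\<exists>\<gamma>. \<gamma> \<in> irr \<and> cf_code n \<gamma> = cf_code n \<alpha>" using that by auto
    then have "V (cf_code n \<alpha>) = u (SOME \<gamma>. \<gamma> \<in> irr \<and> cf_code n \<gamma> = cf_code n \<alpha>)"
      by (auto simp: V_def)
    then show ?thesis
      using someI_ex[OF ex] assms(1) that by (auto simp: cf_code_eq_iff digit_fun_def)
  qed
  have "V i \<in> space N" for i
  proof (cases "\<exists>\<alpha>\<in>irr. cf_code n \<alpha> = i")
    case True
    then obtain \<alpha> where "\<alpha> \<in> irr" "i = cf_code n \<alpha>" by auto
    then show ?thesis using Vu[of \<alpha>] assms(2)[of \<alpha>] by simp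
  next
    case False
    then show ?thesis using assms(2) \<beta> by (simp add: V_def)
  qed
  then have "(\<lambda>\<alpha>. V (cf_code n \<alpha>)) \<in> measurable irr_measure N"
    by (intro measurable_compose_countable[where f = "\<lambda>i _. V i" and g = "cf_code n", OF _ cf_code_measurable_irr]) simp
  moreover have "u \<in> measurable irr_measure N \<longleftrightarrow> (\<lambda>\<alpha>. V (cf_code n \<alpha>)) \<in> measurable irr_measure N"
    by (rule measurable_cong) (simp add: Vu)
  ultimately show ?thesis by blast
next
  case True
  then show ?thesis by (simp add: measurable_def)
qed

lemma digit_fun_borel: "digit_fun n u \<Longrightarrow> u \<in> borel_measurable irr_measure"
  by (rule digit_fun_measurable) auto

lemma digit_fun_ennreal: "digit_fun n u \<Longrightarrow> digit_fun n (\<lambda>\<alpha>. ennreal (u \<alpha>))"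
  by (auto simp: digit_fun_def)

lemma nn_integral_split_codes:
  assumes "f \<in> borel_measurable irr_measure"
  shows "(\<integral>\<^sup>+\<alpha>. f \<alpha> \<partial>irr_measure) = (\<Sum>i. \<integral>\<^sup>+\<alpha>. f \<alpha> * indicator {\<alpha>\<in>irr. cf_code n \<alpha> = i} \<alpha> \<partial>irr_measure)"
proof -
  have [measurable]: "{\<alpha>\<in>irr. cf_code n \<alpha> = i} \<in> sets irr_measure" for i
    using measurable_sets[OF cf_code_measurable_irr[of n], of "{i}"]
    by (auto simp: vimage_def Int_def conj_commute)
  note assms[measurable]
  have "(\<integral>\<^sup>+\<alpha>. f \<alpha> \<partial>irr_measure) = (\<integral>\<^sup>+\<alpha>. (\<Sum>i. f \<alpha> * indicator {\<alpha>\<in>irr. cf_code n \<alpha> = i} \<alpha>) \<partial>irr_measure)"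
    by (intro nn_integral_cong, subst suminf_cmult_indicator[where i = "cf_code n _"])
       (auto simp: disjoint_family_on_def)
  also have "\<dots> = (\<Sum>i. \<integral>\<^sup>+\<alpha>. f \<alpha> * indicator {\<alpha>\<in>irr. cf_code n \<alpha> = i} \<alpha> \<partial>irr_measure)"
    by (intro nn_integral_suminf) measurable
  finally show ?thesis .
qed

text \<open>Plays the role of a conditional expectation inequality: \<open>u\<close> is constant on
  each cylinder of level \<open>n\<close>, so it can be pulled out and the pieces summed.\<close>

lemma cylinderwise_le:
  fixes u g v :: "real \<Rightarrow> ennreal"
  assumes u: "digit_fun n u" and [measurable]: "g \<in> borel_measurable irr_measure" "v \<in> borel_measurable irr_measure"
    and le: "\<And>\<beta>. \<beta> \<in> irr \<Longrightarrow> (\<integral>\<^sup>+\<alpha>. g \<alpha> * indicator (cyl n \<beta>) \<alpha> \<partial>irr_measure)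
        \<le> (\<integral>\<^sup>+\<alpha>. v \<alpha> * indicator (cyl n \<beta>) \<alpha> \<partial>irr_measure)"
  shows "(\<integral>\<^sup>+\<alpha>. u \<alpha> * g \<alpha> \<partial>irr_measure) \<le> (\<integral>\<^sup>+\<alpha>. u \<alpha> * v \<alpha> \<partial>irr_measure)"
proof -
  note digit_fun_borel[OF u, measurable]
  show ?thesis
  proof (subst (1 2) nn_integral_split_codes[of _ n], measurable, rule suminf_le)
    fix i
    show "(\<integral>\<^sup>+\<alpha>. u \<alpha> * g \<alpha> * indicator {\<alpha>\<in>irr. cf_code n \<alpha> = i} \<alpha> \<partial>irr_measure)
        \<le> (\<integral>\<^sup>+\<alpha>. u \<alpha> * v \<alpha> * indicator {\<alpha>\<in>irr. cf_code n \<alpha> = i} \<alpha> \<partial>irr_measure)"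
    proof (cases "\<exists>\<beta>\<in>irr. cf_code n \<beta> = i")
      case True
      then obtain \<beta> where \<beta>: "\<beta> \<in> irr" "cf_code n \<beta> = i" by auto
      have C: "{\<alpha>\<in>irr. cf_code n \<alpha> = i} = cyl n \<beta>"
        using \<beta> by (auto simp: cyl_def cf_code_eq_iff simp flip: \<beta>(2))
      have eq: "(\<integral>\<^sup>+\<alpha>. u \<alpha> * h \<alpha> * indicator (cyl n \<beta>) \<alpha> \<partial>irr_measure)
          = u \<beta> * (\<integral>\<^sup>+\<alpha>. h \<alpha> * indicator (cyl n \<beta>) \<alpha> \<partial>irr_measure)"
        if [measurable]: "h \<in> borel_measurable irr_measure" for h
      proof -
        have [measurable]: "cyl n \<beta> \<in> sets irr_measure" using \<beta> by measurable
        have "(\<integral>\<^sup>+\<alpha>. u \<alpha> * h \<alpha> * indicator (cyl n \<beta>) \<alpha> \<partial>irr_measure)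
            = (\<integral>\<^sup>+\<alpha>. u \<beta> * (h \<alpha> * indicator (cyl n \<beta>) \<alpha>) \<partial>irr_measure)"
          using \<beta> digit_funD[OF u, of _ \<beta>]
          by (intro nn_integral_cong) (auto simp: cyl_def indicator_def mult.assoc)
        also have "\<dots> = u \<beta> * (\<integral>\<^sup>+\<alpha>. h \<alpha> * indicator (cyl n \<beta>) \<alpha> \<partial>irr_measure)"
          by (intro nn_integral_cmult) measurable
        finally show ?thesis .
      qed
      show ?thesis unfolding C by (simp add: eq mult_left_mono le \<beta>)
    next
      case False
      then have "{\<alpha>\<in>irr. cf_code n \<alpha> = i} = {}" by auto
      then show ?thesis by simp
    qed
  qed auto
qed

lemma nn_integral_const_cyl:
  assumes "\<beta> \<in> irr" "digit_fun n v"
  shows "(\<integral>\<^sup>+\<alpha>. v \<alpha> * indicator (cyl n \<beta>) \<alpha> \<partial>irr_measure) = v \<beta> * emeasure lborel (cyl n \<beta>)"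
proof -
  have "(\<integral>\<^sup>+\<alpha>. v \<alpha> * indicator (cyl n \<beta>) \<alpha> \<partial>irr_measure) = (\<integral>\<^sup>+\<alpha>. v \<beta> * indicator (cyl n \<beta>) \<alpha> \<partial>irr_measure)"
    using assms by (intro nn_integral_cong) (auto simp: cyl_def indicator_def dest: digit_funD)
  also have "\<dots> = v \<beta> * emeasure irr_measure (cyl n \<beta>)"
    by (intro nn_integral_cmult_indicator cyl_sets assms)
  finally show ?thesis by (simp add: emeasure_irr_measure cyl_subset_irr)
qed

section \<open>Digit sums and the doubly logarithmic potential\<close>

text \<open>The leading 1 makes the value at least 1 on \<open>irr\<close> even for
  \<open>n = 0\<close>, so logarithms of it are nonnegative and division by it is safe.\<close>

definition cf_S :: "nat \<Rightarrow> real \<Rightarrow> real" where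
  "cf_S n \<alpha> = 1 + (\<Sum>i=1..n. real_of_int (cf_a \<alpha> i))"

lemma cf_S_Suc: "cf_S (Suc n) \<alpha> = cf_S n \<alpha> + real_of_int (cf_a \<alpha> (Suc n))"
  by (simp add: cf_S_def)

lemma cf_S_digit_fun: "digit_fun n (cf_S n)"
  unfolding cf_S_def by (intro digit_funI arg_cong[of _ _ "(+) 1"] sum.cong) (auto simp: cf_agree_a)

lemma cf_S_ge: "\<alpha> \<in> irr \<Longrightarrow> 1 + real n \<le> cf_S n \<alpha>"
proof (induction n)
  case 0
  then show ?case by (simp add: cf_S_def)
next
  case (Suc n)
  have "1 \<le> real_of_int (cf_a \<alpha> (Suc n))" using cf_a_ge_1[OF Suc.prems, of n] by simp
  with Suc show ?case by (simp add: cf_S_Suc)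
qed

lemma cf_S_ge_1: "\<alpha> \<in> irr \<Longrightarrow> 1 \<le> cf_S n \<alpha>"
  using cf_S_ge[of \<alpha> n] by simp

lemma cf_S_mono: "\<alpha> \<in> irr \<Longrightarrow> m \<le> n \<Longrightarrow> cf_S m \<alpha> \<le> cf_S n \<alpha>"
proof (rule lift_Suc_mono_le[of "\<lambda>n. cf_S n \<alpha>"])
  fix n assume "\<alpha> \<in> irr"
  then show "cf_S n \<alpha> \<le> cf_S (Suc n) \<alpha>" using cf_a_ge_1[of \<alpha> n] by (simp add: cf_S_Suc)
qed auto

definition lnln :: "real \<Rightarrow> real" where
  "lnln s = ln (1 + ln s)"

lemma lnln_nonneg: "1 \<le> s \<Longrightarrow> 0 \<le> lnln s"
  by (simp add: lnln_def)

lemma lnln_mono: "1 \<le> s \<Longrightarrow> s \<le> t \<Longrightarrow> lnln s \<le> lnln t"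
proof -
  assume st: "1 \<le> s" "s \<le> t"
  have "0 \<le> ln s" "ln s \<le> ln t" using st by auto
  then show ?thesis unfolding lnln_def by (intro ln_mono) auto
qed

lemma ln_diff_eq: "0 < x \<Longrightarrow> 0 < x + y \<Longrightarrow> ln (x + y) - ln x = ln (1 + y / (x::real))"
proof -
  assume *: "0 < x" "0 < x + y"
  then have "1 + y / x = (x + y) / x" by (simp add: field_simps)
  with * show ?thesis by (simp add: ln_div)
qed

text \<open>The estimate \<open>ln (1 + x) \<le> x\<close> is applied to the outer logarithm only.
  The inner one stays because \<open>b\<close> may be far larger than \<open>s\<close>, and a linear
  bound in \<open>b\<close> would have infinite mean.\<close>

lemma lnln_diff_le:
  assumes "1 \<le> s" "0 \<le> b"
  shows "lnln (s + b) - lnln s \<le> ln (1 + b / s) / (1 + ln s)"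
proof -
  have ls: "0 \<le> ln s" using assms by simp
  have l: "ln (s + b) = ln s + ln (1 + b / s)"
    using ln_diff_eq[of s b] assms by (simp add: diff_eq_eq add.commute)
  have nn: "0 \<le> ln (1 + b / s)" using assms by simp
  have "lnln (s + b) - lnln s = ln ((1 + ln (s + b)) / (1 + ln s))"
    unfolding lnln_def using ls nn l by (subst ln_div) auto
  also have "(1 + ln (s + b)) / (1 + ln s) = 1 + ln (1 + b / s) / (1 + ln s)"
  proof -
    have "(1 + (A + B)) / (1 + A) = 1 + B / (1 + A)" if "1 + A \<noteq> 0" for A B :: real
      using that by (simp add: divide_simps)
    from this[of "ln s"] show ?thesis using ls unfolding l by simp
  qed
  also have "ln \<dots> \<le> ln (1 + b / s) / (1 + ln s)"
    using ls nn by (intro ln_add_one_self_le_self) auto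
  finally show ?thesis .
qed

text \<open>The derivative is \<open>ln (1 + 1 / z) - 1 / z\<close>, which is nonpositive. Comparing
  the arguments \<open>b\<close> and \<open>s + b\<close> yields the telescoping inequality of the
  next estimate.\<close>

lemma mult_ln_ratio_antimono:
  assumes "0 < x" "x \<le> y"
  shows "(y + 1) * (ln (y + 1) - ln y) \<le> (x + 1) * (ln (x + 1) - ln (x::real))"
proof (rule DERIV_nonpos_imp_nonincreasing[OF assms(2)])
  fix z assume z: "x \<le> z" "z \<le> y"
  then have z0: "0 < z" using assms by simp
  have "((\<lambda>z. (z + 1) * (ln (z + 1) - ln z)) has_real_derivative
      (ln (z + 1) - ln z) + (z + 1) * (1 / (z + 1) - 1 / z)) (at z)"
    using z0 by (auto intro!: derivative_eq_intros)
  moreover have "(ln (z + 1) - ln z) + (z + 1) * (1 / (z + 1) - 1 / z) \<le> 0"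
  proof -
    have "ln (z + 1) - ln z = ln (1 + 1 / z)" using z0 by (intro ln_diff_eq) auto
    also have "\<dots> \<le> 1 / z" using z0 by (intro ln_add_one_self_le_self) auto
    moreover have "(z + 1) * (1 / (z + 1) - 1 / z) = - (1 / z)"
      using z0 by (simp add: right_diff_distrib add_divide_distrib)
    ultimately show ?thesis by linarith
  qed
  ultimately show "\<exists>d. ((\<lambda>z. (z + 1) * (ln (z + 1) - ln z)) has_real_derivative d) (at z) \<and> d \<le> 0"
    by blast
qed

text \<open>The telescoping majorant is the tail integral of \<open>ln (1 + t / s) / t\<^sup>2\<close> over \<open>t \<ge> b\<close>.\<close>

lemma sum_ln_weights_le:
  assumes s: "(1::real) \<le> s"
  shows "(\<Sum>i<N. ln (1 + (real i + 1) / s) / ((real i + 1) * (real i + 2))) \<le> 2 * (1 + ln s) / s"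
proof -
  define \<tau> where "\<tau> b = (ln (s + b) - ln s) / b + (ln (s + b) - ln b) / s" for b
  have step: "ln (1 + (real i + 1) / s) / ((real i + 1) * (real i + 2)) \<le> \<tau> (real i + 1) - \<tau> (real (Suc i) + 1)" for i
  proof -
    define b where "b = real i + 1"
    have b: "0 < b" by (simp add: b_def)
    define u v where "u = ln (s + b)" and "v = ln (s + b + 1)"
    \<comment> \<open>After cancellation, the telescoping claim is this comparison divided by
      \<open>s * (b + 1)\<close>.\<close>
    have *: "(s + b + 1) * (v - u) \<le> (b + 1) * (ln (b + 1) - ln b)"
      using mult_ln_ratio_antimono[OF b, of "s + b"] s b unfolding u_def v_def by simp
    have "(v - u) * (1 / s + 1 / (b + 1)) \<le> (ln (b + 1) - ln b) / s"
    proof -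
      have "(v - u) * (1 / s + 1 / (b + 1)) = (s + b + 1) * (v - u) / (s * (b + 1))"
        using s b by (simp add: divide_simps)
      also have "\<dots> \<le> (b + 1) * (ln (b + 1) - ln b) / (s * (b + 1))"
        using * s b by (intro divide_right_mono) auto
      also have "\<dots> = (ln (b + 1) - ln b) / s" using s b by simp
      finally show ?thesis .
    qed
    moreover have "\<tau> b - \<tau> (b + 1) = (u - ln s) / (b * (b + 1)) - (v - u) * (1 / s + 1 / (b + 1)) + (ln (b + 1) - ln b) / s"
    proof -
      have "\<tau> b - \<tau> (b + 1) = (u - ln s) / b + (u - ln b) / s - ((v - ln s) / (b + 1) + (v - ln (b + 1)) / s)"
        unfolding \<tau>_def u_def v_def by (simp add: add.assoc)
      also have "\<dots> = (u - ln s) * (1 / b - 1 / (b + 1)) - (v - u) * (1 / s + 1 / (b + 1)) + (ln (b + 1) - ln b) / s"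
        by (simp add: algebra_simps diff_divide_distrib add_divide_distrib)
      also have "1 / b - 1 / (b + 1) = 1 / (b * (b + 1))" using b by (simp add: field_simps)
      finally show ?thesis by simp
    qed
    ultimately have "(u - ln s) / (b * (b + 1)) \<le> \<tau> b - \<tau> (b + 1)" by linarith
    moreover have "u - ln s = ln (1 + b / s)"
      unfolding u_def using s b by (intro ln_diff_eq) auto
    ultimately show ?thesis by (simp add: b_def algebra_simps)
  qed
  have "(\<Sum>i<N. ln (1 + (real i + 1) / s) / ((real i + 1) * (real i + 2)))
      \<le> (\<Sum>i<N. \<tau> (real i + 1) - \<tau> (real (Suc i) + 1))"
    by (intro sum_mono step)
  also have "\<dots> = \<tau> 1 - \<tau> (real N + 1)"
    using sum_lessThan_telescope'[of "\<lambda>i. \<tau> (real i + 1)" N] by simp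
  also have "\<dots> \<le> \<tau> 1"
  proof -
    have "ln s \<le> ln (s + (real N + 1))" "ln (real N + 1) \<le> ln (s + (real N + 1))"
      using s by (auto intro!: ln_mono)
    then have "0 \<le> \<tau> (real N + 1)"
      using s unfolding \<tau>_def by (intro add_nonneg_nonneg divide_nonneg_nonneg) auto
    then show ?thesis by simp
  qed
  also have "\<tau> 1 \<le> 2 * (1 + ln s) / s"
  proof -
    have "ln (s + 1) - ln s = ln (1 + 1 / s)"
      using s by (intro ln_diff_eq) auto
    also have "\<dots> \<le> 1 / s" using s by (intro ln_add_one_self_le_self) auto
    finally have 1: "ln (s + 1) - ln s \<le> 1 / s" .
    have "1 / s \<le> 1" "0 \<le> ln s" using s by auto
    with 1 have "ln (s + 1) \<le> 1 + 2 * ln s" by linarith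
    then have "ln (s + 1) / s \<le> (1 + 2 * ln s) / s" using s by (intro divide_right_mono) auto
    with 1 show ?thesis unfolding \<tau>_def by (simp add: add_divide_distrib)
  qed
  finally show ?thesis .
qed

text \<open>The weights are the upper bounds for the conditional probability of the digit
  \<open>i + 1\<close>. The factor \<open>1 + ln s\<close> produced by the inner logarithm is
  divided out by the outer one, which leaves a pure multiple of \<open>1 / s\<close>.\<close>

lemma sum_lnln_weights_le:
  assumes s: "(1::real) \<le> s"
  shows "(\<Sum>i<N. 2 / ((real i + 1) * (real i + 2)) * (lnln (s + (real i + 1)) - lnln s)) \<le> 4 / s"
proof -
  have ls: "0 \<le> ln s" using s by simp
  have "(\<Sum>i<N. 2 / ((real i + 1) * (real i + 2)) * (lnln (s + (real i + 1)) - lnln s))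
      \<le> (\<Sum>i<N. 2 / (1 + ln s) * (ln (1 + (real i + 1) / s) / ((real i + 1) * (real i + 2))))"
  proof (rule sum_mono)
    fix i
    have "2 / ((real i + 1) * (real i + 2)) * (lnln (s + (real i + 1)) - lnln s)
      \<le> 2 / ((real i + 1) * (real i + 2)) * (ln (1 + (real i + 1) / s) / (1 + ln s))"
      by (intro mult_left_mono lnln_diff_le s) auto
    then show "2 / ((real i + 1) * (real i + 2)) * (lnln (s + (real i + 1)) - lnln s)
      \<le> 2 / (1 + ln s) * (ln (1 + (real i + 1) / s) / ((real i + 1) * (real i + 2)))"
      by (simp add: mult_ac)
  qed
  also have "\<dots> = 2 / (1 + ln s) * (\<Sum>i<N. ln (1 + (real i + 1) / s) / ((real i + 1) * (real i + 2)))"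
    by (rule sum_distrib_left[symmetric])
  also have "\<dots> \<le> 2 / (1 + ln s) * (2 * (1 + ln s) / s)"
    using ls by (intro mult_left_mono sum_ln_weights_le s) auto
  also have "\<dots> = 4 / s"
  proof -
    have "2 / L * (2 * L / s) = 4 / s" if "L \<noteq> 0" for L using that by simp
    from this[of "1 + ln s"] show ?thesis using ls by linarith
  qed
  finally show ?thesis .
qed

text \<open>Bounds the conditional mean of the increment by splitting each cylinder according to its
  next digit; \<open>u\<close> is an arbitrary weight known at level \<open>n\<close>. The condition
  \<open>1 \<le> n\<close> gives access to the length formula for cylinders of positive
  level.\<close>

lemma lnln_increment:
  assumes u: "digit_fun n u" and n: "1 \<le> n"
  shows "(\<integral>\<^sup>+\<alpha>. u \<alpha> * ennreal (lnln (cf_S (Suc n) \<alpha>) - lnln (cf_S n \<alpha>)) \<partial>irr_measure)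
    \<le> (\<integral>\<^sup>+\<alpha>. u \<alpha> * ennreal (4 / cf_S n \<alpha>) \<partial>irr_measure)"
proof (rule cylinderwise_le[OF u])
  have dg: "digit_fun (Suc n) (\<lambda>\<alpha>. lnln (cf_S (Suc n) \<alpha>) - lnln (cf_S n \<alpha>))"
    using cf_S_digit_fun[of "Suc n"] digit_fun_mono[OF cf_S_digit_fun[of n], of "Suc n"]
    by (auto simp: digit_fun_def)
  show "(\<lambda>\<alpha>. ennreal (lnln (cf_S (Suc n) \<alpha>) - lnln (cf_S n \<alpha>))) \<in> borel_measurable irr_measure"
    by (rule digit_fun_borel[OF digit_fun_ennreal[OF dg]])
  have dS: "digit_fun n (\<lambda>\<alpha>. ennreal (4 / cf_S n \<alpha>))"
    using cf_S_digit_fun[of n] by (auto simp: digit_fun_def)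
  show "(\<lambda>\<alpha>. ennreal (4 / cf_S n \<alpha>)) \<in> borel_measurable irr_measure"
    by (rule digit_fun_borel[OF dS])
  fix \<beta> assume \<beta>: "\<beta> \<in> irr"
  obtain m where m: "n = Suc m" using n by (cases n) auto
  define s where "s = cf_S n \<beta>"
  have s: "1 \<le> s" using cf_S_ge_1[OF \<beta>] by (simp add: s_def)
  define X where "X i = {\<alpha> \<in> cyl n \<beta>. cf_a \<alpha> (Suc n) = int i + 1}" for i :: nat
  have X: "X i \<in> sets lborel" "emeasure lborel (X i) \<le> ennreal (2 / ((real i + 1) * (real i + 2))) * emeasure lborel (cyl n \<beta>)" for i
    using cyl_digit_measure(1,2)[OF \<beta>, of "int i + 1" m] unfolding X_def m by (auto simp: add.assoc)
  have XI: "X i \<in> sets irr_measure" for i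
    using X(1)[of i] cyl_subset_irr[of n \<beta>] by (auto simp: sets_irr_measure X_def)
  define h where "h i = ennreal (lnln (s + (real i + 1)) - lnln s)" for i
  have "(\<integral>\<^sup>+\<alpha>. ennreal (lnln (cf_S (Suc n) \<alpha>) - lnln (cf_S n \<alpha>)) * indicator (cyl n \<beta>) \<alpha> \<partial>irr_measure)
      = (\<integral>\<^sup>+\<alpha>. (\<Sum>i. h i * indicator (X i) \<alpha>) \<partial>irr_measure)"
  proof (rule nn_integral_cong)
    fix \<alpha> assume "\<alpha> \<in> space irr_measure"
    then have \<alpha>: "\<alpha> \<in> irr" by simp
    show "ennreal (lnln (cf_S (Suc n) \<alpha>) - lnln (cf_S n \<alpha>)) * indicator (cyl n \<beta>) \<alpha> = (\<Sum>i. h i * indicator (X i) \<alpha>)"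
    proof (cases "\<alpha> \<in> cyl n \<beta>")
      case True
      define i where "i = nat (cf_a \<alpha> (Suc n) - 1)"
      have i: "cf_a \<alpha> (Suc n) = int i + 1" using cf_a_ge_1[OF \<alpha>, of n] by (simp add: i_def)
      have "(\<Sum>i. h i * indicator (X i) \<alpha>) = h i"
        using True i by (intro suminf_cmult_indicator) (auto simp: X_def disjoint_family_on_def)
      moreover have "cf_S n \<alpha> = s"
        using digit_funD[OF cf_S_digit_fun \<alpha> \<beta>] True by (auto simp: cyl_def s_def)
      ultimately show ?thesis using True by (simp add: h_def cf_S_Suc i add.assoc)
    next
      case False
      then show ?thesis by (simp add: X_def)
    qed
  qed
  also have "\<dots> = (\<Sum>i. \<integral>\<^sup>+\<alpha>. h i * indicator (X i) \<alpha> \<partial>irr_measure)"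
    using XI by (intro nn_integral_suminf) auto
  also have "\<dots> = (\<Sum>i. h i * emeasure lborel (X i))"
    using XI by (simp add: nn_integral_cmult_indicator emeasure_irr_measure sets_irr_measure)
  also have "\<dots> \<le> (\<Sum>i. ennreal (2 / ((real i + 1) * (real i + 2)) * (lnln (s + (real i + 1)) - lnln s)) * emeasure lborel (cyl n \<beta>))"
  proof (rule suminf_le)
    fix i
    have d: "0 \<le> lnln (s + (real i + 1)) - lnln s" using lnln_mono[OF s, of "s + (real i + 1)"] by simp
    have "h i * emeasure lborel (X i) \<le> h i * (ennreal (2 / ((real i + 1) * (real i + 2))) * emeasure lborel (cyl n \<beta>))"
      by (intro mult_left_mono X) auto
    also have "\<dots> = ennreal (2 / ((real i + 1) * (real i + 2)) * (lnln (s + (real i + 1)) - lnln s)) * emeasure lborel (cyl n \<beta>)"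
      using d by (subst ennreal_mult) (auto simp: h_def mult_ac)
    finally show "h i * emeasure lborel (X i) \<le> ennreal (2 / ((real i + 1) * (real i + 2)) * (lnln (s + (real i + 1)) - lnln s)) * emeasure lborel (cyl n \<beta>)" .
  qed auto
  also have "\<dots> = (\<Sum>i. ennreal (2 / ((real i + 1) * (real i + 2)) * (lnln (s + (real i + 1)) - lnln s))) * emeasure lborel (cyl n \<beta>)"
    by simp
  also have "\<dots> \<le> ennreal (4 / s) * emeasure lborel (cyl n \<beta>)"
  proof (intro mult_right_mono suminf_le_const)
    fix N
    have "(\<Sum>i<N. ennreal (2 / ((real i + 1) * (real i + 2)) * (lnln (s + (real i + 1)) - lnln s)))
      = ennreal (\<Sum>i<N. 2 / ((real i + 1) * (real i + 2)) * (lnln (s + (real i + 1)) - lnln s))"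
      using lnln_mono[OF s] by (intro sum_ennreal mult_nonneg_nonneg) auto
    also have "\<dots> \<le> ennreal (4 / s)" by (intro ennreal_leI sum_lnln_weights_le s)
    finally show "(\<Sum>i<N. ennreal (2 / ((real i + 1) * (real i + 2)) * (lnln (s + (real i + 1)) - lnln s))) \<le> ennreal (4 / s)" .
  qed auto
  also have "\<dots> = (\<integral>\<^sup>+\<alpha>. ennreal (4 / cf_S n \<alpha>) * indicator (cyl n \<beta>) \<alpha> \<partial>irr_measure)"
    using nn_integral_const_cyl[OF \<beta> dS] by (simp add: s_def)
  finally show "(\<integral>\<^sup>+\<alpha>. ennreal (lnln (cf_S (Suc n) \<alpha>) - lnln (cf_S n \<alpha>)) * indicator (cyl n \<beta>) \<alpha> \<partial>irr_measure)
      \<le> (\<integral>\<^sup>+\<alpha>. ennreal (4 / cf_S n \<alpha>) * indicator (cyl n \<beta>) \<alpha> \<partial>irr_measure)" .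
qed

lemma lnln_S_measurable: "(\<lambda>\<alpha>. ennreal (lnln (cf_S n \<alpha>))) \<in> borel_measurable irr_measure"
  using cf_S_digit_fun[of n] by (intro digit_fun_borel[of n]) (auto simp: digit_fun_def)

lemma inverse_S_measurable: "(\<lambda>\<alpha>. ennreal (c / cf_S n \<alpha>)) \<in> borel_measurable irr_measure"
  using cf_S_digit_fun[of n] by (intro digit_fun_borel[of n]) (auto simp: digit_fun_def)

text \<open>A function of the first \<open>n\<close> digits is also one of any larger number of
  digits, so the one-step bound iterates; as digit sums increase, every step costs at most
  \<open>4 / cf_S n\<close>.\<close>

lemma lnln_increments:
  assumes u: "digit_fun n u" and n: "1 \<le> n"
  shows "(\<integral>\<^sup>+\<alpha>. u \<alpha> * ennreal (lnln (cf_S (n + L) \<alpha>)) \<partial>irr_measure)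
    \<le> (\<integral>\<^sup>+\<alpha>. u \<alpha> * ennreal (lnln (cf_S n \<alpha>)) \<partial>irr_measure)
      + (\<integral>\<^sup>+\<alpha>. u \<alpha> * ennreal (4 * real L / cf_S n \<alpha>) \<partial>irr_measure)"
proof (induction L)
  case 0
  then show ?case by simp
next
  case (Suc L)
  note digit_fun_borel[OF u, measurable] lnln_S_measurable[measurable] inverse_S_measurable[measurable]
  have uL: "digit_fun (n + L) u" by (rule digit_fun_mono[OF u]) simp
  have dgm [measurable]: "(\<lambda>\<alpha>. ennreal (lnln (cf_S (Suc m) \<alpha>) - lnln (cf_S m \<alpha>))) \<in> borel_measurable irr_measure" for m
    using cf_S_digit_fun[of "Suc m"] digit_fun_mono[OF cf_S_digit_fun[of m], of "Suc m"]
    by (intro digit_fun_borel[of "Suc m"]) (auto simp: digit_fun_def)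
  have "(\<integral>\<^sup>+\<alpha>. u \<alpha> * ennreal (lnln (cf_S (n + Suc L) \<alpha>)) \<partial>irr_measure)
     = (\<integral>\<^sup>+\<alpha>. u \<alpha> * ennreal (lnln (cf_S (n + L) \<alpha>))
          + u \<alpha> * ennreal (lnln (cf_S (Suc (n + L)) \<alpha>) - lnln (cf_S (n + L) \<alpha>)) \<partial>irr_measure)"
  proof (rule nn_integral_cong)
    fix \<alpha> assume "\<alpha> \<in> space irr_measure"
    then have \<alpha>: "\<alpha> \<in> irr" by simp
    have "0 \<le> lnln (cf_S (n + L) \<alpha>)" "lnln (cf_S (n + L) \<alpha>) \<le> lnln (cf_S (Suc (n + L)) \<alpha>)"
      using cf_S_mono[OF \<alpha>, of "n + L" "Suc (n + L)"] cf_S_ge_1[OF \<alpha>]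
      by (auto intro!: lnln_nonneg lnln_mono)
    then have "ennreal (lnln (cf_S (n + Suc L) \<alpha>)) = ennreal (lnln (cf_S (n + L) \<alpha>))
        + ennreal (lnln (cf_S (Suc (n + L)) \<alpha>) - lnln (cf_S (n + L) \<alpha>))"
      by (subst ennreal_plus[symmetric]) auto
    then show "u \<alpha> * ennreal (lnln (cf_S (n + Suc L) \<alpha>)) = u \<alpha> * ennreal (lnln (cf_S (n + L) \<alpha>))
          + u \<alpha> * ennreal (lnln (cf_S (Suc (n + L)) \<alpha>) - lnln (cf_S (n + L) \<alpha>))"
      by (simp add: distrib_left)
  qed
  also have "\<dots> = (\<integral>\<^sup>+\<alpha>. u \<alpha> * ennreal (lnln (cf_S (n + L) \<alpha>)) \<partial>irr_measure)
      + (\<integral>\<^sup>+\<alpha>. u \<alpha> * ennreal (lnln (cf_S (Suc (n + L)) \<alpha>) - lnln (cf_S (n + L) \<alpha>)) \<partial>irr_measure)"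
    by (intro nn_integral_add) measurable
  also have "\<dots> \<le> ((\<integral>\<^sup>+\<alpha>. u \<alpha> * ennreal (lnln (cf_S n \<alpha>)) \<partial>irr_measure)
      + (\<integral>\<^sup>+\<alpha>. u \<alpha> * ennreal (4 * real L / cf_S n \<alpha>) \<partial>irr_measure))
      + (\<integral>\<^sup>+\<alpha>. u \<alpha> * ennreal (4 / cf_S n \<alpha>) \<partial>irr_measure)"
  proof (rule add_mono[OF Suc.IH], rule order_trans)
    show "(\<integral>\<^sup>+\<alpha>. u \<alpha> * ennreal (lnln (cf_S (Suc (n + L)) \<alpha>) - lnln (cf_S (n + L) \<alpha>)) \<partial>irr_measure)
      \<le> (\<integral>\<^sup>+\<alpha>. u \<alpha> * ennreal (4 / cf_S (n + L) \<alpha>) \<partial>irr_measure)"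
      using n by (intro lnln_increment uL) auto
    show "(\<integral>\<^sup>+\<alpha>. u \<alpha> * ennreal (4 / cf_S (n + L) \<alpha>) \<partial>irr_measure)
       \<le> (\<integral>\<^sup>+\<alpha>. u \<alpha> * ennreal (4 / cf_S n \<alpha>) \<partial>irr_measure)"
    proof (intro nn_integral_mono mult_left_mono ennreal_leI divide_left_mono)
      fix \<alpha> assume "\<alpha> \<in> space irr_measure"
      then have \<alpha>: "\<alpha> \<in> irr" by simp
      show "cf_S n \<alpha> \<le> cf_S (n + L) \<alpha>" by (rule cf_S_mono[OF \<alpha>]) simp
      show "0 < cf_S (n + L) \<alpha> * cf_S n \<alpha>"
        using cf_S_ge_1[OF \<alpha>, of n] cf_S_ge_1[OF \<alpha>, of "n + L"] by simp
    qed auto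
  qed
  also have "\<dots> = (\<integral>\<^sup>+\<alpha>. u \<alpha> * ennreal (lnln (cf_S n \<alpha>)) \<partial>irr_measure)
      + ((\<integral>\<^sup>+\<alpha>. u \<alpha> * ennreal (4 * real L / cf_S n \<alpha>) \<partial>irr_measure)
      + (\<integral>\<^sup>+\<alpha>. u \<alpha> * ennreal (4 / cf_S n \<alpha>) \<partial>irr_measure))" by (simp only: add.assoc)
  also have "(\<integral>\<^sup>+\<alpha>. u \<alpha> * ennreal (4 * real L / cf_S n \<alpha>) \<partial>irr_measure)
      + (\<integral>\<^sup>+\<alpha>. u \<alpha> * ennreal (4 / cf_S n \<alpha>) \<partial>irr_measure)
     = (\<integral>\<^sup>+\<alpha>. u \<alpha> * ennreal (4 * real L / cf_S n \<alpha>) + u \<alpha> * ennreal (4 / cf_S n \<alpha>) \<partial>irr_measure)"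
    by (intro nn_integral_add[symmetric]) measurable
  also have "\<dots> = (\<integral>\<^sup>+\<alpha>. u \<alpha> * ennreal (4 * real (Suc L) / cf_S n \<alpha>) \<partial>irr_measure)"
  proof (rule nn_integral_cong)
    fix \<alpha> assume "\<alpha> \<in> space irr_measure"
    then have "0 < cf_S n \<alpha>" using cf_S_ge_1[of \<alpha> n] by simp
    then have "ennreal (4 * real L / cf_S n \<alpha>) + ennreal (4 / cf_S n \<alpha>) = ennreal (4 * real (Suc L) / cf_S n \<alpha>)"
      by (subst ennreal_plus[symmetric]) (auto simp: add_divide_distrib[symmetric] algebra_simps)
    then show "u \<alpha> * ennreal (4 * real L / cf_S n \<alpha>) + u \<alpha> * ennreal (4 / cf_S n \<alpha>) = u \<alpha> * ennreal (4 * real (Suc L) / cf_S n \<alpha>)"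
      by (simp add: distrib_left[symmetric])
  qed
  finally show ?case .
qed

section \<open>Prescribing denominators modulo D\<close>

text \<open>Take for \<open>k\<close> the product of the primes of \<open>D\<close> that do not
  divide \<open>y\<close>. A prime of \<open>D\<close> dividing \<open>y\<close> divides neither
  \<open>k\<close> nor \<open>x\<close>; any other one divides \<open>k\<close> but not
  \<open>y\<close>. So no prime of \<open>D\<close> divides \<open>k * x + y\<close>.\<close>

lemma exists_coprime_combination:
  fixes x y D :: int
  assumes "coprime x y" "1 \<le> D"
  shows "\<exists>b. 1 \<le> b \<and> b \<le> D \<and> coprime (b * x + y) D"
proof -
  define k where "k = \<Prod>{p. p \<in> prime_factors D \<and> \<not> p dvd y}"
  have cop: "coprime (k * x + y) D"
  proof (rule ccontr)
    assume "\<not> coprime (k * x + y) D"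
    then have "gcd (k * x + y) D \<noteq> 0" "\<not> is_unit (gcd (k * x + y) D)"
      using assms(2) by (auto simp: is_unit_gcd)
    then obtain p where "prime p" "p dvd gcd (k * x + y) D"
      using prime_divisor_exists by blast
    then have p: "prime p" "p dvd k * x + y" "p dvd D" by auto
    have pD: "p \<in> prime_factors D" using p assms(2) by (simp add: in_prime_factors_iff)
    show False
    proof (cases "p dvd y")
      case True
      then have "p dvd k * x" using p(2) by (simp add: dvd_add_left_iff)
      moreover have "\<not> p dvd x"
        using True assms(1) p(1) by (meson coprime_common_divisor not_prime_unit)
      ultimately have "p dvd k" using p(1) by (simp add: prime_dvd_mult_iff)
      then obtain r where "r \<in> prime_factors D" "\<not> r dvd y" "p dvd r"
        unfolding k_def using p(1) by (subst (asm) prime_dvd_prod_iff) auto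
      then have "p = r" using p(1) by (simp add: primes_dvd_imp_eq in_prime_factors_iff)
      with True \<open>\<not> r dvd y\<close> show False by simp
    next
      case False
      then have "p dvd k" unfolding k_def using pD by (intro dvd_prodI) auto
      then have "p dvd y" using p(2) by (simp add: dvd_add_right_iff)
      with False show False by simp
    qed
  qed
  \<comment> \<open>Digits are at least 1, so the residue class is represented in the range from 1
    to \<open>D\<close> instead of 0 to \<open>D - 1\<close>.\<close>
  define b where "b = (k - 1) mod D + 1"
  define t where "t = (k - 1) div D"
  have t: "k = b + D * t" unfolding b_def t_def using mult_div_mod_eq[of D "k - 1"] by linarith
  have "coprime (b * x + y) D"
  proof (rule coprimeI)
    fix c assume c: "c dvd b * x + y" "c dvd D"
    have "k * x + y = (b * x + y) + D * (t * x)" by (simp add: t algebra_simps)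
    also have "c dvd \<dots>" by (rule dvd_add[OF c(1) dvd_mult2[OF c(2)]])
    finally have "c dvd k * x + y" .
    then show "is_unit c" using cop c(2) by (meson coprime_common_divisor)
  qed
  moreover have "1 \<le> b" "b \<le> D"
    using pos_mod_sign[of D "k - 1"] pos_mod_bound[of D "k - 1"] assms(2) unfolding b_def by linarith+
  ultimately show ?thesis by blast
qed

text \<open>Bezout inverts \<open>z\<close> modulo \<open>D\<close>. For consecutive denominators
  \<open>x\<close> and \<open>z\<close>, this picks a digit that makes the following denominator 1
  modulo \<open>D\<close>.\<close>

lemma exists_combination_cong_1:
  fixes z x D :: int
  assumes "coprime z D" "1 \<le> D"
  shows "\<exists>b. 1 \<le> b \<and> b \<le> D \<and> D dvd b * z + x - 1"
proof -
  obtain u v where uv: "u * z + v * D = 1"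
    using bezout_int[of z D] assms(1) by auto
  define k where "k = u * (1 - x)"
  have "k * z + x - 1 = (1 - x) * (u * z + v * D) - (1 - x) - (1 - x) * v * D"
    by (simp add: k_def algebra_simps)
  then have k: "D dvd k * z + x - 1" unfolding uv by simp
  define b where "b = (k - 1) mod D + 1"
  define t where "t = (k - 1) div D"
  have t: "k = b + D * t" unfolding b_def t_def using mult_div_mod_eq[of D "k - 1"] by linarith
  have "b * z + x - 1 = (k * z + x - 1) - D * (t * z)" by (simp add: t algebra_simps)
  also have "D dvd \<dots>" by (rule dvd_diff[OF k dvd_triv_left])
  finally have "D dvd b * z + x - 1" .
  moreover have "1 \<le> b" "b \<le> D"
    using pos_mod_sign[of D "k - 1"] pos_mod_bound[of D "k - 1"] assms(2) unfolding b_def by linarith+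
  ultimately show ?thesis by blast
qed

section \<open>Metric theory of large partial quotients\<close>

lemma cyl_extend_measure:
  assumes \<beta>: "\<beta> \<in> irr" and n: "1 \<le> n" and b: "1 \<le> b" "b \<le> D"
  obtains \<gamma> where "\<gamma> \<in> cyl n \<beta>" "cf_a \<gamma> (Suc n) = b"
    "ennreal (1 / (6 * (real_of_int D)\<^sup>2)) * emeasure lborel (cyl n \<beta>) \<le> emeasure lborel (cyl (Suc n) \<gamma>)"
proof -
  obtain m where m: "n = Suc m" using n by (cases n) auto
  obtain \<gamma> where \<gamma>: "\<gamma> \<in> cyl n \<beta>" "cf_a \<gamma> (Suc n) = b"
    using cyl_extend[OF \<beta> b(1), of m] unfolding m by blast
  have "1 / (6 * (real_of_int D)\<^sup>2) \<le> 1 / (6 * (real_of_int b)\<^sup>2)"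
    using b by (intro divide_left_mono mult_left_mono power_mono) (auto intro!: mult_pos_pos)
  then have "ennreal (1 / (6 * (real_of_int D)\<^sup>2)) * emeasure lborel (cyl n \<beta>)
      \<le> ennreal (1 / (6 * (real_of_int b)\<^sup>2)) * emeasure lborel (cyl n \<beta>)"
    by (intro mult_right_mono ennreal_leI) auto
  also have "\<dots> \<le> emeasure lborel {\<alpha> \<in> cyl n \<beta>. cf_a \<alpha> (Suc n) = b}"
    using cyl_digit_measure(3)[OF \<beta> b(1), of m] unfolding m by simp
  also have "{\<alpha> \<in> cyl n \<beta>. cf_a \<alpha> (Suc n) = b} = cyl (Suc n) \<gamma>"
    using cyl_digit_eq[OF \<gamma>(1)] \<gamma>(2) by simp
  finally show thesis using that \<gamma> by blast
qed

text \<open>The digits from \<open>T\<close> to \<open>2 * T - 1\<close> suffice: there are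
  \<open>T\<close> of them, each of conditional probability at least
  \<open>1 / (6 * (2 * T)^2)\<close>.\<close>

lemma cyl_large_digit_measure:
  assumes \<beta>: "\<beta> \<in> irr" and n: "1 \<le> n" and T: "1 \<le> T"
  shows "ennreal (1 / (24 * real_of_int T)) * emeasure lborel (cyl n \<beta>)
    \<le> emeasure lborel {\<alpha> \<in> cyl n \<beta>. T \<le> cf_a \<alpha> (Suc n)}"
    and "{\<alpha> \<in> cyl n \<beta>. T \<le> cf_a \<alpha> (Suc n)} \<in> sets lborel"
proof -
  obtain m where m: "n = Suc m" using n by (cases n) auto
  define X where "X b = {\<alpha> \<in> cyl n \<beta>. cf_a \<alpha> (Suc n) = b}" for b
  have X: "X b \<in> sets lborel" "ennreal (1 / (6 * (real_of_int b)\<^sup>2)) * emeasure lborel (cyl n \<beta>) \<le> emeasure lborel (X b)"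
    if "1 \<le> b" for b
    using cyl_digit_measure(1,3)[OF \<beta> that, of m] unfolding m X_def by auto
  have "{\<alpha> \<in> cyl n \<beta>. T \<le> cf_a \<alpha> (Suc n)} = (\<Union>b\<in>{T..}. X b)" by (auto simp: X_def)
  also have "\<dots> \<in> sets lborel" using X(1) T by (intro sets.countable_UN') auto
  finally show sets: "{\<alpha> \<in> cyl n \<beta>. T \<le> cf_a \<alpha> (Suc n)} \<in> sets lborel" .
  have "ennreal (1 / (24 * real_of_int T)) * emeasure lborel (cyl n \<beta>)
     = (\<Sum>b\<in>{T..<2*T}. ennreal (1 / (24 * (real_of_int T)\<^sup>2)) * emeasure lborel (cyl n \<beta>))"
    using T by (simp add: mult.assoc[symmetric] ennreal_of_nat_eq_real_of_nat ennreal_mult'[symmetric] power2_eq_square)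
  also have "\<dots> \<le> (\<Sum>b\<in>{T..<2*T}. emeasure lborel (X b))"
  proof (rule sum_mono)
    fix b assume b: "b \<in> {T..<2*T}"
    then have "(real_of_int b)\<^sup>2 \<le> (2 * real_of_int T)\<^sup>2" using T by (intro power_mono) auto
    then have "1 / (24 * (real_of_int T)\<^sup>2) \<le> 1 / (6 * (real_of_int b)\<^sup>2)"
      using b T by (intro divide_left_mono) (auto simp: power_mult_distrib intro!: mult_pos_pos)
    then have "ennreal (1 / (24 * (real_of_int T)\<^sup>2)) * emeasure lborel (cyl n \<beta>)
        \<le> ennreal (1 / (6 * (real_of_int b)\<^sup>2)) * emeasure lborel (cyl n \<beta>)"
      by (intro mult_right_mono ennreal_leI) auto
    also have "\<dots> \<le> emeasure lborel (X b)" using b T by (intro X) auto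
    finally show "ennreal (1 / (24 * (real_of_int T)\<^sup>2)) * emeasure lborel (cyl n \<beta>) \<le> emeasure lborel (X b)" .
  qed
  also have "\<dots> = emeasure lborel (\<Union>b\<in>{T..<2*T}. X b)"
    using X(1) T by (intro sum_emeasure) (auto simp: disjoint_family_on_def X_def)
  also have "\<dots> \<le> emeasure lborel {\<alpha> \<in> cyl n \<beta>. T \<le> cf_a \<alpha> (Suc n)}"
    using sets by (intro emeasure_mono) (auto simp: X_def)
  finally show "ennreal (1 / (24 * real_of_int T)) * emeasure lborel (cyl n \<beta>)
    \<le> emeasure lborel {\<alpha> \<in> cyl n \<beta>. T \<le> cf_a \<alpha> (Suc n)}" .
qed

definition good_index :: "int \<Rightarrow> int \<Rightarrow> bool \<Rightarrow> real \<Rightarrow> nat \<Rightarrow> bool" where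
  "good_index D A e \<alpha> k \<longleftrightarrow> D dvd cf_q \<alpha> k - 1 \<and> even k = e \<and>
     A * (\<Sum>i=1..k. cf_a \<alpha> i) \<le> cf_a \<alpha> (Suc k)"

lemma good_index_cong: "cf_agree n \<alpha> \<beta> \<Longrightarrow> Suc k \<le> n \<Longrightarrow> good_index D A e \<alpha> k = good_index D A e \<beta> k"
proof -
  assume *: "cf_agree n \<alpha> \<beta>" "Suc k \<le> n"
  have "(\<Sum>i=1..k. cf_a \<alpha> i) = (\<Sum>i=1..k. cf_a \<beta> i)"
    using * by (intro sum.cong) (auto simp: cf_agree_a)
  moreover have "cf_q \<alpha> k = cf_q \<beta> k" using * by (intro cf_agree_q) auto
  moreover have "cf_a \<alpha> (Suc k) = cf_a \<beta> (Suc k)" using * by (intro cf_agree_a) auto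
  ultimately show ?thesis by (simp add: good_index_def)
qed

lemma cyl_trans: "\<gamma> \<in> cyl m \<beta> \<Longrightarrow> \<delta> \<in> cyl n \<gamma> \<Longrightarrow> m \<le> n \<Longrightarrow> \<delta> \<in> cyl m \<beta>"
  unfolding cyl_def by (auto intro: cf_agree_trans cf_agree_mono)

lemma cf_q_step: "1 \<le> n \<Longrightarrow> cf_q \<alpha> (Suc n) = cf_a \<alpha> (Suc n) * cf_q \<alpha> n + cf_q \<alpha> (n - 1)"
  by (cases n) auto

lemma cf_q_cyl: "\<gamma> \<in> cyl n \<beta> \<Longrightarrow> m \<le> n \<Longrightarrow> cf_q \<gamma> m = cf_q \<beta> m"
  by (auto simp: cyl_def intro: cf_agree_q)

text \<open>One digit makes the denominator coprime to \<open>D\<close>, the next makes it 1 modulo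
  \<open>D\<close>. If the index then has the wrong parity, a third digit restores the residue, as a
  denominator that is 1 modulo \<open>D\<close> is coprime to \<open>D\<close>. All these digits are
  at most \<open>D\<close>, which bounds both the loss of measure and the growth of
  \<open>cf_S\<close>.\<close>

lemma reach_residue:
  assumes \<beta>: "\<beta> \<in> irr" and n: "1 \<le> n" and D: "1 \<le> D"
  obtains \<gamma> k where "\<gamma> \<in> cyl n \<beta>" "n \<le> k" "k < n + 4" "D dvd cf_q \<gamma> k - 1" "even k = e"
    "cf_S k \<gamma> \<le> cf_S n \<beta> + 3 * real_of_int D"
    "ennreal ((1 / (6 * (real_of_int D)\<^sup>2)) ^ 3) * emeasure lborel (cyl n \<beta>) \<le> emeasure lborel (cyl k \<gamma>)"
proof -
  define c where "c = 1 / (6 * (real_of_int D)\<^sup>2)"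
  have c: "0 \<le> c" "c \<le> 1"
  proof -
    have "1 \<le> (real_of_int D)\<^sup>2" using D by (intro one_le_power) auto
    then have "1 \<le> 6 * (real_of_int D)\<^sup>2" by linarith
    then show "0 \<le> c" "c \<le> 1" unfolding c_def by (simp_all only: divide_le_eq_1) auto
  qed
  have cop: "coprime (cf_q \<beta> n) (cf_q \<beta> (n - 1))"
    using coprime_cf_q[of \<beta> "n - 1"] n by simp
  obtain b1 where b1: "1 \<le> b1" "b1 \<le> D" "coprime (b1 * cf_q \<beta> n + cf_q \<beta> (n - 1)) D"
    using exists_coprime_combination[OF cop D] by blast
  obtain \<gamma>1 where g1: "\<gamma>1 \<in> cyl n \<beta>" "cf_a \<gamma>1 (Suc n) = b1"
    and m1: "ennreal c * emeasure lborel (cyl n \<beta>) \<le> emeasure lborel (cyl (Suc n) \<gamma>1)"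
    using cyl_extend_measure[OF \<beta> n b1(1,2)] unfolding c_def by blast
  have i1: "\<gamma>1 \<in> irr" using g1(1) cyl_subset_irr by blast
  have q1: "coprime (cf_q \<gamma>1 (Suc n)) D"
    using b1(3) cf_q_step[OF n, of \<gamma>1] g1 cf_q_cyl[OF g1(1), of n] cf_q_cyl[OF g1(1), of "n - 1"] by simp
  obtain b2 where b2: "1 \<le> b2" "b2 \<le> D" "D dvd b2 * cf_q \<gamma>1 (Suc n) + cf_q \<gamma>1 n - 1"
    using exists_combination_cong_1[OF q1 D] by blast
  obtain \<gamma>2 where g2: "\<gamma>2 \<in> cyl (Suc n) \<gamma>1" "cf_a \<gamma>2 (Suc (Suc n)) = b2"
    and m2: "ennreal c * emeasure lborel (cyl (Suc n) \<gamma>1) \<le> emeasure lborel (cyl (Suc (Suc n)) \<gamma>2)"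
    using cyl_extend_measure[OF i1 _ b2(1,2), of "Suc n"] unfolding c_def by auto
  have i2: "\<gamma>2 \<in> irr" using g2(1) cyl_subset_irr by blast
  have q2: "D dvd cf_q \<gamma>2 (Suc (Suc n)) - 1"
    using b2(3) g2(2) cf_q_cyl[OF g2(1), of n] cf_q_cyl[OF g2(1), of "Suc n"] by simp
  have S1: "cf_S (Suc n) \<gamma>1 \<le> cf_S n \<beta> + real_of_int D"
    using digit_funD[OF cf_S_digit_fun i1 \<beta>, of n] g1 b1 by (auto simp: cf_S_Suc cyl_def)
  have S2: "cf_S (Suc (Suc n)) \<gamma>2 \<le> cf_S n \<beta> + 2 * real_of_int D"
    using digit_funD[OF cf_S_digit_fun i2 i1, of "Suc n"] g2 b2 S1 by (auto simp: cf_S_Suc[of "Suc n"] cyl_def)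
  have m2': "ennreal (c ^ 2) * emeasure lborel (cyl n \<beta>) \<le> emeasure lborel (cyl (Suc (Suc n)) \<gamma>2)"
  proof -
    have "ennreal (c ^ 2) * emeasure lborel (cyl n \<beta>) = ennreal c * (ennreal c * emeasure lborel (cyl n \<beta>))"
      using c by (simp add: power2_eq_square ennreal_mult mult.assoc)
    also have "\<dots> \<le> ennreal c * emeasure lborel (cyl (Suc n) \<gamma>1)" by (intro mult_left_mono m1) auto
    finally show ?thesis using m2 by (rule order_trans)
  qed
  have g2': "\<gamma>2 \<in> cyl n \<beta>" using cyl_trans[OF g1(1) g2(1)] by simp
  show thesis
  proof (cases "even n = e")
    case True
    have "c ^ 3 \<le> c ^ 2" using c by (intro power_decreasing) auto
    then have "ennreal (c ^ 3) * emeasure lborel (cyl n \<beta>) \<le> ennreal (c ^ 2) * emeasure lborel (cyl n \<beta>)"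
      by (intro mult_right_mono ennreal_leI) auto
    then have "ennreal (c ^ 3) * emeasure lborel (cyl n \<beta>) \<le> emeasure lborel (cyl (Suc (Suc n)) \<gamma>2)"
      using m2' by (rule order_trans)
    moreover have "cf_S (Suc (Suc n)) \<gamma>2 \<le> cf_S n \<beta> + 3 * real_of_int D" using S2 D by simp
    ultimately show thesis using that[OF g2' _ _ q2] True unfolding c_def by simp
  next
    case False
    have "coprime (cf_q \<gamma>2 (Suc (Suc n))) D"
    proof (rule coprimeI)
      fix x assume x: "x dvd cf_q \<gamma>2 (Suc (Suc n))" "x dvd D"
      have "x dvd cf_q \<gamma>2 (Suc (Suc n)) - (cf_q \<gamma>2 (Suc (Suc n)) - 1)"
        by (rule dvd_diff[OF x(1) dvd_trans[OF x(2) q2]])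
      then show "is_unit x" by (simp del: cf_q.simps)
    qed
    then obtain b3 where b3: "1 \<le> b3" "b3 \<le> D" "D dvd b3 * cf_q \<gamma>2 (Suc (Suc n)) + cf_q \<gamma>2 (Suc n) - 1"
      using exists_combination_cong_1[OF _ D] by blast
    obtain \<gamma>3 where g3: "\<gamma>3 \<in> cyl (Suc (Suc n)) \<gamma>2" "cf_a \<gamma>3 (Suc (Suc (Suc n))) = b3"
      and m3: "ennreal c * emeasure lborel (cyl (Suc (Suc n)) \<gamma>2) \<le> emeasure lborel (cyl (Suc (Suc (Suc n))) \<gamma>3)"
      using cyl_extend_measure[OF i2 _ b3(1,2), of "Suc (Suc n)"] unfolding c_def by auto
    have i3: "\<gamma>3 \<in> irr" using g3(1) cyl_subset_irr by blast
    have q3: "D dvd cf_q \<gamma>3 (Suc (Suc (Suc n))) - 1"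
      using b3(3) g3(2) cf_q_cyl[OF g3(1), of "Suc n"] cf_q_cyl[OF g3(1), of "Suc (Suc n)"] cf_q_step[of "Suc (Suc n)" \<gamma>3]
      by (simp del: cf_q.simps)
    have S3: "cf_S (Suc (Suc (Suc n))) \<gamma>3 \<le> cf_S n \<beta> + 3 * real_of_int D"
      using digit_funD[OF cf_S_digit_fun i3 i2, of "Suc (Suc n)"] g3 b3 S2
      by (auto simp: cf_S_Suc[of "Suc (Suc n)"] cyl_def)
    have "ennreal (c ^ 3) * emeasure lborel (cyl n \<beta>) = ennreal c * (ennreal (c ^ 2) * emeasure lborel (cyl n \<beta>))"
      using c by (simp add: power3_eq_cube power2_eq_square ennreal_mult mult.assoc)
    also have "\<dots> \<le> ennreal c * emeasure lborel (cyl (Suc (Suc n)) \<gamma>2)" by (intro mult_left_mono m2') auto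
    finally have "ennreal (c ^ 3) * emeasure lborel (cyl n \<beta>) \<le> emeasure lborel (cyl (Suc (Suc (Suc n))) \<gamma>3)"
      using m3 by (rule order_trans)
    moreover have "\<gamma>3 \<in> cyl n \<beta>" using cyl_trans[OF g2' g3(1)] by simp
    ultimately show thesis using that[OF _ _ _ q3] S3 False unfolding c_def by simp
  qed
qed

text \<open>The cube in \<open>p\<close> is the price of at most three steering digits. The factor
  96 is 24 from the large digit times 4 from \<open>s \<le> 4 * D * cf_S n \<beta>\<close>, where
  \<open>s\<close> is the digit sum at the index reached by steering.\<close>

lemma good_index_measure:
  assumes \<beta>: "\<beta> \<in> irr" and n: "1 \<le> n" and D: "1 \<le> D" and A: "1 \<le> A"
  defines "p \<equiv> (1 / (6 * (real_of_int D)\<^sup>2)) ^ 3 / (96 * real_of_int A * real_of_int D)"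
  shows "ennreal (p / cf_S n \<beta>) * emeasure lborel (cyl n \<beta>)
    \<le> emeasure lborel {\<alpha> \<in> cyl n \<beta>. \<exists>k\<in>{n..<n+4}. good_index D A e \<alpha> k}"
proof -
  define c where "c = (1 / (6 * (real_of_int D)\<^sup>2)) ^ 3"
  have c: "0 \<le> c" by (simp add: c_def)
  obtain \<gamma> k where \<gamma>: "\<gamma> \<in> cyl n \<beta>" and k: "n \<le> k" "k < n + 4" and q: "D dvd cf_q \<gamma> k - 1" and e: "even k = e"
    and S: "cf_S k \<gamma> \<le> cf_S n \<beta> + 3 * real_of_int D"
    and m: "ennreal c * emeasure lborel (cyl n \<beta>) \<le> emeasure lborel (cyl k \<gamma>)"
    using reach_residue[OF \<beta> n D, of e] unfolding c_def by metis
  have i: "\<gamma> \<in> irr" using \<gamma> cyl_subset_irr by blast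
  define s where "s = (\<Sum>i=1..k. cf_a \<gamma> i)"
  have s: "cf_S k \<gamma> = 1 + real_of_int s" by (simp add: cf_S_def s_def)
  have k1: "1 \<le> k" using k n by simp
  have s1: "1 \<le> s" using cf_S_ge[OF i, of k] k1 s by linarith
  define T where "T = A * s"
  have "1 * 1 \<le> A * s" using A s1 by (intro mult_mono) auto
  then have T: "1 \<le> T" by (simp add: T_def)
  have sub: "{\<alpha> \<in> cyl k \<gamma>. T \<le> cf_a \<alpha> (Suc k)} \<subseteq> {\<alpha> \<in> cyl n \<beta>. \<exists>k\<in>{n..<n+4}. good_index D A e \<alpha> k}"
  proof safe
    fix \<alpha> assume \<alpha>: "\<alpha> \<in> cyl k \<gamma>" "T \<le> cf_a \<alpha> (Suc k)"
    show "\<alpha> \<in> cyl n \<beta>" by (rule cyl_trans[OF \<gamma> \<alpha>(1) k(1)])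
    have "(\<Sum>i=1..k. cf_a \<alpha> i) = s"
      unfolding s_def using \<alpha>(1) by (intro sum.cong) (auto simp: cyl_def cf_agree_a)
    then have "good_index D A e \<alpha> k"
      using \<alpha>(2) q e cf_q_cyl[OF \<alpha>(1), of k] by (simp add: good_index_def T_def)
    then show "\<exists>k\<in>{n..<n+4}. good_index D A e \<alpha> k" using k by auto
  qed
  have meas: "{\<alpha> \<in> cyl n \<beta>. \<exists>k\<in>{n..<n+4}. good_index D A e \<alpha> k} \<in> sets lborel"
  proof -
    let ?P = "\<lambda>\<alpha>. \<alpha> \<in> cyl n \<beta> \<and> (\<exists>k\<in>{n..<n+4}. good_index D A e \<alpha> k)"
    have "digit_fun (n + 4) ?P"
    proof (rule digit_funI)
      fix x y assume xy: "x \<in> irr" "y \<in> irr" "cf_agree (n + 4) x y"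
      have xy': "cf_agree n x y" using xy(3) by (rule cf_agree_mono) simp
      have "x \<in> cyl n \<beta> \<longleftrightarrow> y \<in> cyl n \<beta>"
        using xy(1,2) cf_agree_trans[OF xy'] cf_agree_trans[OF cf_agree_sym[OF xy']] by (auto simp: cyl_def)
      moreover have "good_index D A e x k = good_index D A e y k" if "k \<in> {n..<n+4}" for k
        using that by (intro good_index_cong[OF xy(3)]) simp
      ultimately show "?P x = ?P y" by blast
    qed
    then have "?P \<in> measurable irr_measure (count_space UNIV)" by (rule digit_fun_measurable) simp
    then have "{\<alpha> \<in> space irr_measure. ?P \<alpha>} \<in> sets irr_measure" by (simp add: pred_def)
    moreover have "{\<alpha> \<in> space irr_measure. ?P \<alpha>} = {\<alpha> \<in> cyl n \<beta>. \<exists>k\<in>{n..<n+4}. good_index D A e \<alpha> k}"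
      using cyl_subset_irr by auto
    ultimately show ?thesis by (simp add: sets_irr_measure)
  qed
  have "p / cf_S n \<beta> \<le> 1 / (24 * real_of_int T) * c"
  proof -
    have S1: "1 \<le> cf_S n \<beta>" by (rule cf_S_ge_1[OF \<beta>])
    have AD: "1 \<le> real_of_int A" "1 \<le> real_of_int D" using A D by auto
    have "1 * cf_S n \<beta> \<le> real_of_int D * cf_S n \<beta>" "real_of_int D * 1 \<le> real_of_int D * cf_S n \<beta>"
      using S1 AD by (intro mult_right_mono mult_left_mono; simp)+
    then have "real_of_int s \<le> 4 * (real_of_int D * cf_S n \<beta>)" using S s by linarith
    then have "real_of_int s \<le> 4 * real_of_int D * cf_S n \<beta>" by (simp only: mult.assoc)
    then have "real_of_int T \<le> real_of_int A * (4 * real_of_int D * cf_S n \<beta>)"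
      unfolding T_def of_int_mult using AD by (intro mult_left_mono) auto
    then have "1 / (24 * (real_of_int A * (4 * real_of_int D * cf_S n \<beta>))) \<le> 1 / (24 * real_of_int T)"
      using T S1 AD by (intro divide_left_mono mult_left_mono mult_pos_pos) auto
    then have "1 / (24 * (real_of_int A * (4 * real_of_int D * cf_S n \<beta>))) * c \<le> 1 / (24 * real_of_int T) * c"
      using c by (rule mult_right_mono)
    moreover have "p / cf_S n \<beta> = 1 / (24 * (real_of_int A * (4 * real_of_int D * cf_S n \<beta>))) * c"
      by (simp add: p_def c_def[symmetric] mult_ac)
    ultimately show ?thesis by simp
  qed
  then have "ennreal (p / cf_S n \<beta>) * emeasure lborel (cyl n \<beta>)
     \<le> ennreal (1 / (24 * real_of_int T) * c) * emeasure lborel (cyl n \<beta>)"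
    by (intro mult_right_mono ennreal_leI) auto
  also have "\<dots> = ennreal (1 / (24 * real_of_int T)) * (ennreal c * emeasure lborel (cyl n \<beta>))"
    using c T by (subst ennreal_mult) (auto simp: mult.assoc)
  also have "\<dots> \<le> ennreal (1 / (24 * real_of_int T)) * emeasure lborel (cyl k \<gamma>)"
    by (intro mult_left_mono m) auto
  also have "\<dots> \<le> emeasure lborel {\<alpha> \<in> cyl k \<gamma>. T \<le> cf_a \<alpha> (Suc k)}"
    by (rule cyl_large_digit_measure(1)[OF i k1 T])
  also have "\<dots> \<le> emeasure lborel {\<alpha> \<in> cyl n \<beta>. \<exists>k\<in>{n..<n+4}. good_index D A e \<alpha> k}"
    by (intro emeasure_mono sub meas)
  finally show ?thesis .
qed

lemma good_index_increment:
  assumes u: "digit_fun n u" and n: "1 \<le> n" and D: "1 \<le> D" and A: "1 \<le> A"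
  defines "p \<equiv> (1 / (6 * (real_of_int D)\<^sup>2)) ^ 3 / (96 * real_of_int A * real_of_int D)"
  shows "(\<integral>\<^sup>+\<alpha>. u \<alpha> * ennreal (p / cf_S n \<alpha>) \<partial>irr_measure)
    \<le> (\<integral>\<^sup>+\<alpha>. u \<alpha> * indicator {\<alpha>\<in>irr. \<exists>k\<in>{n..<n+4}. good_index D A e \<alpha> k} \<alpha> \<partial>irr_measure)"
proof (rule cylinderwise_le[OF u])
  let ?E = "{\<alpha>\<in>irr. \<exists>k\<in>{n..<n+4}. good_index D A e \<alpha> k}"
  have dS: "digit_fun n (\<lambda>\<alpha>. ennreal (p / cf_S n \<alpha>))"
    using cf_S_digit_fun[of n] by (auto simp: digit_fun_def)
  show "(\<lambda>\<alpha>. ennreal (p / cf_S n \<alpha>)) \<in> borel_measurable irr_measure"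
    by (rule digit_fun_borel[OF dS])
  have "digit_fun (n + 4) (indicator ?E :: real \<Rightarrow> ennreal)"
  proof (rule digit_funI)
    fix x y assume xy: "x \<in> irr" "y \<in> irr" "cf_agree (n + 4) x y"
    have "good_index D A e x k = good_index D A e y k" if "k \<in> {n..<n+4}" for k
      using that by (intro good_index_cong[OF xy(3)]) simp
    then have "x \<in> ?E \<longleftrightarrow> y \<in> ?E" using xy by auto
    then show "indicator ?E x = (indicator ?E y :: ennreal)" by (simp add: indicator_def)
  qed
  then show m: "(indicator ?E :: real \<Rightarrow> ennreal) \<in> borel_measurable irr_measure"
    by (rule digit_fun_borel)
  then have E: "?E \<in> sets irr_measure"
    by (subst (asm) borel_measurable_indicator_iff) (simp add: Int_absorb2 subset_iff)
  fix \<beta> assume \<beta>: "\<beta> \<in> irr"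
  have eq: "{\<alpha> \<in> cyl n \<beta>. \<exists>k\<in>{n..<n+4}. good_index D A e \<alpha> k} = ?E \<inter> cyl n \<beta>"
    using cyl_subset_irr by auto
  have "(\<integral>\<^sup>+\<alpha>. ennreal (p / cf_S n \<alpha>) * indicator (cyl n \<beta>) \<alpha> \<partial>irr_measure)
      = ennreal (p / cf_S n \<beta>) * emeasure lborel (cyl n \<beta>)"
    by (rule nn_integral_const_cyl[OF \<beta> dS])
  also have "\<dots> \<le> emeasure lborel (?E \<inter> cyl n \<beta>)"
    using good_index_measure[OF \<beta> n D A, of e] unfolding p_def eq .
  also have "\<dots> = emeasure irr_measure (?E \<inter> cyl n \<beta>)"
    by (intro emeasure_irr_measure[symmetric]) auto
  also have "\<dots> = (\<integral>\<^sup>+\<alpha>. indicator ?E \<alpha> * indicator (cyl n \<beta>) \<alpha> \<partial>irr_measure)"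
    using E cyl_sets[OF \<beta>, of n] by (simp flip: indicator_inter_arith)
  finally show "(\<integral>\<^sup>+\<alpha>. ennreal (p / cf_S n \<alpha>) * indicator (cyl n \<beta>) \<alpha> \<partial>irr_measure)
    \<le> (\<integral>\<^sup>+\<alpha>. indicator ?E \<alpha> * indicator (cyl n \<beta>) \<alpha> \<partial>irr_measure)" .
qed

text \<open>\<open>Z n\<close> is the integral of the potential over the survivors
  \<open>G n\<close>, and it does not increase along steps of four. Survivors at time
  \<open>n\<close> carry potential at least \<open>\<phi> (1 + n)\<close>, which is unbounded, so
  those surviving forever form a null set.\<close>

lemma null_no_good_index_cyl:
  assumes \<beta>: "\<beta> \<in> irr" and k0: "1 \<le> k0" and D: "1 \<le> D" and A: "1 \<le> A"
  shows "{\<alpha>\<in>cyl k0 \<beta>. \<forall>k\<ge>k0. \<not> good_index D A e \<alpha> k} \<in> null_sets irr_measure"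
proof -
  define p where "p = (1 / (6 * (real_of_int D)\<^sup>2)) ^ 3 / (96 * real_of_int A * real_of_int D)"
  have p: "0 < p" using D A by (simp add: p_def)
  \<comment> \<open>Four digits raise the conditional mean of \<open>lnln\<close> by at most
    \<open>16 / cf_S n\<close>. Scaled by this \<open>c\<close>, the rise is
    \<open>p / cf_S n\<close>, exactly the lower bound for the success probability.\<close>
  define c where "c = p / 16"
  have c: "0 < c" using p by (simp add: c_def)
  define \<phi> where "\<phi> s = 1 + c * lnln s" for s
  have \<phi>1: "1 \<le> \<phi> s" if "1 \<le> s" for s using lnln_nonneg[OF that] c by (simp add: \<phi>_def)
  define G where "G n = {\<alpha>\<in>cyl k0 \<beta>. \<forall>k\<in>{k0..<n}. \<not> good_index D A e \<alpha> k}" for n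
  define u :: "nat \<Rightarrow> real \<Rightarrow> ennreal" where "u n = indicator (G n)" for n
  have Gcong: "x \<in> G n \<longleftrightarrow> y \<in> G n" if "x \<in> irr" "y \<in> irr" "cf_agree n x y" "k0 \<le> n" for n x y
  proof -
    have xy': "cf_agree k0 x y" using that(3,4) by (rule cf_agree_mono)
    have "x \<in> cyl k0 \<beta> \<longleftrightarrow> y \<in> cyl k0 \<beta>"
      using that(1,2) cf_agree_trans[OF xy'] cf_agree_trans[OF cf_agree_sym[OF xy']] by (auto simp: cyl_def)
    moreover have "good_index D A e x k = good_index D A e y k" if "k \<in> {k0..<n}" for k
      using that by (intro good_index_cong[OF \<open>cf_agree n x y\<close>]) simp
    ultimately show ?thesis unfolding G_def by blast
  qed
  have du: "digit_fun n (u n)" if "k0 \<le> n" for n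
    using Gcong that by (intro digit_funI) (auto simp: u_def indicator_def)
  have Gsub: "G n \<subseteq> irr" for n using cyl_subset_irr by (auto simp: G_def)
  have GI: "G n \<in> sets irr_measure" if "k0 \<le> n" for n
  proof -
    have "(indicator (G n) :: real \<Rightarrow> ennreal) \<in> borel_measurable irr_measure"
      using digit_fun_borel[OF du[OF that]] by (simp add: u_def)
    then show ?thesis using Gsub[of n] by (simp add: borel_measurable_indicator_iff Int_absorb2)
  qed
  note lnln_S_measurable[measurable] inverse_S_measurable[measurable]
  have S_meas: "cf_S n \<in> borel_measurable irr_measure" for n
    by (rule digit_fun_borel[OF cf_S_digit_fun])
  have \<phi>_meas [measurable]: "(\<lambda>\<alpha>. ennreal (\<phi> (cf_S n \<alpha>))) \<in> borel_measurable irr_measure" for n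
    using cf_S_digit_fun[of n] by (intro digit_fun_borel[of n]) (auto simp: digit_fun_def)
  define Z where "Z n = (\<integral>\<^sup>+\<alpha>. u n \<alpha> * ennreal (\<phi> (cf_S n \<alpha>)) \<partial>irr_measure)" for n
  have step: "Z (n + 4) \<le> Z n" if n: "k0 \<le> n" for n
  proof -
    let ?E = "{\<alpha>\<in>irr. \<exists>k\<in>{n..<n+4}. good_index D A e \<alpha> k}"
    let ?v = "\<lambda>\<alpha>. u n \<alpha> * indicator ?E \<alpha>"
    have n1: "1 \<le> n" using n k0 by simp
    have [measurable]: "G n \<in> sets irr_measure" "G (n + 4) \<in> sets irr_measure" using GI n by auto
    have um [measurable]: "u n \<in> borel_measurable irr_measure" "u (n + 4) \<in> borel_measurable irr_measure"
      unfolding u_def by measurable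
    \<comment> \<open>Success in the window is what separates the survivors at \<open>n\<close> from
      those at \<open>n + 4\<close>.\<close>
    have Eeq: "G n \<inter> ?E = G n - G (n + 4)"
      using Gsub[of n] n by (auto simp: G_def) (metis add.commute atLeastLessThan_iff less_or_eq_imp_le not_le)
    have veq: "?v = indicator (G n - G (n + 4))"
      unfolding Eeq[symmetric] u_def by (auto simp: indicator_def fun_eq_iff)
    have vm [measurable]: "?v \<in> borel_measurable irr_measure" unfolding veq by measurable
    let ?I = "\<integral>\<^sup>+\<alpha>. u n \<alpha> * ennreal (p / cf_S n \<alpha>) \<partial>irr_measure"
    have I: "?I \<le> (\<integral>\<^sup>+\<alpha>. ?v \<alpha> \<partial>irr_measure)"
      using good_index_increment[OF du[OF n] n1 D A] unfolding p_def .
    \<comment> \<open>Finiteness of the killed mass permits cancelling it in \<open>ennreal\<close>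
      at the end of the step.\<close>
    have "(\<integral>\<^sup>+\<alpha>. ?v \<alpha> \<partial>irr_measure) \<le> (\<integral>\<^sup>+\<alpha>. indicator (cyl k0 \<beta>) \<alpha> \<partial>irr_measure)"
      by (intro nn_integral_mono) (auto simp: u_def G_def indicator_def)
    also have "\<dots> = emeasure lborel (cyl k0 \<beta>)"
      using cyl_sets[OF \<beta>, of k0] by (simp add: emeasure_irr_measure cyl_subset_irr)
    also have "\<dots> \<le> emeasure lborel {0<..<1::real}"
      by (intro emeasure_mono) (auto simp: cyl_def irr_def)
    also have "\<dots> < \<infinity>" by simp
    finally have vfin: "(\<integral>\<^sup>+\<alpha>. ?v \<alpha> \<partial>irr_measure) < \<infinity>" .
    \<comment> \<open>Every killed point gives up a potential of at least 1, so the killed mass fits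
      next to the potential of the remaining survivors.\<close>
    have "Z (n + 4) + (\<integral>\<^sup>+\<alpha>. ?v \<alpha> \<partial>irr_measure)
        = (\<integral>\<^sup>+\<alpha>. u (n + 4) \<alpha> * ennreal (\<phi> (cf_S (n + 4) \<alpha>)) + ?v \<alpha> \<partial>irr_measure)"
      unfolding Z_def by (intro nn_integral_add[symmetric]) measurable
    also have "\<dots> \<le> (\<integral>\<^sup>+\<alpha>. u n \<alpha> * ennreal (\<phi> (cf_S (n + 4) \<alpha>)) \<partial>irr_measure)"
    proof (rule nn_integral_mono)
      fix \<alpha> assume "\<alpha> \<in> space irr_measure"
      then have \<alpha>: "\<alpha> \<in> irr" by simp
      have "G (n + 4) \<subseteq> G n" by (auto simp: G_def)
      moreover have "1 \<le> ennreal (\<phi> (cf_S (n + 4) \<alpha>))" using \<phi>1[OF cf_S_ge_1[OF \<alpha>]] by simp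
      ultimately show "u (n + 4) \<alpha> * ennreal (\<phi> (cf_S (n + 4) \<alpha>)) + ?v \<alpha> \<le> u n \<alpha> * ennreal (\<phi> (cf_S (n + 4) \<alpha>))"
        unfolding fun_cong[OF veq] by (auto simp: u_def indicator_def)
    qed
    also have "\<dots> = (\<integral>\<^sup>+\<alpha>. u n \<alpha> + ennreal c * (u n \<alpha> * ennreal (lnln (cf_S (n + 4) \<alpha>))) \<partial>irr_measure)"
    proof (rule nn_integral_cong)
      fix \<alpha> assume "\<alpha> \<in> space irr_measure"
      then show "u n \<alpha> * ennreal (\<phi> (cf_S (n + 4) \<alpha>)) = u n \<alpha> + ennreal c * (u n \<alpha> * ennreal (lnln (cf_S (n + 4) \<alpha>)))"
        using c lnln_nonneg[OF cf_S_ge_1[of \<alpha> "n + 4"]]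
        by (simp add: \<phi>_def ennreal_mult distrib_left mult_ac)
    qed
    also have "\<dots> = (\<integral>\<^sup>+\<alpha>. u n \<alpha> \<partial>irr_measure)
        + ennreal c * (\<integral>\<^sup>+\<alpha>. u n \<alpha> * ennreal (lnln (cf_S (n + 4) \<alpha>)) \<partial>irr_measure)"
      by (subst nn_integral_add, measurable, subst nn_integral_cmult, measurable)
    also have "\<dots> \<le> (\<integral>\<^sup>+\<alpha>. u n \<alpha> \<partial>irr_measure)
        + ennreal c * ((\<integral>\<^sup>+\<alpha>. u n \<alpha> * ennreal (lnln (cf_S n \<alpha>)) \<partial>irr_measure)
          + (\<integral>\<^sup>+\<alpha>. u n \<alpha> * ennreal (4 * real 4 / cf_S n \<alpha>) \<partial>irr_measure))"
      by (intro add_left_mono mult_left_mono lnln_increments du n n1) auto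
    also have "\<dots> = ((\<integral>\<^sup>+\<alpha>. u n \<alpha> \<partial>irr_measure)
        + ennreal c * (\<integral>\<^sup>+\<alpha>. u n \<alpha> * ennreal (lnln (cf_S n \<alpha>)) \<partial>irr_measure))
          + ennreal c * (\<integral>\<^sup>+\<alpha>. u n \<alpha> * ennreal (4 * real 4 / cf_S n \<alpha>) \<partial>irr_measure)"
      by (simp only: distrib_left add.assoc)
    also have "(\<integral>\<^sup>+\<alpha>. u n \<alpha> \<partial>irr_measure)
        + ennreal c * (\<integral>\<^sup>+\<alpha>. u n \<alpha> * ennreal (lnln (cf_S n \<alpha>)) \<partial>irr_measure)
        = (\<integral>\<^sup>+\<alpha>. u n \<alpha> + ennreal c * (u n \<alpha> * ennreal (lnln (cf_S n \<alpha>))) \<partial>irr_measure)"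
      by (subst nn_integral_add, measurable, subst nn_integral_cmult, measurable)
    also have "\<dots> = Z n" unfolding Z_def
    proof (rule nn_integral_cong)
      fix \<alpha> assume "\<alpha> \<in> space irr_measure"
      then show "u n \<alpha> + ennreal c * (u n \<alpha> * ennreal (lnln (cf_S n \<alpha>))) = u n \<alpha> * ennreal (\<phi> (cf_S n \<alpha>))"
        using c lnln_nonneg[OF cf_S_ge_1[of \<alpha> n]]
        by (simp add: \<phi>_def ennreal_mult distrib_left mult_ac)
    qed
    also have "ennreal c * (\<integral>\<^sup>+\<alpha>. u n \<alpha> * ennreal (4 * real 4 / cf_S n \<alpha>) \<partial>irr_measure) = ?I"
    proof -
      have "ennreal c * (\<integral>\<^sup>+\<alpha>. u n \<alpha> * ennreal (4 * real 4 / cf_S n \<alpha>) \<partial>irr_measure)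
        = (\<integral>\<^sup>+\<alpha>. ennreal c * (u n \<alpha> * ennreal (4 * real 4 / cf_S n \<alpha>)) \<partial>irr_measure)"
        by (rule nn_integral_cmult[symmetric]) measurable
      also have "\<dots> = ?I"
      proof (rule nn_integral_cong)
        fix \<alpha> assume "\<alpha> \<in> space irr_measure"
        then have "0 < cf_S n \<alpha>" using cf_S_ge_1[of \<alpha> n] by simp
        then have "ennreal c * ennreal (4 * real 4 / cf_S n \<alpha>) = ennreal (p / cf_S n \<alpha>)"
          using c by (subst ennreal_mult[symmetric]) (auto simp: c_def)
        then show "ennreal c * (u n \<alpha> * ennreal (4 * real 4 / cf_S n \<alpha>)) = u n \<alpha> * ennreal (p / cf_S n \<alpha>)"
          by (metis mult.left_commute)
      qed
      finally show ?thesis .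
    qed
    finally have "Z (n + 4) + (\<integral>\<^sup>+\<alpha>. ?v \<alpha> \<partial>irr_measure) \<le> Z n + ?I" .
    also have "\<dots> \<le> Z n + (\<integral>\<^sup>+\<alpha>. ?v \<alpha> \<partial>irr_measure)" by (intro add_left_mono I)
    finally have "(\<integral>\<^sup>+\<alpha>. ?v \<alpha> \<partial>irr_measure) + Z (n + 4) \<le> (\<integral>\<^sup>+\<alpha>. ?v \<alpha> \<partial>irr_measure) + Z n"
      by (simp only: add.commute)
    with vfin show ?thesis unfolding ennreal_add_left_cancel_le by auto
  qed
  have Zle: "Z (k0 + 4 * i) \<le> Z k0" for i
  proof (induction i)
    case (Suc i)
    have "Z (k0 + 4 * Suc i) \<le> Z (k0 + 4 * i)" using step[of "k0 + 4 * i"] by (simp add: add.commute add.left_commute)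
    with Suc show ?case by simp
  qed simp
  have Z0: "Z k0 < \<infinity>"
  proof -
    have "Z k0 = (\<integral>\<^sup>+\<alpha>. ennreal (\<phi> (cf_S k0 \<alpha>)) * indicator (cyl k0 \<beta>) \<alpha> \<partial>irr_measure)"
      unfolding Z_def u_def G_def by (simp add: mult.commute)
    also have "\<dots> = ennreal (\<phi> (cf_S k0 \<beta>)) * emeasure lborel (cyl k0 \<beta>)"
      using cf_S_digit_fun[of k0] by (intro nn_integral_const_cyl \<beta>) (auto simp: digit_fun_def)
    also have "\<dots> \<le> ennreal (\<phi> (cf_S k0 \<beta>)) * emeasure lborel {0<..<1::real}"
      by (intro mult_left_mono emeasure_mono) (auto simp: cyl_def irr_def)
    also have "\<dots> < \<infinity>" by (simp add: ennreal_mult_less_top)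
    finally show ?thesis .
  qed
  define N where "N = {\<alpha>\<in>cyl k0 \<beta>. \<forall>k\<ge>k0. \<not> good_index D A e \<alpha> k}"
  have Nsub: "N \<subseteq> G n" for n by (auto simp: N_def G_def)
  have "N = (\<Inter>n\<in>{k0..}. G n)"
  proof
    show "N \<subseteq> (\<Inter>n\<in>{k0..}. G n)" using Nsub by blast
    show "(\<Inter>n\<in>{k0..}. G n) \<subseteq> N"
    proof
      fix x assume x: "x \<in> (\<Inter>n\<in>{k0..}. G n)"
      then have "x \<in> cyl k0 \<beta>" by (auto simp: G_def)
      moreover have "\<not> good_index D A e x k" if "k0 \<le> k" for k
      proof -
        have "x \<in> G (Suc k)" using x that by auto
        then show ?thesis using that by (simp add: G_def)
      qed
      ultimately show "x \<in> N" by (simp add: N_def)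
    qed
  qed
  also have "\<dots> \<in> sets irr_measure"
    using GI by (intro sets.countable_INT') auto
  finally have Nm: "N \<in> sets irr_measure" .
  have "emeasure irr_measure N \<le> emeasure lborel {0<..<1::real}"
  proof -
    have "N \<subseteq> irr" using Nm by (simp add: sets_irr_measure)
    moreover from this have "N \<subseteq> {0<..<1}" by (auto simp: irr_def)
    ultimately show ?thesis by (simp only: emeasure_irr_measure) (rule emeasure_mono, auto)
  qed
  also have "\<dots> < \<infinity>" by simp
  finally have Nfin: "emeasure irr_measure N < \<infinity>" .
  define m where "m = enn2real (emeasure irr_measure N)"
  have m: "emeasure irr_measure N = ennreal m" "0 \<le> m" using Nfin by (auto simp: m_def)
  define z where "z = enn2real (Z k0)"
  have z: "Z k0 = ennreal z" "0 \<le> z" using Z0 by (auto simp: z_def)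
  have bound: "\<phi> (1 + real (k0 + 4 * i)) * m \<le> z" for i
  proof -
    let ?n = "k0 + 4 * i"
    have f: "1 \<le> \<phi> (1 + real ?n)" by (rule \<phi>1) simp
    have "ennreal (\<phi> (1 + real ?n)) * emeasure irr_measure N
       = (\<integral>\<^sup>+\<alpha>. ennreal (\<phi> (1 + real ?n)) * indicator N \<alpha> \<partial>irr_measure)"
      using Nm by (simp add: nn_integral_cmult_indicator)
    also have "\<dots> \<le> Z ?n" unfolding Z_def
    proof (rule nn_integral_mono)
      fix \<alpha> assume "\<alpha> \<in> space irr_measure"
      then have \<alpha>: "\<alpha> \<in> irr" by simp
      have "lnln (1 + real ?n) \<le> lnln (cf_S ?n \<alpha>)"
        using cf_S_ge[OF \<alpha>, of ?n] by (intro lnln_mono) auto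
      then have "\<phi> (1 + real ?n) \<le> \<phi> (cf_S ?n \<alpha>)" using c by (simp add: \<phi>_def)
      then show "ennreal (\<phi> (1 + real ?n)) * indicator N \<alpha> \<le> u ?n \<alpha> * ennreal (\<phi> (cf_S ?n \<alpha>))"
        using Nsub[of ?n] by (auto simp: u_def indicator_def intro: ennreal_leI)
    qed
    also have "\<dots> \<le> ennreal z" using Zle[of i] z by simp
    finally show ?thesis using f m z by (simp add: ennreal_mult'[symmetric])
  qed
  have "m = 0"
  proof (rule ccontr)
    assume "m \<noteq> 0"
    then have mp: "0 < m" using m by simp
    \<comment> \<open>With a potential of at least \<open>1 + c * K\<close>, the bound would read
      \<open>m + c * m + z \<le> z\<close>.\<close>
    define K where "K = z / m / c + 1"
    have K0: "0 \<le> K" using z mp c by (simp add: K_def)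
    obtain i :: nat where i: "exp (exp K) < real i" using reals_Archimedean2 by blast
    let ?s = "1 + real (k0 + 4 * i)"
    have s: "exp (exp K) \<le> ?s" using i by simp
    then have "exp K \<le> ln ?s" by (subst ln_ge_iff) auto
    then have "exp K \<le> 1 + ln ?s" by simp
    then have "K \<le> lnln ?s" unfolding lnln_def by (subst ln_ge_iff) (auto intro: less_le_trans[OF exp_gt_zero])
    then have "1 + c * K \<le> \<phi> ?s" using c by (simp add: \<phi>_def)
    then have "(1 + c * K) * m \<le> \<phi> ?s * m" using mp by simp
    also have "\<dots> \<le> z" by (rule bound)
    finally have "(1 + c * K) * m \<le> z" .
    moreover have "(1 + c * K) * m = m + c * m + z" using mp c by (simp add: K_def field_simps)
    moreover have "0 < c * m" using mp c by simp
    ultimately show False using mp by linarith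
  qed
  then have "N \<in> null_sets irr_measure" using Nm m(1) by (intro null_setsI) auto
  then show ?thesis unfolding N_def .
qed

lemma AE_good_index:
  assumes D: "1 \<le> D" and A: "1 \<le> A"
  shows "AE \<alpha> in lborel. \<alpha> \<in> {0..<1} \<longrightarrow> \<alpha> \<in> irr \<and> (\<forall>m. \<exists>k\<ge>m. good_index D A e \<alpha> k)"
proof -
  have "AE \<alpha> in irr_measure. \<forall>m. \<exists>k\<ge>m. good_index D A e \<alpha> k"
  proof (subst AE_all_countable, intro allI)
    fix m
    \<comment> \<open>The null set lemma works on cylinders of positive level, hence the shift; an
      index beyond \<open>Suc m\<close> is also one beyond \<open>m\<close>.\<close>
    define k0 where "k0 = Suc m"
    define N where "N = {\<alpha>\<in>irr. \<forall>k\<ge>k0. \<not> good_index D A e \<alpha> k}"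
    define J where "J = cf_code k0 ` irr"
    have "N = (\<Union>i\<in>J. {\<alpha>\<in>cyl k0 (SOME \<beta>. \<beta> \<in> irr \<and> cf_code k0 \<beta> = i). \<forall>k\<ge>k0. \<not> good_index D A e \<alpha> k})" (is "_ = ?R")
    proof
      show "N \<subseteq> ?R"
      proof
        fix \<alpha> assume \<alpha>: "\<alpha> \<in> N"
        then have ex: "\<exists>\<beta>. \<beta> \<in> irr \<and> cf_code k0 \<beta> = cf_code k0 \<alpha>" by (auto simp: N_def)
        have "cf_agree k0 \<alpha> (SOME \<beta>. \<beta> \<in> irr \<and> cf_code k0 \<beta> = cf_code k0 \<alpha>)"
          using someI_ex[OF ex] by (simp add: cf_code_eq_iff cf_agree_sym)
        with \<alpha> show "\<alpha> \<in> ?R" by (auto simp: N_def J_def cyl_def)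
      qed
      show "?R \<subseteq> N" using cyl_subset_irr by (auto simp: N_def)
    qed
    also have "\<dots> \<in> null_sets irr_measure"
    proof (intro null_sets_UN' null_no_good_index_cyl D A)
      fix i assume "i \<in> J"
      then have ex: "\<exists>\<beta>. \<beta> \<in> irr \<and> cf_code k0 \<beta> = i" by (auto simp: J_def)
      show "(SOME \<beta>. \<beta> \<in> irr \<and> cf_code k0 \<beta> = i) \<in> irr" using someI_ex[OF ex] by simp
    qed (auto simp: k0_def)
    finally have "AE \<alpha> in irr_measure. \<alpha> \<notin> N" by (rule AE_not_in)
    then show "AE \<alpha> in irr_measure. \<exists>k\<ge>m. good_index D A e \<alpha> k"
    proof (rule AE_mp, intro AE_I2 impI)
      fix \<alpha> assume "\<alpha> \<in> space irr_measure" "\<alpha> \<notin> N"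
      then obtain k where "k0 \<le> k" "good_index D A e \<alpha> k" by (auto simp: N_def)
      then show "\<exists>k\<ge>m. good_index D A e \<alpha> k" by (intro exI[of _ k]) (simp add: k0_def)
    qed
  qed
  then have 1: "AE \<alpha> in lborel. \<alpha> \<in> irr \<longrightarrow> (\<forall>m. \<exists>k\<ge>m. good_index D A e \<alpha> k)"
    unfolding irr_measure_def using irr_sets by (subst (asm) AE_restrict_space_iff) auto
  have 2: "AE \<alpha> in lborel. \<alpha> \<notin> (\<rat> :: real set)" by (rule AE_not_in[OF null_Rats])
  show ?thesis
  proof (rule AE_mp[OF 1], rule AE_mp[OF 2], intro AE_I2 impI)
    fix \<alpha> :: real
    assume *: "\<alpha> \<notin> \<rat>" "\<alpha> \<in> irr \<longrightarrow> (\<forall>m. \<exists>k\<ge>m. good_index D A e \<alpha> k)" "\<alpha> \<in> {0..<1}"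
    then have "\<alpha> \<noteq> 0" by auto
    with * have "\<alpha> \<in> irr" by (intro irrI) auto
    with * show "\<alpha> \<in> irr \<and> (\<forall>m. \<exists>k\<ge>m. good_index D A e \<alpha> k)" by blast
  qed
qed

section \<open>Sums along convergent denominators\<close>

lemma periodic_int_shift:
  fixes f :: "real \<Rightarrow> 'a"
  assumes "\<And>x. f (x + p) = f x"
  shows "f (x + of_int k * p) = f x"
proof -
  have nat: "f (y + of_nat n * p) = f y" for y n
  proof (induction n)
    case (Suc n)
    have "y + of_nat (Suc n) * p = (y + of_nat n * p) + p" by (simp add: algebra_simps)
    then show ?case using assms Suc by metis
  qed simp
  show ?thesis
  proof (cases "0 \<le> k")
    case True
    then show ?thesis using nat[of x "nat k"] by simp
  next
    case False
    have "x + of_int k * p + of_nat (nat (- k)) * p = x" using False by (simp add: algebra_simps)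
    then show ?thesis using nat[of "x + of_int k * p" "nat (- k)"] by metis
  qed
qed

lemma sum_blocks:
  fixes f :: "nat \<Rightarrow> real"
  shows "(\<Sum>n=1..b*Q + r. f n) = (\<Sum>n=1..b*Q. f n) + (\<Sum>n=1..r. f (b*Q + n))"
  using sum.ub_add_nat[of 1 "b * Q" f r] sum.shift_bounds_cl_nat_ivl[of f 1 "b * Q" r]
  by (simp add: add.commute)

lemma sum_residues:
  fixes f :: "nat \<Rightarrow> real"
  shows "(\<Sum>n=1..b*Q. f n) = (\<Sum>r=1..Q. \<Sum>m<b. f (m*Q + r))"
proof (induction b)
  case (Suc b)
  have "(\<Sum>n=1..Suc b*Q. f n) = (\<Sum>n=1..b*Q. f n) + (\<Sum>r=1..Q. f (b*Q + r))"
    using sum_blocks[of f b Q Q] by (simp add: add.commute)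
  then show ?case unfolding Suc by (simp add: sum.distrib)
qed simp

lemma bij_betw_residues:
  assumes "coprime P (int Q)" "0 < Q"
  shows "bij_betw (\<lambda>r. nat ((int r * P) mod int Q)) {1..Q} {..<Q}"
proof -
  let ?f = "\<lambda>r. nat ((int r * P) mod int Q)"
  have le: "r = r'" if "r \<in> {1..Q}" "r' \<in> {1..Q}" "r \<le> r'" "?f r = ?f r'" for r r'
  proof -
    have "(int r * P) mod int Q = (int r' * P) mod int Q"
      using that(4) assms(2) by (metis eq_nat_nat_iff of_nat_0_less_iff pos_mod_sign)
    then have "int Q dvd int r' * P - int r * P" by (metis mod_eq_dvd_iff)
    also have "int r' * P - int r * P = P * int (r' - r)" using that(3) by (simp add: of_nat_diff algebra_simps)
    finally have "int Q dvd int (r' - r)" using assms(1) by (simp add: coprime_dvd_mult_right_iff coprime_commute)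
    then have "Q dvd r' - r" by simp
    moreover have "r' - r < Q" using that by auto
    ultimately have "r' - r = 0" by (meson dvd_imp_le gr0I not_le)
    then show "r = r'" using that(3) by simp
  qed
  have inj: "inj_on ?f {1..Q}"
    by (rule inj_onI) (metis le nat_le_linear)
  have sub: "?f ` {1..Q} \<subseteq> {..<Q}" using assms(2) by (auto simp: nat_less_iff)
  have "?f ` {1..Q} = {..<Q}"
    using card_image[OF inj] by (intro card_subset_eq[OF _ sub]) auto
  with inj show ?thesis by (simp add: bij_betw_def)
qed

lemma sum_abs_le_telescope:
  fixes G M :: "nat \<Rightarrow> real" and c :: "nat \<Rightarrow> real"
  assumes "\<And>m. m < b \<Longrightarrow> \<bar>G (Suc m) - G m - c m\<bar> \<le> M (Suc m) - M m"
  shows "\<bar>G b - G 0 - (\<Sum>m<b. c m)\<bar> \<le> M b - M 0"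
  using assms
proof (induction b)
  case (Suc b)
  have "\<bar>G b - G 0 - (\<Sum>m<b. c m)\<bar> \<le> M b - M 0" using Suc by simp
  moreover have "\<bar>G (Suc b) - G b - c b\<bar> \<le> M (Suc b) - M b" using Suc.prems by simp
  ultimately show ?case by simp
qed simp

text \<open>\<open>F\<close> is an antiderivative of \<open>\<phi>\<close> and \<open>\<mu>\<close> dominates the variation of \<open>\<phi>\<close>, whose total over a
  period is \<open>V\<close>; working with \<open>F\<close> and \<open>\<mu>\<close> turns every sum over disjoint cells into a telescoping one.\<close>

locale periodic_variation =
  fixes \<phi> F \<mu> :: "real \<Rightarrow> real" and V :: real
  assumes periodic: "\<phi> (x + 1) = \<phi> x"
    and F_periodic: "F (x + 1) = F x"
    and \<mu>_shift: "\<mu> (x + 1) = \<mu> x + V"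
    and control: "u \<le> y \<Longrightarrow> y \<le> v \<Longrightarrow> \<bar>F v - F u - (v - u) * \<phi> y\<bar> \<le> (v - u) * (\<mu> v - \<mu> u)"
begin

lemma \<mu>_mono: "u \<le> v \<Longrightarrow> \<mu> u \<le> \<mu> v"
proof (cases "u = v")
  case False
  assume "u \<le> v"
  with False have "u < v" by simp
  have "0 \<le> (v - u) * (\<mu> v - \<mu> u)" using control[of u u v] \<open>u \<le> v\<close> by linarith
  with \<open>u < v\<close> show ?thesis by (simp add: zero_le_mult_iff)
qed simp

lemma V_nonneg: "0 \<le> V"
  using \<mu>_mono[of 0 1] \<mu>_shift[of 0] by simp

lemma periodic_int: "\<phi> (x + of_int k) = \<phi> x"
  using periodic_int_shift[of \<phi> 1 x k] periodic by simp

text \<open>Negative drift, and with it odd \<open>k\<close>, reduces to positive drift by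
  reflection. The signs of \<open>F\<close> and \<open>\<mu>\<close> are flipped so that the first
  still integrates the function and the second still increases.\<close>

lemma reflected: "periodic_variation (\<lambda>x. \<phi> (- x)) (\<lambda>x. - F (- x)) (\<lambda>x. - \<mu> (- x)) V"
proof
  fix x u y v :: real
  show "\<phi> (- (x + 1)) = \<phi> (- x)" using periodic[of "- x - 1"] by simp
  show "- F (- (x + 1)) = - F (- x)" using F_periodic[of "- x - 1"] by simp
  show "- \<mu> (- (x + 1)) = - \<mu> (- x) + V" using \<mu>_shift[of "- x - 1"] by simp
  show "\<bar>- F (- v) - - F (- u) - (v - u) * \<phi> (- y)\<bar> \<le> (v - u) * (- \<mu> (- v) - - \<mu> (- u))"
    if "u \<le> y" "y \<le> v" using control[of "- v" "- y" "- u"] that by simp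
qed

lemma sum_\<mu>_lattice: "0 < Q \<Longrightarrow> (\<Sum>j<Q. \<mu> (x + real j / real Q + 1 / real Q) - \<mu> (x + real j / real Q)) = V"
proof -
  assume Q: "0 < Q"
  have "(\<Sum>j<Q. \<mu> (x + real j / real Q + 1 / real Q) - \<mu> (x + real j / real Q))
      = (\<Sum>j<Q. \<mu> (x + real (Suc j) / real Q) - \<mu> (x + real j / real Q))"
    by (intro sum.cong) (simp_all add: add_divide_distrib add_ac)
  also have "\<dots> = \<mu> (x + real Q / real Q) - \<mu> (x + real 0 / real Q)"
    by (rule sum_lessThan_telescope)
  finally show ?thesis using Q \<mu>_shift[of x] by simp
qed

text \<open>The orbit point at time \<open>m * Q + r\<close> is, modulo 1, the lattice point of
  index \<open>r * P mod Q\<close>, displaced by the drift of \<open>m\<close> whole blocks and by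
  the drift \<open>r * \<delta>\<close> inside the current block.\<close>

lemma lattice_point:
  assumes "0 < Q" "\<alpha> = of_int P / real Q + \<delta>"
  shows "\<phi> (x + real (m * Q + r) * \<alpha>)
    = \<phi> (x + real (nat ((int r * P) mod int Q)) / real Q + real m * (real Q * \<delta>) + real r * \<delta>)"
proof -
  let ?j = "(int r * P) mod int Q" and ?d = "(int r * P) div int Q"
  have "int r * P = int Q * ?d + ?j" by (simp only: mult_div_mod_eq)
  then have "real_of_int (int r * P) = real_of_int (int Q * ?d + ?j)" by (rule arg_cong)
  then have "real r * of_int P = real Q * of_int ?d + of_int ?j"
    by (simp only: of_int_add of_int_mult of_int_of_nat_eq)
  then have "real r * (of_int P / real Q) = of_int ?d + of_int ?j / real Q"
    using assms(1) by (simp add: field_simps)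
  moreover have "real (nat ?j) = of_int ?j" using assms(1) by simp
  ultimately have "x + real (m * Q + r) * \<alpha>
    = x + real (nat ?j) / real Q + real m * (real Q * \<delta>) + real r * \<delta> + of_int (int m * P + ?d)"
    using assms by (simp add: algebra_simps)
  then show ?thesis by (simp only: periodic_int)
qed

text \<open>For a fixed residue \<open>r\<close>, the orbit visits one lattice cell with step
  \<open>h = Q * \<delta>\<close>, so \<open>h\<close> times the sum over these visits is a Riemann
  sum for an increment of \<open>F\<close>. The hypothesis on \<open>b\<close> keeps all visits of
  one residue inside one cell, so the errors add up to \<open>h\<close> times the variation over one
  period.\<close>

lemma block_sum:
  assumes Q: "0 < Q" and P: "coprime P (int Q)" and \<alpha>: "\<alpha> = of_int P / real Q + \<delta>" and \<delta>: "0 < \<delta>"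
    and b: "real b * (real Q * \<delta>) \<le> 1 / real Q"
  shows "\<bar>(\<Sum>n=1..b*Q. \<phi> (x + real n * \<alpha>))
    - (\<Sum>j<Q. F (x + real j / real Q + real b * (real Q * \<delta>)) - F (x + real j / real Q)) / (real Q * \<delta>)\<bar> \<le> V"
proof -
  define h where "h = real Q * \<delta>"
  have h: "0 < h" using Q \<delta> by (simp add: h_def)
  define j where "j r = nat ((int r * P) mod int Q)" for r
  define e where "e j = x + real j / real Q" for j :: nat
  have bij: "bij_betw j {1..Q} {..<Q}" unfolding j_def by (rule bij_betw_residues[OF P Q])
  have cell: "\<bar>F (e (j r) + real b * h) - F (e (j r)) - h * (\<Sum>m<b. \<phi> (x + real (m * Q + r) * \<alpha>))\<bar>
      \<le> h * (\<mu> (e (j r) + 1 / real Q) - \<mu> (e (j r)))" if r: "r \<in> {1..Q}" for r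
  proof -
    have "\<bar>F (e (j r) + real (Suc m) * h) - F (e (j r) + real m * h) - h * \<phi> (x + real (m * Q + r) * \<alpha>)\<bar>
        \<le> h * \<mu> (e (j r) + real (Suc m) * h) - h * \<mu> (e (j r) + real m * h)" for m
    proof -
      \<comment> \<open>Since \<open>r \<le> Q\<close>, visit number \<open>m\<close> lies in the
        interval number \<open>m\<close> of a chain of intervals of length \<open>h\<close>, which
        is where \<open>control\<close> applies.\<close>
      have "real r * \<delta> \<le> h" unfolding h_def using r \<delta> by (intro mult_right_mono) auto
      moreover have "0 \<le> real r * \<delta>" using \<delta> by simp
      ultimately have "\<bar>F (e (j r) + real (Suc m) * h) - F (e (j r) + real m * h)
         - ((e (j r) + real (Suc m) * h) - (e (j r) + real m * h)) * \<phi> (e (j r) + real m * h + real r * \<delta>)\<bar>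
         \<le> ((e (j r) + real (Suc m) * h) - (e (j r) + real m * h)) * (\<mu> (e (j r) + real (Suc m) * h) - \<mu> (e (j r) + real m * h))"
        by (intro control) (simp_all add: algebra_simps)
      moreover have "(e (j r) + real (Suc m) * h) - (e (j r) + real m * h) = h" by (simp add: algebra_simps)
      moreover have "\<phi> (x + real (m * Q + r) * \<alpha>) = \<phi> (e (j r) + real m * h + real r * \<delta>)"
        unfolding e_def j_def h_def by (rule lattice_point[OF Q \<alpha>])
      ultimately show ?thesis by (simp add: right_diff_distrib)
    qed
    then have "\<bar>F (e (j r) + real b * h) - F (e (j r) + real 0 * h) - (\<Sum>m<b. h * \<phi> (x + real (m * Q + r) * \<alpha>))\<bar>
      \<le> h * \<mu> (e (j r) + real b * h) - h * \<mu> (e (j r) + real 0 * h)"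
      by (rule sum_abs_le_telescope)
    also have "\<dots> = h * (\<mu> (e (j r) + real b * h) - \<mu> (e (j r)))" by (simp add: right_diff_distrib)
    also have "\<dots> \<le> h * (\<mu> (e (j r) + 1 / real Q) - \<mu> (e (j r)))"
      using h b unfolding h_def[symmetric] by (intro mult_left_mono diff_right_mono \<mu>_mono) auto
    finally show ?thesis by (simp add: sum_distrib_left)
  qed
  let ?S = "\<Sum>n=1..b*Q. \<phi> (x + real n * \<alpha>)"
  let ?D = "\<Sum>j<Q. F (e j + real b * h) - F (e j)"
  have "?D - h * ?S = (\<Sum>r=1..Q. F (e (j r) + real b * h) - F (e (j r)) - h * (\<Sum>m<b. \<phi> (x + real (m * Q + r) * \<alpha>)))"
  proof -
    have "?D = (\<Sum>r=1..Q. F (e (j r) + real b * h) - F (e (j r)))"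
      using sum.reindex_bij_betw[OF bij, of "\<lambda>i. F (e i + real b * h) - F (e i)"] by simp
    moreover have "h * ?S = (\<Sum>r=1..Q. h * (\<Sum>m<b. \<phi> (x + real (m * Q + r) * \<alpha>)))"
      unfolding sum_residues by (rule sum_distrib_left)
    ultimately show ?thesis by (simp only: sum_subtractf)
  qed
  also have "\<bar>\<dots>\<bar> \<le> (\<Sum>r=1..Q. h * (\<mu> (e (j r) + 1 / real Q) - \<mu> (e (j r))))"
    by (rule order_trans[OF sum_abs]) (intro sum_mono cell)
  also have "\<dots> = (\<Sum>i<Q. h * (\<mu> (e i + 1 / real Q) - \<mu> (e i)))"
    using sum.reindex_bij_betw[OF bij, of "\<lambda>i. h * (\<mu> (e i + 1 / real Q) - \<mu> (e i))"] by simp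
  also have "\<dots> = h * V"
    using sum_\<mu>_lattice[OF Q, of x] by (simp add: sum_distrib_left[symmetric] e_def)
  finally have "\<bar>?D - h * ?S\<bar> \<le> h * V" .
  moreover have "?D - h * ?S = h * (?D / h - ?S)" using h by (simp add: right_diff_distrib)
  ultimately have "h * \<bar>?D / h - ?S\<bar> \<le> h * V" using h by (simp add: abs_mult)
  then have "\<bar>?D / h - ?S\<bar> \<le> V" using h by simp
  then show ?thesis unfolding e_def h_def by (simp add: abs_minus_commute)
qed

text \<open>Now each cell of width \<open>1 / Q\<close> contains one orbit point. The comparison
  with \<open>F\<close> is made on the whole cell, and the increments of \<open>F\<close> cancel
  over the period.\<close>

lemma Denjoy_Koksma_pos:
  assumes Q: "0 < Q" and P: "coprime P (int Q)" and \<alpha>: "\<alpha> = of_int P / real Q + \<delta>" and \<delta>: "0 \<le> \<delta>"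
    and le: "real Q * \<delta> \<le> 1 / real Q"
  shows "\<bar>\<Sum>n=1..Q. \<phi> (x + real n * \<alpha>)\<bar> \<le> V"
proof -
  define j where "j r = nat ((int r * P) mod int Q)" for r
  define e where "e j = x + real j / real Q" for j :: nat
  have bij: "bij_betw j {1..Q} {..<Q}" unfolding j_def by (rule bij_betw_residues[OF P Q])
  have cell: "\<bar>F (e (j r) + 1 / real Q) - F (e (j r)) - 1 / real Q * \<phi> (x + real r * \<alpha>)\<bar>
      \<le> 1 / real Q * (\<mu> (e (j r) + 1 / real Q) - \<mu> (e (j r)))" if r: "r \<in> {1..Q}" for r
  proof -
    have "real r * \<delta> \<le> real Q * \<delta>" using r \<delta> by (intro mult_right_mono) auto
    moreover have "0 \<le> real r * \<delta>" using \<delta> by simp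
    ultimately have "\<bar>F (e (j r) + 1 / real Q) - F (e (j r))
         - ((e (j r) + 1 / real Q) - e (j r)) * \<phi> (e (j r) + real r * \<delta>)\<bar>
         \<le> ((e (j r) + 1 / real Q) - e (j r)) * (\<mu> (e (j r) + 1 / real Q) - \<mu> (e (j r)))"
      using le by (intro control) simp_all
    moreover have "\<phi> (x + real r * \<alpha>) = \<phi> (e (j r) + real r * \<delta>)"
      using lattice_point[OF Q \<alpha>, of x 0 r] unfolding e_def j_def by simp
    ultimately show ?thesis by simp
  qed
  let ?S = "\<Sum>n=1..Q. \<phi> (x + real n * \<alpha>)"
  have "(\<Sum>i<Q. F (e i + 1 / real Q) - F (e i)) = (\<Sum>i<Q. F (x + real (Suc i) / real Q) - F (x + real i / real Q))"
    unfolding e_def by (intro sum.cong) (simp_all add: add_divide_distrib add_ac)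
  also have "\<dots> = F (x + real Q / real Q) - F (x + real 0 / real Q)"
    by (rule sum_lessThan_telescope)
  also have "\<dots> = 0" using Q F_periodic[of x] by simp
  finally have 0: "(\<Sum>i<Q. F (e i + 1 / real Q) - F (e i)) = 0" .
  have "0 - 1 / real Q * ?S = (\<Sum>r=1..Q. F (e (j r) + 1 / real Q) - F (e (j r)) - 1 / real Q * \<phi> (x + real r * \<alpha>))"
    using sum.reindex_bij_betw[OF bij, of "\<lambda>i. F (e i + 1 / real Q) - F (e i)"] 0
    by (simp add: sum_subtractf sum_distrib_left)
  also have "\<bar>\<dots>\<bar> \<le> (\<Sum>r=1..Q. 1 / real Q * (\<mu> (e (j r) + 1 / real Q) - \<mu> (e (j r))))"
    by (rule order_trans[OF sum_abs]) (intro sum_mono cell)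
  also have "\<dots> = (\<Sum>i<Q. 1 / real Q * (\<mu> (e i + 1 / real Q) - \<mu> (e i)))"
    using sum.reindex_bij_betw[OF bij, of "\<lambda>i. 1 / real Q * (\<mu> (e i + 1 / real Q) - \<mu> (e i))"] by simp
  also have "\<dots> = 1 / real Q * V"
    using sum_\<mu>_lattice[OF Q, of x] unfolding e_def sum_distrib_left[symmetric] by simp
  finally show ?thesis using Q by (simp add: abs_mult divide_le_cancel)
qed

lemma reflected_sum: "(\<Sum>n=1..N. \<phi> (x + real n * \<alpha>)) = (\<Sum>n=1..N. \<phi> (- (- x + real n * (- \<alpha>))))"
  by (simp add: add.commute)

lemma Denjoy_Koksma:
  assumes Q: "0 < Q" and P: "coprime P (int Q)" and \<alpha>: "\<alpha> = of_int P / real Q + \<delta>"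
    and le: "real Q * \<bar>\<delta>\<bar> \<le> 1 / real Q"
  shows "\<bar>\<Sum>n=1..Q. \<phi> (x + real n * \<alpha>)\<bar> \<le> V"
proof (cases "0 \<le> \<delta>")
  case True
  then show ?thesis using Denjoy_Koksma_pos[OF Q P \<alpha>] le by simp
next
  case False
  have "- \<alpha> = of_int (- P) / real Q + (- \<delta>)" by (simp add: \<alpha>)
  then show ?thesis unfolding reflected_sum
    using P False le by (intro periodic_variation.Denjoy_Koksma_pos[OF reflected Q, of "- P"]) auto
qed

lemma cf_denominator_sum:
  assumes \<alpha>: "\<alpha> \<in> irr"
  shows "\<bar>\<Sum>n=1..nat (cf_q \<alpha> k). \<phi> (x + real n * \<alpha>)\<bar> \<le> V"
proof -
  have q: "1 \<le> cf_q \<alpha> k" by (rule cf_q_ge_1[OF \<alpha>])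
  let ?Q = "nat (cf_q \<alpha> k)"
  have Q: "0 < ?Q" "real ?Q = of_int (cf_q \<alpha> k)" using q by auto
  let ?\<delta> = "(-1) ^ k * cf_rho \<alpha> k / of_int (cf_q \<alpha> k)"
  have "\<alpha> = of_int (cf_p \<alpha> k) / real ?Q + ?\<delta>"
    using cf_approx[OF \<alpha>, of k] q unfolding Q(2) by (simp add: field_simps)
  moreover have "real ?Q * \<bar>?\<delta>\<bar> \<le> 1 / real ?Q"
  proof -
    have "cf_rho \<alpha> k * of_int (cf_q \<alpha> k) \<le> cf_rho \<alpha> k * of_int (cf_q \<alpha> (Suc k))"
      using cf_q_mono_Suc[OF \<alpha>, of k] cf_rho_pos[OF \<alpha>, of k] by (intro mult_left_mono) auto
    also have "\<dots> \<le> 1" using cf_rho_bounds(1)[OF \<alpha>, of k] by (simp add: mult.commute)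
    finally show ?thesis using q cf_rho_pos[OF \<alpha>, of k] unfolding Q(2) by (simp add: abs_mult field_simps)
  qed
  moreover have "coprime (cf_p \<alpha> k) (int ?Q)" using coprime_cf[of \<alpha> k] q by simp
  ultimately show ?thesis using Denjoy_Koksma[OF Q(1)] by blast
qed

lemma repeated_blocks:
  assumes "\<And>x. \<bar>\<Sum>n=1..Q. \<phi> (x + real n * \<alpha>)\<bar> \<le> V"
  shows "\<bar>\<Sum>n=1..b*Q. \<phi> (x + real n * \<alpha>)\<bar> \<le> real b * V"
proof (induction b)
  case (Suc b)
  have "(\<Sum>n=1..Suc b*Q. \<phi> (x + real n * \<alpha>))
      = (\<Sum>n=1..b*Q. \<phi> (x + real n * \<alpha>)) + (\<Sum>n=1..Q. \<phi> ((x + real (b * Q) * \<alpha>) + real n * \<alpha>))"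
    using sum_blocks[of "\<lambda>n. \<phi> (x + real n * \<alpha>)" b Q Q] by (simp add: algebra_simps)
  with Suc assms[of "x + real (b * Q) * \<alpha>"] show ?case by (simp add: distrib_right del: of_nat_mult)
qed simp

text \<open>Divide \<open>N\<close> by the largest available denominator and recurse on the
  remainder: the quotient is at most the corresponding digit, and each full block costs at most
  \<open>V\<close> wherever it starts. The remainder starts at a shifted point, so the induction
  keeps \<open>x\<close> arbitrary.\<close>

lemma Ostrowski_sum:
  assumes \<alpha>: "\<alpha> \<in> irr"
  shows "int N < cf_q \<alpha> k \<Longrightarrow> \<bar>\<Sum>n=1..N. \<phi> (x + real n * \<alpha>)\<bar> \<le> V * of_int (\<Sum>i=1..k. cf_a \<alpha> i)"
proof (induction k arbitrary: N x)
  case 0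
  then show ?case by simp
next
  case (Suc k)
  let ?Q = "nat (cf_q \<alpha> k)"
  have q: "1 \<le> cf_q \<alpha> k" by (rule cf_q_ge_1[OF \<alpha>])
  define b r where "b = N div ?Q" and "r = N mod ?Q"
  have N: "N = b * ?Q + r" by (simp add: b_def r_def)
  have r: "int r < cf_q \<alpha> k" using q unfolding r_def by (metis mod_less_divisor zless_nat_eq_int_zless zless_nat_conj int_one_le_iff_zero_less nat_0_le of_nat_less_iff zero_less_nat_eq)
  have "int b * cf_q \<alpha> k < (cf_a \<alpha> (Suc k) + 1) * cf_q \<alpha> k"
  proof -
    have "int b * cf_q \<alpha> k \<le> int N" using q unfolding N by simp
    also have "\<dots> < cf_q \<alpha> (Suc k)" by (rule Suc.prems)
    also have "\<dots> \<le> (cf_a \<alpha> (Suc k) + 1) * cf_q \<alpha> k" by (rule cf_q_Suc_bounds(2)[OF \<alpha>])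
    finally show ?thesis .
  qed
  then have b: "int b \<le> cf_a \<alpha> (Suc k)" using q by (simp add: mult_less_cancel_right)
  have "(\<Sum>n=1..N. \<phi> (x + real n * \<alpha>))
      = (\<Sum>n=1..b*?Q. \<phi> (x + real n * \<alpha>)) + (\<Sum>n=1..r. \<phi> ((x + real (b * ?Q) * \<alpha>) + real n * \<alpha>))"
    unfolding N sum_blocks by (simp add: algebra_simps)
  moreover have "\<bar>\<Sum>n=1..b*?Q. \<phi> (x + real n * \<alpha>)\<bar> \<le> real b * V"
    by (rule repeated_blocks[OF cf_denominator_sum[OF \<alpha>]])
  moreover have "real b * V \<le> of_int (cf_a \<alpha> (Suc k)) * V"
    using b V_nonneg by (intro mult_right_mono) linarith+
  moreover have "\<bar>\<Sum>n=1..r. \<phi> ((x + real (b * ?Q) * \<alpha>) + real n * \<alpha>)\<bar> \<le> V * of_int (\<Sum>i=1..k. cf_a \<alpha> i)"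
    by (rule Suc.IH[OF r])
  ultimately show ?case by (simp add: algebra_simps)
qed

text \<open>Here \<open>P / Q\<close> is the convergent and the drift per block
  \<open>Q * \<delta>\<close> equals \<open>cf_rho \<alpha> k\<close>. For even \<open>k\<close> the
  convergent lies below \<open>\<alpha>\<close>, so the drift is positive.\<close>

lemma cf_block_sum:
  assumes \<alpha>: "\<alpha> \<in> irr" and k: "even k"
    and b: "real b * (of_int (cf_q \<alpha> k) * cf_rho \<alpha> k) \<le> 1"
  shows "\<bar>(\<Sum>n=1..b*nat (cf_q \<alpha> k). \<phi> (x + real n * \<alpha>))
    - (\<Sum>j<nat (cf_q \<alpha> k). F (x + real j / of_int (cf_q \<alpha> k) + real b * cf_rho \<alpha> k)
        - F (x + real j / of_int (cf_q \<alpha> k))) / cf_rho \<alpha> k\<bar> \<le> V"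
proof -
  have q: "1 \<le> cf_q \<alpha> k" by (rule cf_q_ge_1[OF \<alpha>])
  let ?Q = "nat (cf_q \<alpha> k)"
  have Q: "0 < ?Q" "real ?Q = of_int (cf_q \<alpha> k)" using q by auto
  let ?\<delta> = "cf_rho \<alpha> k / of_int (cf_q \<alpha> k)"
  have "\<alpha> = of_int (cf_p \<alpha> k) / real ?Q + ?\<delta>"
    using cf_approx[OF \<alpha>, of k] q k unfolding Q(2) by (simp add: field_simps)
  moreover have "0 < ?\<delta>" using q cf_rho_pos[OF \<alpha>, of k] by simp
  moreover have h: "real ?Q * ?\<delta> = cf_rho \<alpha> k" using q by simp
  moreover have "coprime (cf_p \<alpha> k) (int ?Q)" using coprime_cf[of \<alpha> k] q by simp
  moreover have "real b * (real ?Q * ?\<delta>) \<le> 1 / real ?Q"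
    unfolding h unfolding Q(2) using b q by (simp add: field_simps)
  ultimately show ?thesis using block_sum[OF Q(1), of "cf_p \<alpha> k" \<alpha> ?\<delta> b x] unfolding h unfolding Q(2) by blast
qed

lemma cf_block_sum_odd:
  assumes \<alpha>: "\<alpha> \<in> irr" and k: "odd k"
    and b: "real b * (of_int (cf_q \<alpha> k) * cf_rho \<alpha> k) \<le> 1"
  shows "\<bar>(\<Sum>n=1..b*nat (cf_q \<alpha> k). \<phi> (x + real n * \<alpha>))
    - (\<Sum>j<nat (cf_q \<alpha> k). F (x - real j / of_int (cf_q \<alpha> k))
        - F (x - real j / of_int (cf_q \<alpha> k) - real b * cf_rho \<alpha> k)) / cf_rho \<alpha> k\<bar> \<le> V"
proof -
  have q: "1 \<le> cf_q \<alpha> k" by (rule cf_q_ge_1[OF \<alpha>])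
  let ?Q = "nat (cf_q \<alpha> k)"
  have Q: "0 < ?Q" "real ?Q = of_int (cf_q \<alpha> k)" using q by auto
  let ?\<delta> = "cf_rho \<alpha> k / of_int (cf_q \<alpha> k)"
  have "- \<alpha> = of_int (- cf_p \<alpha> k) / real ?Q + ?\<delta>"
    using cf_approx[OF \<alpha>, of k] q k unfolding Q(2) by (simp add: field_simps)
  moreover have "0 < ?\<delta>" using q cf_rho_pos[OF \<alpha>, of k] by simp
  moreover have h: "real ?Q * ?\<delta> = cf_rho \<alpha> k" using q by simp
  moreover have "coprime (- cf_p \<alpha> k) (int ?Q)" using coprime_cf[of \<alpha> k] q by simp
  moreover have "real b * (real ?Q * ?\<delta>) \<le> 1 / real ?Q"
    unfolding h unfolding Q(2) using b q by (simp add: field_simps)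
  ultimately have "\<bar>(\<Sum>n=1..b*?Q. \<phi> (- (- x + real n * - \<alpha>)))
    - (\<Sum>j<?Q. - F (- (- x + real j / of_int (cf_q \<alpha> k) + real b * cf_rho \<alpha> k))
        - - F (- (- x + real j / of_int (cf_q \<alpha> k)))) / cf_rho \<alpha> k\<bar> \<le> V"
    using periodic_variation.block_sum[OF reflected Q(1), of "- cf_p \<alpha> k" "- \<alpha>" ?\<delta> b "- x"]
    unfolding h unfolding Q(2) by blast
  moreover have "- F (- (- x + real j / of_int (cf_q \<alpha> k) + real b * cf_rho \<alpha> k)) - - F (- (- x + real j / of_int (cf_q \<alpha> k)))
     = F (x - real j / of_int (cf_q \<alpha> k)) - F (x - real j / of_int (cf_q \<alpha> k) - real b * cf_rho \<alpha> k)" for j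
    by (simp add: algebra_simps)
  ultimately show ?thesis unfolding reflected_sum[symmetric] by simp
qed

end

section \<open>The sawtooth function\<close>

lemma periodic_variation_add:
  assumes "periodic_variation \<phi> F \<mu> V" "periodic_variation \<phi>' F' \<mu>' V'"
  shows "periodic_variation (\<lambda>x. \<phi> x + \<phi>' x) (\<lambda>x. F x + F' x) (\<lambda>x. \<mu> x + \<mu>' x) (V + V')"
proof -
  interpret A: periodic_variation \<phi> F \<mu> V by fact
  interpret B: periodic_variation \<phi>' F' \<mu>' V' by fact
  show ?thesis
  proof
    fix u y v :: real
    assume "u \<le> y" "y \<le> v"
    from A.control[OF this] B.control[OF this]
    show "\<bar>F v + F' v - (F u + F' u) - (v - u) * (\<phi> y + \<phi>' y)\<bar> \<le> (v - u) * (\<mu> v + \<mu>' v - (\<mu> u + \<mu>' u))"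
      by (simp add: algebra_simps)
  qed (simp_all add: A.periodic B.periodic A.F_periodic B.F_periodic A.\<mu>_shift B.\<mu>_shift)
qed

lemma periodic_variation_scale:
  assumes "periodic_variation \<phi> F \<mu> V"
  shows "periodic_variation (\<lambda>x. c * \<phi> x) (\<lambda>x. c * F x) (\<lambda>x. \<bar>c\<bar> * \<mu> x) (\<bar>c\<bar> * V)"
proof -
  interpret periodic_variation \<phi> F \<mu> V by fact
  show ?thesis
  proof
    fix u y v :: real
    assume "u \<le> y" "y \<le> v"
    then have "\<bar>c\<bar> * \<bar>F v - F u - (v - u) * \<phi> y\<bar> \<le> \<bar>c\<bar> * ((v - u) * (\<mu> v - \<mu> u))"
      by (intro mult_left_mono control) auto
    also have "\<bar>c\<bar> * \<bar>F v - F u - (v - u) * \<phi> y\<bar> = \<bar>c * F v - c * F u - (v - u) * (c * \<phi> y)\<bar>"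
      unfolding abs_mult[symmetric] by (simp add: algebra_simps)
    finally show "\<bar>c * F v - c * F u - (v - u) * (c * \<phi> y)\<bar> \<le> (v - u) * (\<bar>c\<bar> * \<mu> v - \<bar>c\<bar> * \<mu> u)"
      by (simp add: algebra_simps)
  qed (simp_all add: periodic F_periodic \<mu>_shift distrib_left)
qed

lemma periodic_variation_translate:
  assumes "periodic_variation \<phi> F \<mu> V"
  shows "periodic_variation (\<lambda>x. \<phi> (x - a)) (\<lambda>x. F (x - a)) (\<lambda>x. \<mu> (x - a)) V"
proof -
  interpret periodic_variation \<phi> F \<mu> V by fact
  have s: "x + 1 - a = x - a + 1" for x by simp
  show ?thesis
  proof
    fix u y v :: real
    assume "u \<le> y" "y \<le> v"
    then show "\<bar>F (v - a) - F (u - a) - (v - u) * \<phi> (y - a)\<bar> \<le> (v - u) * (\<mu> (v - a) - \<mu> (u - a))"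
      using control[of "u - a" "y - a" "v - a"] by simp
  qed (simp_all only: s periodic F_periodic \<mu>_shift)
qed

lemma periodic_variation_sum:
  assumes "finite X" "\<And>i. i \<in> X \<Longrightarrow> periodic_variation (\<phi> i) (F i) (\<mu> i) (V i)"
  shows "periodic_variation (\<lambda>x. \<Sum>i\<in>X. \<phi> i x) (\<lambda>x. \<Sum>i\<in>X. F i x) (\<lambda>x. \<Sum>i\<in>X. \<mu> i x) (\<Sum>i\<in>X. V i)"
  using assms
proof (induction X rule: finite_induct)
  case empty
  show ?case by unfold_locales auto
next
  case (insert i X)
  then show ?case using periodic_variation_add[of "\<phi> i" "F i" "\<mu> i" "V i"] by simp
qed

definition saw :: "real \<Rightarrow> real" where
  "saw x = frac x - 1 / 2"

text \<open>The periodic antiderivative of \<open>saw\<close> that vanishes at the integers; up to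
  an additive constant, half of the second Bernoulli function.\<close>

definition saw2 :: "real \<Rightarrow> real" where
  "saw2 x = ((frac x)\<^sup>2 - frac x) / 2"

lemma frac_add_1: "frac (x + 1) = frac (x::real)"
  by (simp add: frac_def)

lemma saw_periodic: "saw (x + 1) = saw x"
  by (simp add: saw_def frac_add_1)

lemma saw2_periodic: "saw2 (x + 1) = saw2 x"
  by (simp add: saw2_def frac_add_1)

lemma saw2_periodic_int: "saw2 (x + of_int k) = saw2 x"
  using periodic_int_shift[of saw2 1 x k] saw2_periodic by simp

lemma abs_saw_le: "\<bar>saw x\<bar> \<le> 1 / 2"
  unfolding saw_def using frac_ge_0[of x] frac_lt_1[of x] by linarith

lemma abs_saw2_le: "\<bar>saw2 x\<bar> \<le> frac x / 2" "\<bar>saw2 x\<bar> \<le> (1 - frac x) / 2"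
proof -
  have e: "\<bar>saw2 x\<bar> = frac x * (1 - frac x) / 2"
  proof -
    have "saw2 x = - (frac x * (1 - frac x) / 2)" 
      by (simp add: saw2_def power2_eq_square right_diff_distrib minus_divide_left)
    moreover have "0 \<le> frac x * (1 - frac x)"
      using frac_lt_1[of x] by (intro mult_nonneg_nonneg) (auto simp: less_imp_le)
    ultimately show ?thesis by simp
  qed
  have "frac x * (1 - frac x) \<le> frac x * 1" "frac x * (1 - frac x) \<le> 1 * (1 - frac x)"
    using frac_lt_1[of x] by (intro mult_left_mono mult_right_mono; simp)+
  then show "\<bar>saw2 x\<bar> \<le> frac x / 2" "\<bar>saw2 x\<bar> \<le> (1 - frac x) / 2" unfolding e by simp_all
qed

lemma saw2_same_floor:
  assumes "\<lfloor>u\<rfloor> = \<lfloor>v\<rfloor>"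
  shows "saw2 v - saw2 u = (v - u) * ((frac u + frac v) / 2 - 1 / 2)"
proof -
  have "v - u = frac v - frac u" using assms by (simp add: frac_def)
  moreover have "saw2 v - saw2 u = (frac v - frac u) * ((frac u + frac v) / 2 - 1 / 2)"
    unfolding saw2_def power2_eq_square by (simp add: field_simps)
  ultimately show ?thesis by simp
qed

text \<open>Without an integer in between, the difference factors. Otherwise \<open>saw2\<close>
  vanishes at that integer, and each value is at most half of the distance to an integer on the
  way.\<close>

lemma saw2_lipschitz: "u \<le> v \<Longrightarrow> \<bar>saw2 v - saw2 u\<bar> \<le> (v - u) / 2"
proof (cases "\<lfloor>u\<rfloor> = \<lfloor>v\<rfloor>")
  case True
  assume uv: "u \<le> v"
  have "\<bar>(frac u + frac v) / 2 - 1 / 2\<bar> \<le> 1 / 2"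
  proof -
    have "0 \<le> frac u + frac v" "frac u + frac v \<le> 2" using frac_lt_1[of u] frac_lt_1[of v] by auto
    then show ?thesis by (simp add: abs_le_iff field_simps)
  qed
  then have "\<bar>v - u\<bar> * \<bar>(frac u + frac v) / 2 - 1 / 2\<bar> \<le> \<bar>v - u\<bar> * (1 / 2)" by (intro mult_left_mono) auto
  then show ?thesis unfolding saw2_same_floor[OF True] abs_mult using uv by simp
next
  case False
  assume uv: "u \<le> v"
  then have "\<lfloor>u\<rfloor> < \<lfloor>v\<rfloor>" using False floor_mono[OF uv] by linarith
  then have "real_of_int \<lfloor>u\<rfloor> + 1 \<le> real_of_int \<lfloor>v\<rfloor>" by linarith
  then have "(1 - frac u) + frac v \<le> v - u" by (simp add: frac_def)
  moreover have "\<bar>saw2 v - saw2 u\<bar> \<le> frac v / 2 + (1 - frac u) / 2"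
    by (rule order_trans[OF abs_triangle_ineq4 add_mono[OF abs_saw2_le(1) abs_saw2_le(2)]])
  ultimately show ?thesis by (simp add: field_simps)
qed

text \<open>In the majorant, \<open>x\<close> accounts for the slope 1 and the floor for the unit
  jumps, hence the total 2. An interval crossing an integer has a majorant increment of at least 1,
  so the crude bounds \<open>1 / 2 + 1 / 2\<close> suffice there.\<close>

lemma periodic_variation_saw: "periodic_variation saw saw2 (\<lambda>x. x + of_int \<lfloor>x\<rfloor>) 2"
proof
  fix u y v :: real
  assume uy: "u \<le> y" and yv: "y \<le> v"
  show "\<bar>saw2 v - saw2 u - (v - u) * saw y\<bar> \<le> (v - u) * (v + real_of_int \<lfloor>v\<rfloor> - (u + real_of_int \<lfloor>u\<rfloor>))"
  proof (cases "\<lfloor>u\<rfloor> = \<lfloor>v\<rfloor>")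
    case True
    then have y: "\<lfloor>y\<rfloor> = \<lfloor>u\<rfloor>" using floor_mono[OF uy] floor_mono[OF yv] by linarith
    have "saw2 v - saw2 u - (v - u) * saw y = (v - u) * ((frac u + frac v) / 2 - frac y)"
      unfolding saw2_same_floor[OF True] saw_def by (simp add: algebra_simps)
    moreover have "\<bar>(frac u + frac v) / 2 - frac y\<bar> \<le> v - u"
    proof -
      have "(frac u + frac v) / 2 - frac y = (u + v) / 2 - y" using True y by (simp add: frac_def field_simps)
      then show ?thesis using uy yv by (simp add: abs_le_iff field_simps)
    qed
    ultimately show ?thesis using uy yv True by (auto simp: abs_mult intro!: mult_left_mono)
  next
    case False
    then have "\<lfloor>u\<rfloor> < \<lfloor>v\<rfloor>" using floor_mono[of u v] uy yv by linarith
    then have "1 \<le> v + real_of_int \<lfloor>v\<rfloor> - (u + real_of_int \<lfloor>u\<rfloor>)" using uy yv by linarith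
    then have "(v - u) * 1 \<le> (v - u) * (v + real_of_int \<lfloor>v\<rfloor> - (u + real_of_int \<lfloor>u\<rfloor>))"
      using uy yv by (intro mult_left_mono) auto
    moreover have "\<bar>(v - u) * saw y\<bar> \<le> (v - u) * (1 / 2)"
      unfolding abs_mult using abs_saw_le[of y] uy yv by (intro mult_mono) auto
    moreover have "\<bar>saw2 v - saw2 u\<bar> \<le> (v - u) / 2" using uy yv by (intro saw2_lipschitz) simp
    ultimately show ?thesis by linarith
  qed
qed (simp_all add: saw_periodic saw2_periodic)

section \<open>Lattice sums of the sawtooth and of the continuous part\<close>

lemma lattice_sum_shift:
  fixes f :: "real \<Rightarrow> real"
  assumes "\<And>x. f (x + 1) = f x" "0 < Q"
  shows "(\<Sum>j<Q. f (x + 1 / real Q + real j / real Q)) = (\<Sum>j<Q. f (x + real j / real Q))"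
proof -
  have "(\<Sum>j<Q. f (x + 1 / real Q + real j / real Q)) = (\<Sum>j<Q. f (x + real (Suc j) / real Q))"
    by (intro sum.cong) (simp_all add: add_divide_distrib add_ac)
  also have "\<dots> = (\<Sum>j<Q. f (x + real j / real Q)) + f (x + real Q / real Q) - f (x + real 0 / real Q)"
    using sum.lessThan_Suc_shift[of "\<lambda>j. f (x + real j / real Q)" Q] by simp
  also have "\<dots> = (\<Sum>j<Q. f (x + real j / real Q))" using assms by simp
  finally show ?thesis .
qed

text \<open>The multiplication formula of the second Bernoulli polynomial. The difference
  \<open>d\<close> has period \<open>1 / Q\<close>, and on the first cell no fractional part wraps
  around, so a polynomial identity shows it to be constant.\<close>

lemma saw2_lattice_sum:
  assumes Q: "0 < Q"
  shows "(\<Sum>j<Q. saw2 (x + real j / real Q)) = saw2 (real Q * x) / real Q + (\<Sum>j<Q. saw2 (real j / real Q))"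
proof -
  define d where "d x = (\<Sum>j<Q. saw2 (x + real j / real Q)) - saw2 (real Q * x) / real Q" for x
  have per: "d (x + 1 / real Q) = d x" for x
  proof -
    have "real Q * (x + 1 / real Q) = real Q * x + 1" using Q by (simp add: algebra_simps)
    then show ?thesis unfolding d_def using lattice_sum_shift[of saw2 Q x] saw2_periodic Q by simp
  qed
  have local: "d y = d 0" if y: "0 \<le> y" "y < 1 / real Q" for y
  proof -
    have fr: "frac (y + real j / real Q) = y + real j / real Q" "frac (real j / real Q) = real j / real Q" if "j < Q" for j
    proof -
      have "y + real j / real Q < 1 / real Q + real j / real Q" using y by simp
      also have "\<dots> = real (Suc j) / real Q" by (simp add: add_divide_distrib)
      also have "\<dots> \<le> 1" using that by simp
      finally show "frac (y + real j / real Q) = y + real j / real Q" "frac (real j / real Q) = real j / real Q"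
        using y that by (auto simp: frac_eq)
    qed
    have yQ: "frac (real Q * y) = real Q * y" using y Q by (simp add: frac_eq field_simps)
    have "(\<Sum>j<Q. saw2 (y + real j / real Q)) - (\<Sum>j<Q. saw2 (0 + real j / real Q))
        = (\<Sum>j<Q. (y\<^sup>2 - y) / 2 + y / real Q * real j)"
      unfolding sum_subtractf[symmetric]
      by (intro sum.cong) (simp_all add: saw2_def fr power2_eq_square algebra_simps add_divide_distrib diff_divide_distrib)
    also have "\<dots> = real Q * ((y\<^sup>2 - y) / 2) + y / real Q * (\<Sum>j<Q. real j)"
      by (simp add: sum.distrib sum_distrib_left)
    also have "(\<Sum>j<Q. real j) = real Q * (real Q - 1) / 2"
      by (induction Q) (simp_all add: field_simps)
    also have "real Q * ((y\<^sup>2 - y) / 2) + y / real Q * (real Q * (real Q - 1) / 2) = ((real Q * y)\<^sup>2 - real Q * y) / 2 / real Q"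
      using Q by (simp add: field_simps power2_eq_square)
    also have "\<dots> = saw2 (real Q * y) / real Q" by (simp add: saw2_def yQ)
    finally show ?thesis by (simp add: d_def saw2_def)
  qed
  have "d x = d (x - of_int \<lfloor>real Q * x\<rfloor> * (1 / real Q))"
    using periodic_int_shift[of d "1 / real Q" x "- \<lfloor>real Q * x\<rfloor>"] per by simp
  also have "\<dots> = d 0"
  proof (rule local)
    have "x - of_int \<lfloor>real Q * x\<rfloor> * (1 / real Q) = frac (real Q * x) / real Q"
      using Q by (simp add: frac_def field_simps)
    then show "0 \<le> x - of_int \<lfloor>real Q * x\<rfloor> * (1 / real Q)" "x - of_int \<lfloor>real Q * x\<rfloor> * (1 / real Q) < 1 / real Q"
      using Q frac_lt_1[of "real Q * x"] by (auto intro!: divide_strict_right_mono)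
  qed
  finally show ?thesis by (simp add: d_def saw2_def)
qed

lemma saw2_lattice_diff:
  assumes "0 < Q"
  shows "(\<Sum>j<Q. saw2 (x + real j / real Q + s) - saw2 (x + real j / real Q))
    = (saw2 (real Q * x + real Q * s) - saw2 (real Q * x)) / real Q"
proof -
  have "(\<Sum>j<Q. saw2 (x + real j / real Q + s)) = (\<Sum>j<Q. saw2 ((x + s) + real j / real Q))"
    by (intro sum.cong) (simp_all add: add_ac)
  then show ?thesis
    using saw2_lattice_sum[OF assms, of x] saw2_lattice_sum[OF assms, of "x + s"]
    by (simp add: sum_subtractf distrib_left diff_divide_distrib)
qed

text \<open>A mean value estimate that tolerates finitely many points without derivative, obtained
  by integrating the derivative.\<close>

lemma increment_bounds:
  fixes T T' :: "real \<Rightarrow> real"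
  assumes ab: "a \<le> b" and S: "finite S" and cont: "continuous_on {a..b} T"
    and der: "\<And>x. x \<in> {a<..<b} - S \<Longrightarrow> (T has_real_derivative T' x) (at x)"
    and bound: "\<And>x. x \<in> {a<..<b} - S \<Longrightarrow> lo \<le> T' x \<and> T' x \<le> hi"
  shows "lo * (b - a) \<le> T b - T a" "T b - T a \<le> hi * (b - a)"
proof -
  \<comment> \<open>The value \<open>c\<close> outside the set of good points is free; taking
    \<open>lo\<close> or \<open>hi\<close> makes the respective bound hold on the whole
    interval.\<close>
  have int: "((\<lambda>x. if x \<in> {a<..<b} - S then T' x else c) has_integral (T b - T a)) {a..b}" for c
  proof (rule fundamental_theorem_of_calculus_interior_strong[OF S ab _ cont])
    fix x assume "x \<in> {a<..<b} - S"
    then show "(T has_vector_derivative (if x \<in> {a<..<b} - S then T' x else c)) (at x)"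
      using der by (simp add: has_real_derivative_iff_has_vector_derivative)
  qed
  have const: "((\<lambda>x. c) has_integral (c * (b - a))) {a..b}" for c :: real
    using has_integral_const_real[of c a b] ab by (simp add: mult.commute)
  show "lo * (b - a) \<le> T b - T a"
    by (rule has_integral_le[OF const int[of lo]]) (use bound in auto)
  show "T b - T a \<le> hi * (b - a)"
    by (rule has_integral_le[OF int[of hi] const]) (use bound in auto)
qed

lemma finite_frac_preimage:
  assumes "finite X"
  shows "finite {y \<in> {a..b}. frac (y + s) \<in> (X :: real set)}"
proof (rule finite_subset)
  show "{y \<in> {a..b}. frac (y + s) \<in> X} \<subseteq> (\<lambda>(m, i). of_int m + i - s) ` ({\<lfloor>a + s\<rfloor>..\<lfloor>b + s\<rfloor>} \<times> X)"
  proof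
    fix y assume y: "y \<in> {y \<in> {a..b}. frac (y + s) \<in> X}"
    then have "\<lfloor>y + s\<rfloor> \<in> {\<lfloor>a + s\<rfloor>..\<lfloor>b + s\<rfloor>}" by (auto intro!: floor_mono)
    moreover have "y = of_int \<lfloor>y + s\<rfloor> + frac (y + s) - s" by (simp add: frac_def)
    ultimately show "y \<in> (\<lambda>(m, i). of_int m + i - s) ` ({\<lfloor>a + s\<rfloor>..\<lfloor>b + s\<rfloor>} \<times> X)"
      using y by (intro image_eqI[of _ _ "(\<lfloor>y + s\<rfloor>, frac (y + s))"]) auto
  qed
  show "finite ((\<lambda>(m, i). of_int m + i - s) ` ({\<lfloor>a + s\<rfloor>..\<lfloor>b + s\<rfloor>} \<times> X))" using assms by simp
qed

text \<open>The points \<open>x + j / Q\<close> and \<open>y + j / Q\<close> interlace into one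
  increasing list, and the required terms are its gaps at even positions. A single application of
  the variation bound thus covers all \<open>j\<close>, with no factor \<open>Q\<close>.\<close>

lemma bounded_variation_pairs:
  fixes g :: "real \<Rightarrow> real"
  assumes W: "\<And>ts. sorted ts \<Longrightarrow> set ts \<subseteq> {0..<1} \<Longrightarrow> (\<Sum>i<length ts - 1. \<bar>g (ts ! Suc i) - g (ts ! i)\<bar>) \<le> W"
    and Q: "0 < Q" and xy: "0 \<le> x" "x \<le> y" "y < 1 / real Q"
  shows "(\<Sum>j<Q. \<bar>g (y + real j / real Q) - g (x + real j / real Q)\<bar>) \<le> W"
proof -
  define t where "t k = (if even k then x else y) + real (k div 2) / real Q" for k :: nat
  have mono: "t k \<le> t (Suc k)" for k
  proof (cases "even k")
    case True
    then show ?thesis using xy by (simp add: t_def)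
  next
    case False
    then have "real (Suc k div 2) = real (k div 2) + 1" by (auto elim!: oddE)
    then show ?thesis using False xy by (simp add: t_def add_divide_distrib)
  qed
  define ts where "ts = map t [0..<2 * Q]"
  have len: "length ts = 2 * Q" by (simp add: ts_def)
  have "sorted ts"
    unfolding ts_def sorted_map sorted_wrt_upt
    by (rule sorted_wrt_mono_rel[OF _ sorted_upt]) (auto intro: lift_Suc_mono_le[of t, OF mono])
  moreover have "set ts \<subseteq> {0..<1}"
  proof -
    have "0 \<le> t k \<and> t k < 1" if k: "k < 2 * Q" for k
    proof -
      have "t k < 1 / real Q + real (k div 2) / real Q" using xy by (simp add: t_def)
      also have "\<dots> = real (Suc (k div 2)) / real Q" by (simp add: add_divide_distrib)
      also have "\<dots> \<le> 1"
      proof -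
        have "Suc (k div 2) \<le> Q" using k by linarith
        then have "real (Suc (k div 2)) \<le> real Q" by (rule of_nat_mono)
        then show ?thesis using Q by (simp only: divide_le_eq_1) simp
      qed
      finally show ?thesis using xy by (auto simp: t_def)
    qed
    then show ?thesis by (auto simp: ts_def)
  qed
  ultimately have le: "(\<Sum>i<length ts - 1. \<bar>g (ts ! Suc i) - g (ts ! i)\<bar>) \<le> W" by (rule W)
  have "(\<Sum>j<Q. \<bar>g (y + real j / real Q) - g (x + real j / real Q)\<bar>)
      = (\<Sum>j<Q. \<bar>g (ts ! Suc (2 * j)) - g (ts ! (2 * j))\<bar>)"
    by (intro sum.cong) (simp_all add: ts_def t_def)
  also have "\<dots> = (\<Sum>i\<in>(\<lambda>j. 2 * j) ` {..<Q}. \<bar>g (ts ! Suc i) - g (ts ! i)\<bar>)"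
    by (subst sum.reindex) (auto simp: inj_on_def)
  also have "\<dots> \<le> (\<Sum>i<length ts - 1. \<bar>g (ts ! Suc i) - g (ts ! i)\<bar>)"
    by (intro sum_mono2) (auto simp: len)
  finally show ?thesis using le by simp
qed

text \<open>The lattice sum \<open>T\<close> has period \<open>1 / Q\<close>. Its derivative
  oscillates by at most \<open>W\<close> and has mean zero over a period, so it is at most
  \<open>W\<close> in absolute value. The antiderivative \<open>R\<close> is periodic as well, so
  \<open>T\<close> vanishes somewhere in a cell, and a cell has length only
  \<open>1 / Q\<close>.\<close>

lemma lattice_sum_le:
  fixes h g F :: "real \<Rightarrow> real"
  assumes W: "\<And>ts. sorted ts \<Longrightarrow> set ts \<subseteq> {0..<1} \<Longrightarrow> (\<Sum>i<length ts - 1. \<bar>g (ts ! Suc i) - g (ts ! i)\<bar>) \<le> W"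
    and X: "finite X"
    and per: "\<And>x. h (x + 1) = h x" and cont: "\<And>x. isCont h x"
    and der: "\<And>x. frac x \<notin> X \<Longrightarrow> (h has_real_derivative g (frac x) - \<Gamma>) (at x)"
    and F: "\<And>x. (F has_real_derivative h x) (at x)" and Fper: "\<And>x. F (x + 1) = F x"
    and Q: "0 < Q"
  shows "\<bar>\<Sum>j<Q. h (x + real j / real Q)\<bar> \<le> W / real Q"
proof -
  define T where "T y = (\<Sum>j<Q. h (y + real j / real Q))" for y
  define T' where "T' y = (\<Sum>j<Q. g (y + real j / real Q) - \<Gamma>)" for y
  define S where "S = (\<Union>j<Q. {y \<in> {0..1 / real Q}. frac (y + real j / real Q) \<in> X})"
  have S: "finite S" unfolding S_def using X by (intro finite_UN_I finite_frac_preimage) auto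
  have Q1: "0 < 1 / real Q" using Q by simp
  have Tper: "T (y + 1 / real Q) = T y" for y
    unfolding T_def by (rule lattice_sum_shift[of h, OF per Q])
  have Tcont: "continuous_on A T" for A
    unfolding T_def by (intro continuous_intros continuous_on_compose2[OF continuous_at_imp_continuous_on[of UNIV h]]) (auto simp: cont)
  have Tder: "(T has_real_derivative T' y) (at y)" if y: "y \<in> {0<..<1 / real Q} - S" for y
    unfolding T_def T'_def
  proof (rule DERIV_sum)
    fix j assume j: "j \<in> {..<Q}"
    have "y + real j / real Q < 1 / real Q + real j / real Q" using y by simp
    also have "\<dots> = real (Suc j) / real Q" by (simp add: add_divide_distrib)
    also have "\<dots> \<le> 1" using j Q by simp
    finally have fr: "frac (y + real j / real Q) = y + real j / real Q" using y by (simp add: frac_eq)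
    have "y \<in> {0..1 / real Q}" using y by auto
    then have "frac (y + real j / real Q) \<notin> X" using y j by (auto simp: S_def)
    from der[OF this] show "((\<lambda>y. h (y + real j / real Q)) has_real_derivative g (y + real j / real Q) - \<Gamma>) (at y)"
      unfolding fr by (simp add: DERIV_shift)
  qed
  have T'diff: "\<bar>T' y - T' z\<bar> \<le> W" if yz: "y \<in> {0<..<1 / real Q}" "z \<in> {0<..<1 / real Q}" for y z
  proof -
    have le: "\<bar>T' y - T' z\<bar> \<le> W" if "0 < z" "z \<le> y" "y < 1 / real Q" for y z
    proof -
      have "\<bar>T' y - T' z\<bar> = \<bar>\<Sum>j<Q. g (y + real j / real Q) - g (z + real j / real Q)\<bar>"
        unfolding T'_def sum_subtractf[symmetric] by simp
      also have "\<dots> \<le> (\<Sum>j<Q. \<bar>g (y + real j / real Q) - g (z + real j / real Q)\<bar>)" by (rule sum_abs)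
      also have "\<dots> \<le> W" using that by (intro bounded_variation_pairs[OF W Q]) auto
      finally show ?thesis .
    qed
    show ?thesis
    proof (cases "z \<le> y")
      case True
      then show ?thesis using le[of z y] yz by simp
    next
      case False
      then show ?thesis using le[of y z] yz by (simp add: abs_minus_commute)
    qed
  qed
  have T'le: "\<bar>T' z\<bar> \<le> W" if z: "z \<in> {0<..<1 / real Q}" for z
  proof -
    have bd: "T' z - W \<le> T' y \<and> T' y \<le> T' z + W" if "y \<in> {0<..<1 / real Q} - S" for y
      using T'diff[of y z] that z by (auto simp: abs_le_iff)
    have "(T' z - W) * (1 / real Q - 0) \<le> T (1 / real Q) - T 0" "T (1 / real Q) - T 0 \<le> (T' z + W) * (1 / real Q - 0)"
      using increment_bounds[OF less_imp_le[OF Q1] S Tcont Tder bd] by simp_all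
    moreover have "T (1 / real Q) = T 0" using Tper[of 0] by simp
    ultimately have "(T' z - W) * (1 / real Q) \<le> 0" "0 \<le> (T' z + W) * (1 / real Q)" by simp_all
    then have "T' z - W \<le> 0" "0 \<le> T' z + W"
      using Q by (auto simp: divide_le_0_iff zero_le_divide_iff)
    then show ?thesis by linarith
  qed
  have Tdiff: "\<bar>T y - T z\<bar> \<le> W / real Q" if yz: "0 \<le> z" "z \<le> y" "y \<le> 1 / real Q" for y z
  proof -
    have W0: "0 \<le> W" using W[of "[]"] by simp
    have sub: "x \<in> {z<..<y} - S \<Longrightarrow> x \<in> {0<..<1 / real Q} - S" for x using yz by auto
    have bd: "- W \<le> T' x \<and> T' x \<le> W" if "x \<in> {z<..<y} - S" for x
      using T'le[of x] sub[OF that] by (auto simp: abs_le_iff)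
    have "- W * (y - z) \<le> T y - T z" "T y - T z \<le> W * (y - z)"
      using increment_bounds[OF yz(2) S Tcont Tder[OF sub] bd] by simp_all
    then have "\<bar>T y - T z\<bar> \<le> W * (y - z)" by (simp add: abs_le_iff)
    also have "\<dots> \<le> W * (1 / real Q)" using yz W0 by (intro mult_left_mono) auto
    finally show ?thesis by simp
  qed
  define R where "R y = (\<Sum>j<Q. F (y + real j / real Q))" for y
  have Rder: "(R has_real_derivative T y) (at y)" for y
    unfolding R_def T_def by (intro DERIV_sum) (simp add: F flip: DERIV_shift)
  have "R (0 + 1 / real Q) = R 0" unfolding R_def by (rule lattice_sum_shift[of F, OF Fper Q])
  then have "R (1 / real Q) = R 0" by simp
  moreover obtain z where z: "0 < z" "z < 1 / real Q" "R (1 / real Q) - R 0 = (1 / real Q - 0) * T z"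
    using MVT2[OF Q1, of R T] Rder by blast
  ultimately have Tz: "T z = 0" using Q by simp
  define y where "y = frac (real Q * x) / real Q"
  have y: "0 \<le> y" "y \<le> 1 / real Q"
    using Q less_imp_le[OF frac_lt_1[of "real Q * x"]] by (auto simp: y_def intro!: divide_right_mono)
  have "y = x + of_int (- \<lfloor>real Q * x\<rfloor>) * (1 / real Q)"
    using Q by (simp add: y_def frac_def field_simps)
  then have "T x = T y" using periodic_int_shift[of T "1 / real Q" x "- \<lfloor>real Q * x\<rfloor>"] Tper by simp
  moreover have "\<bar>T y\<bar> \<le> W / real Q"
  proof (cases "z \<le> y")
    case True
    then show ?thesis using Tdiff[of z y] z y Tz by simp
  next
    case False
    then show ?thesis using Tdiff[of y z] z y Tz by simp
  qed
  ultimately show ?thesis by (simp add: T_def)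
qed

section \<open>Decomposition of piecewise smooth functions\<close>

lemma frac_avoids_nearby:
  fixes X :: "real set"
  assumes "finite X"
  obtains d where "0 < d" "\<And>y. y \<noteq> x \<Longrightarrow> \<bar>y - x\<bar> < d \<Longrightarrow> frac y \<notin> X"
proof -
  have "finite {y \<in> {x - 1..x + 1}. frac (y + 0) \<in> X}" by (rule finite_frac_preimage[OF assms])
  from finite_set_avoid[OF this, of x] obtain d where
    d: "0 < d" "\<And>y. y \<in> {y \<in> {x - 1..x + 1}. frac (y + 0) \<in> X} \<Longrightarrow> y \<noteq> x \<Longrightarrow> d \<le> dist x y"
    by blast
  show thesis
  proof (rule that)
    show "0 < min d 1" using d(1) by simp
    fix y assume y: "y \<noteq> x" "\<bar>y - x\<bar> < min d 1"
    then have "y \<in> {x - 1..x + 1}" "dist x y < d" by (auto simp: dist_real_def abs_le_iff)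
    then show "frac y \<notin> X" using d(2)[of y] y by fastforce
  qed
qed

text \<open>A bounded derivative makes \<open>f\<close> Lipschitz on each side of \<open>x\<close>,
  hence uniformly continuous there and extendable to the endpoint.\<close>

lemma one_sided_limits_of_bounded_derivative:
  fixes f :: "real \<Rightarrow> real"
  assumes d: "0 < d" and der: "\<And>y. y \<noteq> x \<Longrightarrow> \<bar>y - x\<bar> < d \<Longrightarrow> (f has_real_derivative f' y) (at y)"
    and bound: "\<And>y. \<bar>f' y\<bar> \<le> B"
  shows "\<exists>l. (f \<longlongrightarrow> l) (at_right x)" "\<exists>l. (f \<longlongrightarrow> l) (at_left x)"
proof -
  have uc: "uniformly_continuous_on S f" if S: "convex S" "\<And>y. y \<in> S \<Longrightarrow> y \<noteq> x \<and> \<bar>y - x\<bar> < d" for S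
  proof -
    have B: "0 \<le> B" using bound[of 0] by linarith
    have "B-lipschitz_on S f"
    proof (rule lipschitz_onI[OF _ B])
      fix u v assume uv: "u \<in> S" "v \<in> S"
      have "norm (f u - f v) \<le> B * norm (u - v)"
        using S bound by (intro field_differentiable_bound[OF S(1) _ _ uv(1) uv(2), of f f' B])
          (auto intro: has_field_derivative_at_within der)
      then show "dist (f u) (f v) \<le> B * dist u v" by (simp add: dist_norm)
    qed
    then show ?thesis by (rule lipschitz_on_uniformly_continuous)
  qed
  have "x \<in> closure {x<..<x + d}" using d by simp
  moreover have "uniformly_continuous_on {x<..<x + d} f" by (rule uc) auto
  ultimately obtain l where "(f \<longlongrightarrow> l) (at x within {x<..<x + d})"
    using uniformly_continuous_on_extension_at_closure by blast
  moreover have "at x within {x<..<x + d} = at_right x"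
    by (rule at_within_nhd[of x "{x - d<..<x + d}"]) (use d in auto)
  ultimately show "\<exists>l. (f \<longlongrightarrow> l) (at_right x)" by auto
  have "x \<in> closure {x - d<..<x}" using d by simp
  moreover have "uniformly_continuous_on {x - d<..<x} f" by (rule uc) auto
  ultimately obtain l where "(f \<longlongrightarrow> l) (at x within {x - d<..<x})"
    using uniformly_continuous_on_extension_at_closure by blast
  moreover have "at x within {x - d<..<x} = at_left x"
    by (rule at_within_nhd[of x "{x - d<..<x + d}"]) (use d in auto)
  ultimately show "\<exists>l. (f \<longlongrightarrow> l) (at_left x)" by auto
qed

lemma saw_at_right_0: "(saw \<longlongrightarrow> - 1 / 2) (at_right 0)"
proof (rule Lim_transform_eventually)
  show "((\<lambda>y. y - 1 / 2) \<longlongrightarrow> - 1 / 2) (at_right (0::real))"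
    by (auto intro!: tendsto_eq_intros)
  have "eventually (\<lambda>y::real. y \<in> {0<..<1}) (at_right 0)" by (rule eventually_at_right_real) simp
  then show "eventually (\<lambda>y. y - 1 / 2 = saw y) (at_right 0)"
    by eventually_elim (auto simp: saw_def frac_eq)
qed

lemma saw_at_left_0: "(saw \<longlongrightarrow> 1 / 2) (at_left 0)"
proof (rule Lim_transform_eventually)
  show "((\<lambda>y. y + 1 / 2) \<longlongrightarrow> 1 / 2) (at_left (0::real))"
    by (auto intro!: tendsto_eq_intros)
  have "eventually (\<lambda>y::real. y \<in> {-1<..<0}) (at_left 0)" by (rule eventually_at_left_real) simp
  then show "eventually (\<lambda>y. y + 1 / 2 = saw y) (at_left 0)"
  proof eventually_elim
    case (elim y)
    then have "\<lfloor>y\<rfloor> = -1" by (simp add: floor_eq_iff)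
    then show ?case by (simp add: saw_def frac_def)
  qed
qed

lemma frac_has_derivative:
  fixes x :: real
  assumes "x \<notin> \<int>"
  shows "(frac has_real_derivative 1) (at x)"
proof -
  have "((\<lambda>z. real_of_int \<lfloor>z\<rfloor>) has_real_derivative 0) (at x)"
    using floor_has_real_derivative[of x "\<lambda>z. z"] assms by simp
  from DERIV_diff[OF DERIV_ident this] show ?thesis by (simp add: frac_def[abs_def])
qed

lemma saw_has_derivative: "x \<notin> \<int> \<Longrightarrow> (saw has_real_derivative 1) (at x)"
  unfolding saw_def[abs_def] by (auto intro!: derivative_eq_intros frac_has_derivative)

lemma saw2_has_derivative: "x \<notin> \<int> \<Longrightarrow> (saw2 has_real_derivative saw x) (at x)"
  unfolding saw2_def[abs_def] saw_def by (auto intro!: derivative_eq_intros frac_has_derivative)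

lemma diff_notin_Ints:
  assumes "frac x \<noteq> i" "0 \<le> i" "i < (1::real)"
  shows "x - i \<notin> \<int>"
proof
  assume "x - i \<in> \<int>"
  then obtain m :: int where "x - i = of_int m" by (auto elim: Ints_cases)
  then have "x = of_int m + i" by simp
  then have "frac x = i" using assms(2,3) by (simp add: frac_def floor_eq_iff)
  with assms(1) show False by simp
qed

text \<open>The coefficient \<open>c i\<close> is left limit minus right limit. As
  \<open>saw\<close> drops by 1 at each integer, subtracting \<open>c i * saw (x - i)\<close>
  removes the jump. Values of \<open>f\<close> on \<open>X\<close> are arbitrary, so
  \<open>h\<close> is defined there by limits and the formula for \<open>f\<close> is asserted only
  off \<open>X\<close>.\<close>

lemma sawtooth_decomposition:
  assumes psm: "piecewise_smooth_rat_disc f"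
  obtains X c g h where
    "finite X" "X \<subseteq> \<rat> \<inter> {0..<1}" "\<exists>i\<in>X. c i \<noteq> 0" "bounded_variation_on g {0..<1}"
    "\<And>x. h (x + 1) = h x" "\<And>x. isCont h x"
    "\<And>x. frac x \<notin> X \<Longrightarrow> f x = h x + (\<Sum>i\<in>X. c i * saw (x - i))"
    "\<And>x. frac x \<notin> X \<Longrightarrow> (h has_real_derivative g (frac x) - (\<Sum>i\<in>X. c i)) (at x)"
proof -
  from psm have per: "\<And>x. f (x + 1) = f x" unfolding piecewise_smooth_rat_disc_def by blast
  from psm obtain X g x0 L where X: "finite X" "X \<subseteq> \<rat> \<inter> {0..<1}"
    and bv: "bounded_variation_on g {0..<1}"
    and der0: "\<And>x. x \<in> {0..<1} - X \<Longrightarrow> (f has_real_derivative g x) (at x)"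
    and x0: "x0 \<in> X" and L: "L \<noteq> 0" "((\<lambda>\<delta>. f (x0 - \<delta>) - f (x0 + \<delta>)) \<longlongrightarrow> L) (at_right 0)"
    unfolding piecewise_smooth_rat_disc_def by blast
  have X01: "0 \<le> i" "i < 1" if "i \<in> X" for i using X(2) that by auto
  have per_int: "f (x + of_int k) = f x" for x k
    using periodic_int_shift[of f 1 x k] per by simp
  have der: "(f has_real_derivative g (frac x)) (at x)" if "frac x \<notin> X" for x
  proof -
    have "(f has_real_derivative g (frac x)) (at (frac x))"
      using der0[of "frac x"] that by (auto simp: frac_lt_1)
    then have "(f has_real_derivative g (frac x)) (at (x + of_int (- \<lfloor>x\<rfloor>)))" by (simp add: frac_def)
    then show ?thesis unfolding DERIV_shift by (simp only: per_int)
  qed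
  \<comment> \<open>The variation over the two-point list \<open>[0, x]\<close> already bounds
    \<open>g\<close>.\<close>
  obtain B where B: "\<And>x. x \<in> {0..<1} \<Longrightarrow> \<bar>g x\<bar> \<le> B"
  proof -
    obtain W where W: "\<And>ts. sorted ts \<Longrightarrow> set ts \<subseteq> {0..<1} \<Longrightarrow> (\<Sum>i<length ts - 1. \<bar>g (ts ! Suc i) - g (ts ! i)\<bar>) \<le> W"
      using bv unfolding bounded_variation_on_def by blast
    have "\<bar>g x\<bar> \<le> W + \<bar>g 0\<bar>" if "x \<in> {0..<1}" for x
      using W[of "[0, x]"] that by simp
    with that show thesis by blast
  qed
  have lims: "\<exists>l. (f \<longlongrightarrow> l) (at_right x)" "\<exists>l. (f \<longlongrightarrow> l) (at_left x)" for x
  proof -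
    obtain d where d: "0 < d" "\<And>y. y \<noteq> x \<Longrightarrow> \<bar>y - x\<bar> < d \<Longrightarrow> frac y \<notin> X"
      using frac_avoids_nearby[OF X(1)] by blast
    have "\<bar>g (frac y)\<bar> \<le> B" for y by (intro B) (simp add: frac_lt_1)
    then show "\<exists>l. (f \<longlongrightarrow> l) (at_right x)" "\<exists>l. (f \<longlongrightarrow> l) (at_left x)"
      using one_sided_limits_of_bounded_derivative[of d x f "\<lambda>y. g (frac y)" B] d der by blast+
  qed
  then obtain r l where r: "\<And>x. (f \<longlongrightarrow> r x) (at_right x)" and l: "\<And>x. (f \<longlongrightarrow> l x) (at_left x)"
    by metis
  define c where "c i = l i - r i" for i
  have "c x0 \<noteq> 0"
  proof -
    have "((\<lambda>\<delta>. f (\<delta> + x0)) \<longlongrightarrow> r x0) (at_right 0)" using r[of x0] unfolding filterlim_at_right_to_0[of _ _ x0] .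
    moreover have "((\<lambda>\<delta>. f (x0 - \<delta>)) \<longlongrightarrow> l x0) (at_right 0)"
      using l[of x0] unfolding filterlim_at_left_to_right filterlim_at_right_to_0[of _ _ "- x0"] by (simp add: add.commute)
    ultimately have "((\<lambda>\<delta>. f (x0 - \<delta>) - f (x0 + \<delta>)) \<longlongrightarrow> l x0 - r x0) (at_right 0)"
      by (intro tendsto_diff) (simp_all add: add.commute)
    then have "L = c x0" unfolding c_def using L(2) by (intro tendsto_unique[of "at_right (0::real)"]) auto
    then show ?thesis using L(1) by simp
  qed
  define F where "F x = f x - (\<Sum>i\<in>X. c i * saw (x - i))" for x
  have Fper: "F (x + of_int k) = F x" for x k
  proof -
    have "saw (x + of_int k - i) = saw (x - i)" for i
      using periodic_int_shift[of saw 1 "x - i" k] saw_periodic by (simp add: algebra_simps)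
    then show ?thesis by (simp add: F_def per_int)
  qed
  have Fder: "(F has_real_derivative g (frac x) - (\<Sum>i\<in>X. c i)) (at x)" if x: "frac x \<notin> X" for x
  proof -
    have "((\<lambda>x. c i * saw (x - i)) has_real_derivative c i) (at x)" if i: "i \<in> X" for i
    proof -
      have "(saw has_real_derivative 1) (at (x + (- i)))"
        using diff_notin_Ints[of x i] X01[OF i] x i by (intro saw_has_derivative) auto
      then have "((\<lambda>x. saw (x + (- i))) has_real_derivative 1) (at x)" unfolding DERIV_shift .
      from DERIV_cmult[OF this, of "c i"] show ?thesis by simp
    qed
    then have "((\<lambda>x. \<Sum>i\<in>X. c i * saw (x - i)) has_real_derivative (\<Sum>i\<in>X. c i)) (at x)"
      by (intro DERIV_sum)
    then show ?thesis unfolding F_def by (intro DERIV_diff der x)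
  qed
  have Flim0: "\<exists>L. (F \<longlongrightarrow> L) (at x)" if x: "x \<in> X" for x
  proof -
    have other: "((\<lambda>y. c i * saw (y - i)) \<longlongrightarrow> c i * saw (x - i)) (at x)" if i: "i \<in> X - {x}" for i
    proof -
      have "frac x = x" using X01[OF x] by (simp add: frac_eq)
      then have "x - i \<notin> \<int>" using i X01[of i] by (intro diff_notin_Ints) auto
      then have "isCont saw (x - i)" by (intro DERIV_isCont[OF saw_has_derivative])
      then have "((\<lambda>y. saw (y - i)) \<longlongrightarrow> saw (x - i)) (at x)"
        by (rule isCont_tendsto_compose) (intro tendsto_intros)
      then show ?thesis by (intro tendsto_mult tendsto_const)
    qed
    define R where "R = (\<Sum>i\<in>X - {x}. c i * saw (x - i))"
    have Fsplit: "F = (\<lambda>y. f y - (c x * saw (y - x) + (\<Sum>i\<in>X - {x}. c i * saw (y - i))))"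
      by (simp add: F_def fun_eq_iff sum.remove[OF X(1) x])
    have sumlim: "((\<lambda>y. \<Sum>i\<in>X - {x}. c i * saw (y - i)) \<longlongrightarrow> R) (at x within A)" for A
      unfolding R_def by (intro tendsto_sum) (use other in \<open>blast intro: tendsto_within_subset[of _ _ _ UNIV]\<close>)
    have sr: "((\<lambda>y. saw (y - x)) \<longlongrightarrow> - 1 / 2) (at_right x)"
      unfolding filterlim_at_right_to_0[of _ _ x] using saw_at_right_0 by simp
    have sl: "((\<lambda>y. saw (y - x)) \<longlongrightarrow> 1 / 2) (at_left x)"
      using saw_at_left_0 unfolding filterlim_at_left_to_right[of _ _ x] filterlim_at_left_to_right[of _ _ 0]
        filterlim_at_right_to_0[of _ _ "- x"] by simp
    have 1: "(F \<longlongrightarrow> r x - (c x * (- 1 / 2) + R)) (at_right x)"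
      unfolding Fsplit by (intro tendsto_intros r sr sumlim)
    have 2: "(F \<longlongrightarrow> l x - (c x * (1 / 2) + R)) (at_left x)"
      unfolding Fsplit by (intro tendsto_intros l sl sumlim)
    \<comment> \<open>The one-sided limits \<open>1 / 2\<close> and \<open>- 1 / 2\<close> of
      \<open>saw\<close> make up for the difference between those of \<open>f\<close>.\<close>
    have eq: "l x - (c x * (1 / 2) + R) = r x - (c x * (- 1 / 2) + R)" by (simp add: c_def field_simps)
    have "(F \<longlongrightarrow> l x - (c x * (1 / 2) + R)) (at_right x)" unfolding eq by (rule 1)
    from filterlim_split_at[OF 2 this] show ?thesis by blast
  qed
  have Flim: "\<exists>L. (F \<longlongrightarrow> L) (at x)" for x
  proof (cases "frac x \<in> X")
    case True
    then obtain L where "(F \<longlongrightarrow> L) (at (frac x))" using Flim0 by blast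
    from LIM_offset[OF this, of "- of_int \<lfloor>x\<rfloor>"]
    have "((\<lambda>y. F (y + of_int (- \<lfloor>x\<rfloor>))) \<longlongrightarrow> L) (at x)" by (simp add: frac_def)
    then show ?thesis unfolding Fper by blast
  next
    case False
    then have "isCont F x" using DERIV_isCont[OF Fder] by blast
    then show ?thesis by (auto simp: isCont_def)
  qed
  define h where "h x = (if frac x \<in> X then Lim (at x) F else F x)" for x
  have Fh: "(F \<longlongrightarrow> h x) (at x)" for x
  proof (cases "frac x \<in> X")
    case True
    obtain L where "(F \<longlongrightarrow> L) (at x)" using Flim by blast
    moreover from this have "Lim (at x) F = L" by (intro tendsto_Lim) auto
    ultimately show ?thesis using True by (simp add: h_def)
  next
    case False
    then have "isCont F x" using DERIV_isCont[OF Fder] by blast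
    then show ?thesis using False by (simp add: h_def isCont_def)
  qed
  have ev: "eventually (\<lambda>y. F y = h y) (at x)" for x
  proof -
    obtain d where d: "0 < d" "\<And>y. y \<noteq> x \<Longrightarrow> \<bar>y - x\<bar> < d \<Longrightarrow> frac y \<notin> X"
      using frac_avoids_nearby[OF X(1)] by blast
    then show ?thesis by (auto simp: eventually_at dist_real_def h_def)
  qed
  show thesis
  proof (rule that[OF X _ bv])
    show "\<exists>i\<in>X. c i \<noteq> 0" using x0 \<open>c x0 \<noteq> 0\<close> by blast
    show "isCont h x" for x
      unfolding isCont_def by (rule Lim_transform_eventually[OF Fh ev])
    show "h (x + 1) = h x" for x
    proof -
      have "((\<lambda>y. F (y + 1)) \<longlongrightarrow> h (x + 1)) (at (x + 1 - 1))" by (rule LIM_offset[OF Fh])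
      then have "(F \<longlongrightarrow> h (x + 1)) (at x)" using Fper[of _ 1] by simp
      then show ?thesis using Fh[of x] by (intro tendsto_unique[of "at x" F]) auto
    qed
    show "f x = h x + (\<Sum>i\<in>X. c i * saw (x - i))" if "frac x \<notin> X" for x
      using that by (simp add: h_def F_def)
    show "(h has_real_derivative g (frac x) - (\<Sum>i\<in>X. c i)) (at x)" if x: "frac x \<notin> X" for x
    proof -
      have "eventually (\<lambda>y. F y = h y) (nhds x)"
        using ev[of x, unfolded eventually_at_filter]
        by (rule eventually_mono) (use x in \<open>auto simp: h_def\<close>)
      from DERIV_cong_ev[OF refl this refl] show ?thesis using Fder[OF x] by simp
    qed
  qed
qed

section \<open>Positive upper density\<close>

lemma upper_density_pos:
  assumes \<rho>: "0 < \<rho>" and dense: "\<And>m. \<exists>M\<ge>m. 0 < M \<and> \<rho> * real M \<le> real (card {N \<in> A. N \<le> M})"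
  shows "0 < upper_density A"
proof (rule ccontr)
  assume "\<not> 0 < upper_density A"
  then have "upper_density A < ereal \<rho>" using \<rho> by (simp add: not_less le_less_trans)
  then have "eventually (\<lambda>M. ereal (real (card {N \<in> A. N \<le> M}) / real M) < ereal \<rho>) sequentially"
    unfolding upper_density_def by (rule Limsup_lessD)
  then obtain m where m: "\<And>M. m \<le> M \<Longrightarrow> real (card {N \<in> A. N \<le> M}) / real M < \<rho>"
    unfolding eventually_sequentially by auto
  obtain M where "m \<le> M" "0 < M" "\<rho> * real M \<le> real (card {N \<in> A. N \<le> M})" using dense by blast
  with m[of M] show False by (simp add: divide_less_eq)
qed

lemma upper_density_mono: "A \<subseteq> B \<Longrightarrow> upper_density A \<le> upper_density B"
  unfolding upper_density_def
  by (intro Limsup_mono always_eventually allI)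
     (auto intro!: divide_right_mono card_mono of_nat_mono)

text \<open>The lattice is symmetric modulo 1. For odd \<open>k\<close> the orbit traverses it
  backwards, and this brings the sums to the form of the even case.\<close>

lemma sum_lattice_negate:
  fixes f :: "real \<Rightarrow> real"
  assumes per: "\<And>x. f (x + 1) = f x" and Q: "0 < Q"
  shows "(\<Sum>j<Q. f (x - real j / real Q)) = (\<Sum>j<Q. f (x + real j / real Q))"
proof -
  have "(\<Sum>j<Q. f (x - real j / real Q)) = (\<Sum>j<Q. f (x - real (Q - Suc j) / real Q))"
    by (rule sum.nat_diff_reindex[symmetric])
  also have "\<dots> = (\<Sum>j<Q. f (x + 1 / real Q + real j / real Q))"
  proof (intro sum.cong refl)
    fix j assume "j \<in> {..<Q}"
    then have eq: "x - real (Q - Suc j) / real Q + 1 = x + 1 / real Q + real j / real Q"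
      using Q by (simp add: of_nat_diff field_simps)
    show "f (x - real (Q - Suc j) / real Q) = f (x + 1 / real Q + real j / real Q)"
      using per[of "x - real (Q - Suc j) / real Q"] unfolding eq by (rule sym)
  qed
  also have "\<dots> = (\<Sum>j<Q. f (x + real j / real Q))" by (rule lattice_sum_shift[of f, OF per Q])
  finally show ?thesis .
qed

section \<open>Birkhoff sums before a large partial quotient\<close>

context periodic_variation
begin

text \<open>Merges the parities: for odd \<open>k\<close> the drift points backwards, and by the
  symmetry of the lattice the difference takes the even form with both the shift and the overall
  sign reversed.\<close>

lemma cf_block_sum_signed:
  fixes \<alpha> :: real and k :: nat and b :: nat
  defines "\<epsilon> \<equiv> (if even k then 1 else - 1 :: real)" and "Q \<equiv> nat (cf_q \<alpha> k)"
  assumes \<alpha>: "\<alpha> \<in> irr" and b: "real b * (real Q * cf_rho \<alpha> k) \<le> 1"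
  shows "\<bar>(\<Sum>n=1..b*Q. \<phi> (x + real n * \<alpha>))
    - \<epsilon> * (\<Sum>j<Q. F (x + real j / real Q + \<epsilon> * (real b * cf_rho \<alpha> k)) - F (x + real j / real Q)) / cf_rho \<alpha> k\<bar> \<le> V"
proof -
  have q: "1 \<le> cf_q \<alpha> k" by (rule cf_q_ge_1[OF \<alpha>])
  have Q: "0 < Q" "real_of_int (cf_q \<alpha> k) = real Q" using q by (auto simp: Q_def)
  have b': "real b * (real_of_int (cf_q \<alpha> k) * cf_rho \<alpha> k) \<le> 1" using b Q by simp
  show ?thesis
  proof (cases "even k")
    case True
    then show ?thesis using cf_block_sum[OF \<alpha> True b', of x] unfolding Q(2) Q_def[symmetric] \<epsilon>_def by simp
  next
    case False
    let ?s = "real b * cf_rho \<alpha> k"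
    have "(\<Sum>j<Q. F (x - real j / real Q) - F (x - real j / real Q - ?s))
       = (\<Sum>j<Q. F (x - real j / real Q)) - (\<Sum>j<Q. F (x - ?s - real j / real Q))"
      by (simp add: sum_subtractf algebra_simps)
    also have "\<dots> = (\<Sum>j<Q. F (x + real j / real Q)) - (\<Sum>j<Q. F (x - ?s + real j / real Q))"
      using sum_lattice_negate[of F Q] F_periodic Q(1) by simp
    also have "\<dots> = \<epsilon> * (\<Sum>j<Q. F (x + real j / real Q + \<epsilon> * ?s) - F (x + real j / real Q))"
      using False by (simp add: \<epsilon>_def sum_subtractf algebra_simps)
    finally show ?thesis using cf_block_sum_odd[OF \<alpha> False b', of x] unfolding Q(2) Q_def[symmetric] by simp
  qed
qed

text \<open>Of the gain \<open>3 * \<eta>\<close>, one \<open>\<eta>\<close> pays for the lattice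
  error, which leaves \<open>2 * \<eta> * a\<close>. A further \<open>\<eta> * a\<close> pays for
  the block error \<open>V\<close> and the remainder \<open>V * s\<close>. All digits involved sum
  to at most \<open>2 * a\<close>, so the surviving \<open>\<eta> * a\<close> gives the constant
  \<open>\<eta> / 2\<close>.\<close>

lemma large_partial_quotient_sum:
  fixes K :: "real \<Rightarrow> real" and D A :: int and e :: bool
  defines "\<epsilon> \<equiv> (if e then 1 else - 1 :: real)"
  assumes \<alpha>: "\<alpha> \<in> irr" and good: "good_index D A e \<alpha> k" and k: "1 \<le> k"
    and lattice: "\<And>Q s. 0 < Q \<Longrightarrow> D dvd int Q - 1 \<Longrightarrow>
      \<bar>(\<Sum>j<Q. F (x + real j / real Q + s) - F (x + real j / real Q)) - (K (real Q * s) - K 0) / real Q\<bar> \<le> \<bar>s\<bar> * W / real Q"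
    and gain: "\<And>\<beta>. \<beta>1 \<le> \<beta> \<Longrightarrow> \<beta> \<le> \<beta>2 \<Longrightarrow> 3 * \<eta> \<le> \<epsilon> * (K (\<epsilon> * \<beta>) - K 0)"
    and \<beta>: "0 < \<beta>1" "\<beta>1 < \<beta>2" "\<beta>2 < 1" and \<eta>: "0 < \<eta>" and A: "1 \<le> A" "2 * V \<le> \<eta> * of_int A"
    and W: "W \<le> \<eta> * of_int (cf_q \<alpha> k)"
    and N: "(\<beta>1 * (of_int (cf_a \<alpha> (Suc k)) + 2) + 1) * of_int (cf_q \<alpha> k) \<le> real N"
      "real N \<le> \<beta>2 * of_int (cf_a \<alpha> (Suc k)) * of_int (cf_q \<alpha> k)"
  shows "\<eta> / 2 * (\<Sum>i=1..cf_K \<alpha> N. real_of_int (cf_a \<alpha> i)) \<le> (\<Sum>n=1..N. \<phi> (x + real n * \<alpha>))"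
proof -
  define Q where "Q = nat (cf_q \<alpha> k)"
  define \<rho> where "\<rho> = cf_rho \<alpha> k"
  define a where "a = real_of_int (cf_a \<alpha> (Suc k))"
  define s where "s = (\<Sum>i=1..k. cf_a \<alpha> i)"
  have q: "1 \<le> cf_q \<alpha> k" by (rule cf_q_ge_1[OF \<alpha>])
  have Q: "0 < Q" "real_of_int (cf_q \<alpha> k) = real Q" "int Q = cf_q \<alpha> k" using q by (auto simp: Q_def)
  have Q1: "1 \<le> real Q" using Q by simp
  have \<rho>: "0 < \<rho>" by (simp add: \<rho>_def cf_rho_pos[OF \<alpha>])
  have a1: "1 \<le> a" using cf_a_ge_1[OF \<alpha>, of k] by (simp add: a_def)
  have dv: "D dvd int Q - 1" and par: "even k = e" and As: "A * s \<le> cf_a \<alpha> (Suc k)"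
    using good by (auto simp: good_index_def s_def Q(3))
  have s1: "1 \<le> s"
  proof -
    have "(\<Sum>i=1..k. 1) \<le> s" unfolding s_def using cf_a_ge_1[OF \<alpha>] by (intro sum_mono) (metis atLeastAtMost_iff Suc_le_D One_nat_def)
    then show ?thesis using k by simp
  qed
  have As': "of_int A * real_of_int s \<le> a" using As unfolding a_def by (metis of_int_le_iff of_int_mult)
  have Qrho: "a * (real Q * \<rho>) \<le> 1" "1 \<le> (a + 2) * (real Q * \<rho>)"
  proof -
    have "a * real Q \<le> real_of_int (cf_q \<alpha> (Suc k))"
      using cf_q_Suc_bounds(1)[OF \<alpha>, of k] unfolding a_def Q(2)[symmetric] by (metis of_int_le_iff of_int_mult)
    then have "a * real Q * \<rho> \<le> real_of_int (cf_q \<alpha> (Suc k)) * \<rho>" using \<rho> by (intro mult_right_mono) auto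
    also have "\<dots> \<le> 1" unfolding \<rho>_def by (rule cf_rho_bounds(1)[OF \<alpha>])
    finally show "a * (real Q * \<rho>) \<le> 1" by (simp add: mult.assoc)
    show "1 \<le> (a + 2) * (real Q * \<rho>)"
      using cf_rho_bounds(2)[OF \<alpha>, of k] unfolding a_def \<rho>_def Q(2) .
  qed
  have Qr: "0 < real Q * \<rho>" using Q1 \<rho> by simp
  \<comment> \<open>In the lower bound on \<open>N\<close>, the extra 1 absorbs the rounding in
    \<open>N div Q\<close>, and \<open>a + 2\<close> matches the lower bound on
    \<open>Q * \<rho>\<close>.\<close>
  define b r where "b = N div Q" and "r = N mod Q"
  have Nbr: "N = b * Q + r" "r < Q" using Q by (auto simp: b_def r_def)
  have N': "(\<beta>1 * (a + 2) + 1) * real Q \<le> real N" "real N \<le> \<beta>2 * a * real Q"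
    using N unfolding a_def Q(2) .
  have b2: "real b \<le> \<beta>2 * a"
  proof -
    have "real b * real Q \<le> real N" unfolding Nbr(1) by simp
    with N'(2) have "real b * real Q \<le> \<beta>2 * a * real Q" by linarith
    then show ?thesis using Q1 by simp
  qed
  have b1: "\<beta>1 * (a + 2) \<le> real b"
  proof -
    have "real N \<le> (real b + 1) * real Q" using Nbr by (simp add: algebra_simps)
    with N'(1) have "(\<beta>1 * (a + 2) + 1) * real Q \<le> (real b + 1) * real Q" by linarith
    then show ?thesis using Q1 by simp
  qed
  \<comment> \<open>The total drift \<open>b * \<rho>\<close> in units of the cell width
    \<open>1 / Q\<close>; this is the argument at which the profile \<open>K\<close> is
    evaluated.\<close>
  define \<beta> where "\<beta> = real b * (real Q * \<rho>)"
  have \<beta>b: "\<beta>1 \<le> \<beta>" "\<beta> \<le> \<beta>2"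
  proof -
    have "\<beta>1 * 1 \<le> \<beta>1 * ((a + 2) * (real Q * \<rho>))" using Qrho \<beta> by (intro mult_left_mono) auto
    also have "\<dots> = \<beta>1 * (a + 2) * (real Q * \<rho>)" by simp
    also have "\<dots> \<le> \<beta>" unfolding \<beta>_def using b1 Qr by (intro mult_right_mono) auto
    finally show "\<beta>1 \<le> \<beta>" by simp
    have "\<beta> \<le> \<beta>2 * a * (real Q * \<rho>)" unfolding \<beta>_def using b2 Qr by (intro mult_right_mono) auto
    also have "\<dots> = \<beta>2 * (a * (real Q * \<rho>))" by simp
    also have "\<dots> \<le> \<beta>2 * 1" using Qrho \<beta> by (intro mult_left_mono) auto
    finally show "\<beta> \<le> \<beta>2" by simp
  qed
  let ?\<Lambda> = "\<Sum>j<Q. F (x + real j / real Q + \<epsilon> * (real b * \<rho>)) - F (x + real j / real Q)"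
  have \<epsilon>k: "\<epsilon> = (if even k then 1 else - 1)" using par by (simp add: \<epsilon>_def)
  have \<epsilon>: "\<bar>\<epsilon>\<bar> = 1" "\<epsilon> * \<epsilon> = 1" by (auto simp: \<epsilon>_def)
  have "\<bar>?\<Lambda> - (K (real Q * (\<epsilon> * (real b * \<rho>))) - K 0) / real Q\<bar> \<le> \<bar>\<epsilon> * (real b * \<rho>)\<bar> * W / real Q"
    by (rule lattice[OF Q(1) dv])
  moreover have "real Q * (\<epsilon> * (real b * \<rho>)) = \<epsilon> * \<beta>" by (simp add: \<beta>_def)
  moreover have "\<bar>\<epsilon> * (real b * \<rho>)\<bar> = \<beta> / real Q" using \<rho> Q1 by (simp add: abs_mult \<epsilon> \<beta>_def)
  ultimately have L1: "\<bar>?\<Lambda> - (K (\<epsilon> * \<beta>) - K 0) / real Q\<bar> \<le> \<beta> / real Q * W / real Q" by simp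
  have "\<epsilon> * (K (\<epsilon> * \<beta>) - K 0) / real Q - \<epsilon> * ?\<Lambda> = - (\<epsilon> * (?\<Lambda> - (K (\<epsilon> * \<beta>) - K 0) / real Q))"
    by (simp add: algebra_simps)
  also have "\<dots> \<le> \<bar>\<epsilon> * (?\<Lambda> - (K (\<epsilon> * \<beta>) - K 0) / real Q)\<bar>" by simp
  also have "\<dots> \<le> \<beta> / real Q * W / real Q" unfolding abs_mult \<epsilon>(1) using L1 by simp
  also have "\<dots> \<le> \<eta> / real Q"
  proof -
    have "W / real Q \<le> \<eta>" using W Q1 unfolding Q(2) by (simp add: divide_le_eq)
    then have "\<beta> * (W / real Q) \<le> 1 * \<eta>"
      using \<beta> \<beta>b \<eta> by (intro order_trans[OF mult_left_mono mult_right_mono]) auto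
    then have "\<beta> * (W / real Q) / real Q \<le> \<eta> / real Q" using Q1 by (intro divide_right_mono) auto
    then show ?thesis by simp
  qed
  finally have "3 * \<eta> / real Q - \<eta> / real Q \<le> \<epsilon> * ?\<Lambda>"
    using divide_right_mono[OF gain[OF \<beta>b], of "real Q"] Q1 by linarith
  then have "2 * \<eta> / real Q / \<rho> \<le> \<epsilon> * ?\<Lambda> / \<rho>"
    using \<rho> by (intro divide_right_mono) (simp_all add: diff_divide_distrib[symmetric])
  moreover have "2 * \<eta> * a \<le> 2 * \<eta> / real Q / \<rho>"
  proof -
    have "2 * \<eta> * (a * (real Q * \<rho>)) \<le> 2 * \<eta> * 1" using Qrho \<eta> by (intro mult_left_mono) auto
    then show ?thesis using Qr by (simp add: le_divide_eq mult.assoc)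
  qed
  moreover have "\<bar>(\<Sum>n=1..b*Q. \<phi> (x + real n * \<alpha>)) - \<epsilon> * ?\<Lambda> / \<rho>\<bar> \<le> V"
    using cf_block_sum_signed[OF \<alpha>, of b k x] \<beta>b \<beta> unfolding Q_def[symmetric] \<rho>_def[symmetric] \<epsilon>k[symmetric] \<beta>_def by simp
  ultimately have S1: "2 * \<eta> * a - V \<le> (\<Sum>n=1..b*Q. \<phi> (x + real n * \<alpha>))" by linarith
  have S2: "- (V * of_int s) \<le> (\<Sum>n=1..r. \<phi> ((x + real (b * Q) * \<alpha>) + real n * \<alpha>))"
    using Ostrowski_sum[OF \<alpha>, of r k "x + real (b * Q) * \<alpha>"] Nbr(2) unfolding s_def[symmetric] Q(3)[symmetric]
    by (simp add: abs_le_iff)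
  have "(\<Sum>n=1..N. \<phi> (x + real n * \<alpha>))
      = (\<Sum>n=1..b*Q. \<phi> (x + real n * \<alpha>)) + (\<Sum>n=1..r. \<phi> ((x + real (b * Q) * \<alpha>) + real n * \<alpha>))"
    unfolding Nbr(1) sum_blocks by (simp add: algebra_simps)
  with S1 S2 have S: "2 * \<eta> * a - V - V * of_int s \<le> (\<Sum>n=1..N. \<phi> (x + real n * \<alpha>))" by linarith
  have "V * 1 \<le> V * of_int s" using V_nonneg s1 by (intro mult_left_mono) auto
  moreover have "2 * V * of_int s \<le> \<eta> * a"
  proof -
    have "2 * V * of_int s \<le> \<eta> * of_int A * of_int s" using A s1 by (intro mult_right_mono) auto
    also have "\<dots> \<le> \<eta> * a" using As' \<eta> by (simp add: mult.assoc)
    finally show ?thesis .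
  qed
  ultimately have "\<eta> * a \<le> 2 * \<eta> * a - V - V * of_int s" by linarith
  with S have "\<eta> * a \<le> (\<Sum>n=1..N. \<phi> (x + real n * \<alpha>))" by linarith
  moreover have "\<eta> / 2 * (\<Sum>i=1..cf_K \<alpha> N. real_of_int (cf_a \<alpha> i)) \<le> \<eta> * a"
  proof -
    have "real_of_int s * 1 \<le> real_of_int s * of_int A" using s1 A by (intro mult_left_mono) auto
    then have sa: "real_of_int s \<le> a" using As' by (simp add: mult.commute)
    have "cf_K \<alpha> N = Suc k"
    proof (rule cf_K_eq[OF \<alpha>])
      have "0 \<le> \<beta>1 * (a + 2) * real Q" using \<beta> a1 by simp
      then have "real Q \<le> real N" using N'(1) by (simp add: distrib_right)
      then show "cf_q \<alpha> k \<le> int N" unfolding Q(3)[symmetric] by simp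
      have "\<beta>2 * (a * real Q) < 1 * (a * real Q)" using \<beta> a1 Q1 by (intro mult_strict_right_mono) auto
      then have "real N < a * real Q" using N'(2) by (simp add: mult.assoc)
      also have "a * real Q \<le> real_of_int (cf_q \<alpha> (Suc k))"
        using cf_q_Suc_bounds(1)[OF \<alpha>, of k] unfolding a_def Q(2)[symmetric] by (metis of_int_le_iff of_int_mult)
      finally show "int N < cf_q \<alpha> (Suc k)" by linarith
    qed
    then have "(\<Sum>i=1..cf_K \<alpha> N. real_of_int (cf_a \<alpha> i)) = of_int s + a"
      by (simp add: s_def a_def)
    also have "\<dots> \<le> 2 * a" using sa by simp
    finally have "\<eta> / 2 * (\<Sum>i=1..cf_K \<alpha> N. real_of_int (cf_a \<alpha> i)) \<le> \<eta> / 2 * (2 * a)"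
      using \<eta> by (intro mult_left_mono) auto
    then show ?thesis by simp
  qed
  ultimately show ?thesis by linarith
qed

text \<open>Each good index provides a window of admissible \<open>N\<close> ending at some
  \<open>M \<le> a * Q\<close>, with at least \<open>(\<beta>2 - \<beta>1) / 2 * (a * Q)\<close>
  elements. This proportion recurs for arbitrarily large \<open>M\<close>.\<close>

lemma large_partial_quotient_density:
  fixes K :: "real \<Rightarrow> real" and D A :: int and e :: bool
  defines "\<epsilon> \<equiv> (if e then 1 else - 1 :: real)"
  assumes \<alpha>: "\<alpha> \<in> irr" and good: "\<And>m. \<exists>k\<ge>m. good_index D A e \<alpha> k"
    and lattice: "\<And>Q s. 0 < Q \<Longrightarrow> D dvd int Q - 1 \<Longrightarrow>
      \<bar>(\<Sum>j<Q. F (x + real j / real Q + s) - F (x + real j / real Q)) - (K (real Q * s) - K 0) / real Q\<bar> \<le> \<bar>s\<bar> * W / real Q"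
    and gain: "\<And>\<beta>. \<beta>1 \<le> \<beta> \<Longrightarrow> \<beta> \<le> \<beta>2 \<Longrightarrow> 3 * \<eta> \<le> \<epsilon> * (K (\<epsilon> * \<beta>) - K 0)"
    and \<beta>: "0 < \<beta>1" "\<beta>1 < \<beta>2" "\<beta>2 < 1" and \<eta>: "0 < \<eta>" and A: "1 \<le> A" "2 * V \<le> \<eta> * of_int A"
  shows "0 < upper_density {N. 1 \<le> N \<and>
    \<eta> / 2 * (\<Sum>i=1..cf_K \<alpha> N. real_of_int (cf_a \<alpha> i)) \<le> (\<Sum>n=1..N. \<phi> (x + real n * \<alpha>))}" (is "0 < upper_density ?S")
proof (rule upper_density_pos)
  show "0 < (\<beta>2 - \<beta>1) / 2" using \<beta> by simp
  fix m
  \<comment> \<open>The three bounds serve to push \<open>M\<close> beyond \<open>m\<close>, to make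
    \<open>W / q k\<close> at most \<open>\<eta>\<close>, and to make the digit so large that half
    of the window absorbs the shifts and roundings at its ends.\<close>
  obtain m' :: nat where m': "max (real m) (max (W / \<eta>) (8 / (\<beta>2 - \<beta>1))) < real m'" using reals_Archimedean2 by blast
  obtain k where k: "Suc m' \<le> k" "good_index D A e \<alpha> k" using good by blast
  have k1: "1 \<le> k" using k by simp
  define Q where "Q = nat (cf_q \<alpha> k)"
  define a where "a = real_of_int (cf_a \<alpha> (Suc k))"
  have q: "1 \<le> cf_q \<alpha> k" by (rule cf_q_ge_1[OF \<alpha>])
  have Q: "real_of_int (cf_q \<alpha> k) = real Q" using q by (auto simp: Q_def)
  have kQ: "real k \<le> real Q" using cf_q_ge_index[OF \<alpha>, of k] unfolding Q[symmetric] by simp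
  have ka: "real k \<le> a"
  proof -
    have "int k = (\<Sum>i=1..k. 1)" by simp
    also have "\<dots> \<le> (\<Sum>i=1..k. cf_a \<alpha> i)"
      using cf_a_ge_1[OF \<alpha>] by (intro sum_mono) (metis atLeastAtMost_iff Suc_le_D One_nat_def)
    finally have s: "int k \<le> (\<Sum>i=1..k. cf_a \<alpha> i)" .
    then have "1 * (\<Sum>i=1..k. cf_a \<alpha> i) \<le> A * (\<Sum>i=1..k. cf_a \<alpha> i)" using A by (intro mult_right_mono) auto
    also have "\<dots> \<le> cf_a \<alpha> (Suc k)" using k(2) by (simp add: good_index_def)
    finally show ?thesis using s unfolding a_def by linarith
  qed
  have kk: "real m < real k" "W / \<eta> < real k" "8 / (\<beta>2 - \<beta>1) < real k"
    using m' k(1) by (auto simp: max_less_iff_conj)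
  have W: "W \<le> \<eta> * of_int (cf_q \<alpha> k)"
  proof -
    have "W / \<eta> < real Q" using kk(2) kQ by linarith
    then show ?thesis using \<eta> unfolding Q by (simp add: divide_less_eq mult.commute)
  qed
  have Q1: "1 \<le> real Q" using k1 kQ by linarith
  have a8: "4 \<le> (\<beta>2 - \<beta>1) * a / 2"
  proof -
    have "8 / (\<beta>2 - \<beta>1) < a" using kk(3) ka by linarith
    then show ?thesis using \<beta> by (simp add: divide_less_eq mult.commute)
  qed
  have a1: "0 < a" using k1 ka by linarith
  define lo hi where "lo = (\<beta>1 * (a + 2) + 1) * real Q" and "hi = \<beta>2 * a * real Q"
  have lo: "real Q \<le> lo" using \<beta> a1 Q1 by (simp add: lo_def distrib_right)
  have gap: "(\<beta>2 - \<beta>1) / 2 * (a * real Q) + 1 \<le> hi - lo"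
  proof -
    have "4 * real Q \<le> (\<beta>2 - \<beta>1) * a / 2 * real Q" using a8 Q1 by (intro mult_right_mono) auto
    moreover have "hi - lo = (\<beta>2 - \<beta>1) * a / 2 * real Q + (\<beta>2 - \<beta>1) * a / 2 * real Q - (2 * \<beta>1 + 1) * real Q"
      by (simp add: hi_def lo_def field_simps)
    moreover have "(2 * \<beta>1 + 1) * real Q \<le> 3 * real Q" using \<beta> Q1 by (intro mult_right_mono) auto
    moreover have "(\<beta>2 - \<beta>1) / 2 * (a * real Q) = (\<beta>2 - \<beta>1) * a / 2 * real Q" by simp
    ultimately show ?thesis using Q1 by linarith
  qed
  define L M where "L = nat \<lceil>lo\<rceil>" and "M = nat \<lfloor>hi\<rfloor>"
  have "0 \<le> (\<beta>2 - \<beta>1) / 2 * (a * real Q)" using \<beta> a1 Q1 by simp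
  then have lohi: "lo + 1 \<le> hi" using gap by linarith
  have LM: "lo \<le> real L" "real L < lo + 1" "hi - 1 < real M" "real M \<le> hi"
    using lo lohi Q1 unfolding L_def M_def by linarith+
  have sub: "{L..M} \<subseteq> {N \<in> ?S. N \<le> M}"
  proof
    fix N assume N: "N \<in> {L..M}"
    then have N': "lo \<le> real N" "real N \<le> hi" using LM by (auto intro: order_trans)
    have "1 \<le> N" using N' lo Q1 by linarith
    moreover have "\<eta> / 2 * (\<Sum>i=1..cf_K \<alpha> N. real_of_int (cf_a \<alpha> i)) \<le> (\<Sum>n=1..N. \<phi> (x + real n * \<alpha>))"
      using N' unfolding lo_def hi_def a_def Q[symmetric]
      by (intro large_partial_quotient_sum[OF \<alpha> k(2) k1 lattice gain[unfolded \<epsilon>_def] \<beta> \<eta> A W]) auto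
    ultimately show "N \<in> {N \<in> ?S. N \<le> M}" using N by simp
  qed
  have "real (Suc M - L) \<le> real (card {N \<in> ?S. N \<le> M})"
    using card_mono[OF _ sub] by (simp add: finite_subset[of _ "{..M}"] subset_iff)
  moreover have "(\<beta>2 - \<beta>1) / 2 * (a * real Q) \<le> real (Suc M - L)"
    using LM gap by linarith
  moreover have "(\<beta>2 - \<beta>1) / 2 * real M \<le> (\<beta>2 - \<beta>1) / 2 * (a * real Q)"
  proof (intro mult_left_mono)
    have "\<beta>2 * (a * real Q) \<le> 1 * (a * real Q)" using \<beta> a1 Q1 by (intro mult_right_mono) auto
    then show "real M \<le> a * real Q" using LM(4) by (simp add: hi_def mult.assoc)
  qed (use \<beta> in simp)
  moreover have "m \<le> M"
  proof -
    have "real m < real M + 1" using LM lohi lo kQ kk(1) by linarith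
    then show ?thesis by linarith
  qed
  moreover have "0 < M" using LM lohi lo Q1 by linarith
  ultimately show "\<exists>M\<ge>m. 0 < M \<and> (\<beta>2 - \<beta>1) / 2 * real M \<le> real (card {N \<in> ?S. N \<le> M})"
    by (intro exI[of _ M]) linarith
qed

end

section \<open>Nonconstancy of the profile\<close>

lemma saw2_second_difference:
  assumes "0 < \<delta>" "\<delta> < frac z" "\<delta> < 1 - frac z"
  shows "saw2 (z + \<delta>) + saw2 (z - \<delta>) - 2 * saw2 z = \<delta>\<^sup>2"
proof -
  have "\<lfloor>z + \<delta>\<rfloor> = \<lfloor>z\<rfloor>" "\<lfloor>z - \<delta>\<rfloor> = \<lfloor>z\<rfloor>" using assms by (auto simp: frac_def floor_eq_iff)
  then have *: "frac (z + \<delta>) = frac z + \<delta>" "frac (z - \<delta>) = frac z - \<delta>" by (simp_all add: frac_def)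
  show ?thesis unfolding saw2_def * by (simp add: power2_eq_square field_simps)
qed

text \<open>The second difference at the singularity of one summand sees its linear kink, while all other
  summands only contribute quadratically.\<close>

lemma saw2_combination_nonconstant:
  assumes X: "finite X" "X \<subseteq> {0..<1}" and i0: "i0 \<in> X" "c i0 \<noteq> 0"
  shows "\<exists>t\<in>{0<..<1}. (\<Sum>i\<in>X. c i * saw2 (y + t - i)) \<noteq> (\<Sum>i\<in>X. c i * saw2 (y + 0 - i))"
proof (rule ccontr)
  define K where "K t = (\<Sum>i\<in>X. c i * saw2 (y + t - i))" for t
  assume "\<not> ?thesis"
  then have K01: "K t = K 0" if "0 \<le> t" "t < 1" for t using that by (cases "t = 0") (auto simp: K_def)
  have const: "K t = K 0" for t
  proof -
    have "saw2 (y + t - i) = saw2 (y + frac t - i)" for i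
    proof -
      have "y + t - i = (y + frac t - i) + of_int \<lfloor>t\<rfloor>" by (simp add: frac_def)
      then show ?thesis by (simp only: saw2_periodic_int)
    qed
    then have "K t = K (frac t)" by (simp add: K_def)
    also have "\<dots> = K 0" by (intro K01) (simp_all add: frac_lt_1)
    finally show ?thesis .
  qed
  \<comment> \<open>Within distance \<open>E\<close> of \<open>i0\<close> no other singularity
    occurs modulo 1. The inserted 1 keeps the minimum defined when \<open>X\<close> is a
    singleton.\<close>
  define E where "E = Min (insert 1 ((\<lambda>j. min (frac (i0 - j)) (1 - frac (i0 - j))) ` (X - {i0})))"
  have "i0 - j \<notin> \<int>" if "j \<in> X - {i0}" for j
  proof -
    have "frac i0 = i0" "0 \<le> j" "j < 1" using X i0 that by (auto simp: frac_eq)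
    then show ?thesis using that by (intro diff_notin_Ints) auto
  qed
  then have E0: "0 < E" unfolding E_def using X(1) by (subst Min_gr_iff) (auto simp: frac_lt_1)
  have E1: "E \<le> frac (i0 - j) \<and> E \<le> 1 - frac (i0 - j)" if "j \<in> X" "j \<noteq> i0" for j
  proof -
    have "E \<le> min (frac (i0 - j)) (1 - frac (i0 - j))"
      unfolding E_def using X(1) that by (intro Min_le) auto
    then show "E \<le> frac (i0 - j) \<and> E \<le> 1 - frac (i0 - j)" by simp
  qed
  have E_le_1: "E \<le> 1" unfolding E_def using X(1) by (intro Min_le) auto
  \<comment> \<open>The second difference of a constant vanishes, which forces this relation for all
    small \<open>\<delta>\<close>; two different values of \<open>\<delta>\<close> then give
    \<open>c i0 = 0\<close>.\<close>
  have eq: "(\<Sum>i\<in>X. c i) * \<delta> = c i0" if \<delta>: "0 < \<delta>" "\<delta> < E" for \<delta>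
  proof -
    have summand: "c j * saw2 (i0 - j + \<delta>) + c j * saw2 (i0 - j - \<delta>) - 2 * (c j * saw2 (i0 - j))
        = c j * \<delta>\<^sup>2 - (if j = i0 then c i0 * \<delta> else 0)" if j: "j \<in> X" for j
    proof (cases "j = i0")
      case True
      have "\<lfloor>\<delta>\<rfloor> = 0" "\<lfloor>- \<delta>\<rfloor> = -1" using \<delta> E_le_1 by (auto simp: floor_eq_iff)
      then have "saw2 \<delta> + saw2 (- \<delta>) - 2 * saw2 0 = \<delta>\<^sup>2 - \<delta>"
        by (simp add: saw2_def frac_def power2_eq_square field_simps)
      then have "c i0 * (saw2 \<delta> + saw2 (- \<delta>) - 2 * saw2 0) = c i0 * (\<delta>\<^sup>2 - \<delta>)" by simp
      then show ?thesis using True by (simp add: algebra_simps)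
    next
      case False
      have "saw2 (i0 - j + \<delta>) + saw2 (i0 - j - \<delta>) - 2 * saw2 (i0 - j) = \<delta>\<^sup>2"
        using \<delta> E1[of j] j False by (intro saw2_second_difference) auto
      then have "c j * (saw2 (i0 - j + \<delta>) + saw2 (i0 - j - \<delta>) - 2 * saw2 (i0 - j)) = c j * \<delta>\<^sup>2" by simp
      then show ?thesis using False by (simp add: algebra_simps)
    qed
    have Kt: "K (i0 - y + u) = (\<Sum>j\<in>X. c j * saw2 (i0 - j + u))" for u
      by (simp add: K_def algebra_simps)
    have "0 = K (i0 - y + \<delta>) + K (i0 - y + (- \<delta>)) - 2 * K (i0 - y + 0)"
      unfolding const[of "i0 - y + \<delta>"] const[of "i0 - y + - \<delta>"] const[of "i0 - y + 0"] by simp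
    also have "\<dots> = (\<Sum>j\<in>X. c j * saw2 (i0 - j + \<delta>) + c j * saw2 (i0 - j - \<delta>) - 2 * (c j * saw2 (i0 - j)))"
      unfolding Kt by (simp add: sum.distrib sum_subtractf sum_distrib_left)
    also have "\<dots> = (\<Sum>j\<in>X. c j * \<delta>\<^sup>2 - (if j = i0 then c i0 * \<delta> else 0))"
      by (intro sum.cong refl summand)
    also have "\<dots> = (\<Sum>j\<in>X. c j) * \<delta>\<^sup>2 - c i0 * \<delta>"
      using X(1) i0(1) by (simp add: sum_subtractf sum_distrib_right)
    also have "\<dots> = \<delta> * ((\<Sum>j\<in>X. c j) * \<delta> - c i0)"
      by (simp add: power2_eq_square right_diff_distrib mult_ac)
    finally have "\<delta> * ((\<Sum>j\<in>X. c j) * \<delta> - c i0) = 0" by (rule sym)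
    then show ?thesis using \<delta> by simp
  qed
  have "(\<Sum>i\<in>X. c i) * (E / 2) = c i0" "(\<Sum>i\<in>X. c i) * (E / 4) = c i0"
    using E0 by (intro eq; simp)+
  then have "c i0 = 0" by simp
  with i0(2) show False by simp
qed

lemma isCont_saw2: "isCont saw2 x"
proof -
  have "(1/2)-lipschitz_on UNIV saw2"
  proof (rule lipschitz_onI)
    fix u v :: real
    show "dist (saw2 u) (saw2 v) \<le> 1 / 2 * dist u v"
      using saw2_lipschitz[of u v] saw2_lipschitz[of v u] by (cases "u \<le> v") (auto simp: dist_real_def abs_minus_commute)
  qed simp
  then have "continuous_on UNIV saw2" by (rule lipschitz_on_continuous_on)
  then show ?thesis by (simp add: continuous_on_eq_continuous_at)
qed

section \<open>Assembly for almost every rotation number\<close>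

lemma common_denominator:
  assumes "finite Y" "Y \<subseteq> \<rat>"
  obtains D :: int where "1 \<le> D" "\<And>y :: real. y \<in> Y \<Longrightarrow> \<exists>m::int. of_int D * y = of_int m"
proof -
  have "\<exists>D::int. 1 \<le> D \<and> (\<forall>y\<in>Y. \<exists>m::int. of_int D * y = of_int m)"
    using assms
  proof (induction Y rule: finite_induct)
    case empty
    then show ?case by (intro exI[of _ 1]) simp
  next
    case (insert y Y)
    then obtain D :: int where D: "1 \<le> D" "\<forall>y\<in>Y. \<exists>m::int. of_int D * y = of_int m" by auto
    obtain a b :: int where ab: "0 < b" "y = of_int a / of_int b"
      using insert.prems by (auto elim: Rats_cases')
    show ?case
    proof (rule exI[of _ "D * b"], intro conjI ballI)
      show "1 \<le> D * b" using D(1) ab(1) mult_mono[of 1 D 1 b] by simp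
      fix z assume z: "z \<in> insert y Y"
      show "\<exists>m::int. of_int (D * b) * z = of_int m"
      proof (cases "z = y")
        case True
        then show ?thesis using ab by (intro exI[of _ "D * a"]) simp
      next
        case False
        with z D(2) obtain m :: int where "of_int D * z = of_int m" by auto
        then have "of_int (D * b) * z = of_int (m * b)" by (simp add: mult_ac)
        then show ?thesis by blast
      qed
    qed
  qed
  then show thesis using that by blast
qed

text \<open>The one-sided half of the result. Membership in \<open>irr\<close> is carried along to
  supply positive digits when the two halves are combined.\<close>

lemma AE_upper_density_ge:
  assumes psm: "piecewise_smooth_rat_disc f" and q: "q \<in> \<rat>"
  shows "AE \<alpha> in lborel. \<alpha> \<in> {0..<1} \<longrightarrow> \<alpha> \<in> irr \<and>
    (\<exists>C>0. 0 < upper_density {N. 1 \<le> N \<and> C * (\<Sum>i=1..cf_K \<alpha> N. real_of_int (cf_a \<alpha> i)) \<le> S_N f \<alpha> q N})"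
proof -
  obtain X c g h where X: "finite X" "X \<subseteq> \<rat> \<inter> {0..<1}" and c: "\<exists>i\<in>X. c i \<noteq> 0"
    and bv: "bounded_variation_on g {0..<1}"
    and hper: "\<And>x. h (x + 1) = h x" and hcont: "\<And>x. isCont h x"
    and f: "\<And>x. frac x \<notin> X \<Longrightarrow> f x = h x + (\<Sum>i\<in>X. c i * saw (x - i))"
    and hder: "\<And>x. frac x \<notin> X \<Longrightarrow> (h has_real_derivative g (frac x) - (\<Sum>i\<in>X. c i)) (at x)"
    by (rule sawtooth_decomposition[OF psm], rule that)
  define \<Gamma> where "\<Gamma> = (\<Sum>i\<in>X. c i)"
  obtain W where W: "\<And>ts. sorted ts \<Longrightarrow> set ts \<subseteq> {0..<1} \<Longrightarrow> (\<Sum>i<length ts - 1. \<bar>g (ts ! Suc i) - g (ts ! i)\<bar>) \<le> W"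
    using bv unfolding bounded_variation_on_def by blast
  define B where "B = W + \<bar>g 0\<bar> + \<bar>\<Gamma>\<bar>"
  have g: "\<bar>g (frac x) - \<Gamma>\<bar> \<le> B" for x
    using W[of "[0, frac x]"] by (simp add: frac_lt_1 B_def)
  have B0: "0 \<le> B" using g[of 0] by linarith
  have hlip: "\<bar>h v - h u\<bar> \<le> B * (v - u)" if "u \<le> v" for u v
  proof -
    have S: "finite {y \<in> {u..v}. frac (y + 0) \<in> X}" by (rule finite_frac_preimage[OF X(1)])
    have co: "continuous_on {u..v} h" by (intro continuous_at_imp_continuous_on ballI hcont)
    have de: "(h has_real_derivative g (frac y) - \<Gamma>) (at y)" if "y \<in> {u<..<v} - {y \<in> {u..v}. frac (y + 0) \<in> X}" for y
      using hder[of y] that unfolding \<Gamma>_def by auto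
    have bd: "- B \<le> g (frac y) - \<Gamma> \<and> g (frac y) - \<Gamma> \<le> B" if "y \<in> {u<..<v} - {y \<in> {u..v}. frac (y + 0) \<in> X}" for y
      using g[of y] by (simp add: abs_le_iff)
    show ?thesis using increment_bounds[OF that S co de bd] by (simp add: abs_le_iff)
  qed
  obtain F0 where F0: "\<And>x. (F0 has_real_derivative h x) (at x)"
    using einterval_antiderivative[of "-\<infinity>" \<infinity> h] hcont
    by (auto simp: has_real_derivative_iff_has_vector_derivative)
  \<comment> \<open>The mean of \<open>h\<close> over a period; subtracting it makes the
    antiderivative periodic. The sawtooth terms have mean zero, so it is also the integral of
    \<open>f\<close>.\<close>
  define m where "m = F0 1 - F0 0"
  have F0per: "F0 (x + 1) - F0 x = m" for x
  proof -
    have "((\<lambda>x. F0 (x + 1) - F0 x) has_real_derivative 0) (at y)" for y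
    proof -
      have "((\<lambda>x. F0 (x + 1)) has_real_derivative h y) (at y)"
        using F0[of "y + 1"] unfolding hper DERIV_shift .
      from DERIV_diff[OF this F0[of y]] show ?thesis by simp
    qed
    from DERIV_isconst_all[of "\<lambda>x. F0 (x + 1) - F0 x" x 0] this show ?thesis by (simp add: m_def)
  qed
  have integral: "integral {0..1} f = m"
  proof -
    define G where "G x = F0 x + (\<Sum>i\<in>X. c i * saw2 (x - i))" for x
    have "continuous_on {0..1} G" unfolding G_def
    proof (intro continuous_at_imp_continuous_on ballI continuous_intros)
      fix x :: real and i
      show "isCont F0 x" by (rule DERIV_isCont[OF F0])
      show "isCont (\<lambda>x. saw2 (x - i)) x" by (rule isCont_o2[where g = saw2]) (auto intro: isCont_saw2)
    qed
    moreover have "(G has_vector_derivative f x) (at x)" if x: "x \<in> {0<..<1} - X" for x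
    proof -
      have fr: "frac x = x" using x by (simp add: frac_eq)
      have "((\<lambda>x. c i * saw2 (x - i)) has_real_derivative c i * saw (x - i)) (at x)" if i: "i \<in> X" for i
      proof -
        have "frac x \<noteq> i" "0 \<le> i" "i < 1" using X(2) i x fr by auto
        then have "x + - i \<notin> \<int>" using diff_notin_Ints[of x i] by simp
        from saw2_has_derivative[OF this, unfolded DERIV_shift] have "((\<lambda>x. saw2 (x - i)) has_real_derivative saw (x - i)) (at x)" by simp
        from DERIV_cmult[OF this] show ?thesis .
      qed
      then have "(G has_real_derivative h x + (\<Sum>i\<in>X. c i * saw (x - i))) (at x)"
        unfolding G_def by (intro DERIV_add F0 DERIV_sum)
      then show ?thesis using f[of x] fr x by (simp add: has_real_derivative_iff_has_vector_derivative)
    qed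
    ultimately have "(f has_integral (G 1 - G 0)) {0..1}"
      by (intro fundamental_theorem_of_calculus_interior_strong[OF X(1)]) auto
    moreover have "saw2 (1 - i) = saw2 (0 - i)" for i using saw2_periodic[of "- i"] by simp
    then have "G 1 - G 0 = m" by (simp add: G_def m_def)
    ultimately show ?thesis by (simp add: integral_unique)
  qed
  define h0 where "h0 x = h x - m" for x
  define Fh where "Fh x = F0 x - m * x" for x
  have Fhder: "(Fh has_real_derivative h0 x) (at x)" for x
    unfolding Fh_def h0_def using F0 by (auto intro!: derivative_eq_intros)
  have Fhper: "Fh (x + 1) = Fh x" for x using F0per[of x] by (simp add: Fh_def algebra_simps)
  \<comment> \<open>A function with Lipschitz constant \<open>B\<close> has the linear majorant
    \<open>B * x\<close>.\<close>
  have pvh: "periodic_variation h0 Fh (\<lambda>x. B * x) B"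
  proof
    fix u y v :: real
    assume uy: "u \<le> y" and yv: "y \<le> v"
    show "\<bar>Fh v - Fh u - (v - u) * h0 y\<bar> \<le> (v - u) * (B * v - B * u)"
    proof (cases "u = v")
      case False
      then have "u < v" using uy yv by simp
      then obtain z where z: "u < z" "z < v" "Fh v - Fh u = (v - u) * h0 z"
        using MVT2[of u v Fh h0] Fhder by blast
      have "\<bar>h0 z - h0 y\<bar> \<le> B * \<bar>z - y\<bar>"
        using hlip[of y z] hlip[of z y] by (cases "y \<le> z") (auto simp: h0_def abs_minus_commute)
      also have "\<dots> \<le> B * (v - u)" using z uy yv B0 by (intro mult_left_mono) auto
      finally have "(v - u) * \<bar>h0 z - h0 y\<bar> \<le> (v - u) * (B * (v - u))" using \<open>u < v\<close> by (intro mult_left_mono) auto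
      moreover have "\<bar>Fh v - Fh u - (v - u) * h0 y\<bar> = (v - u) * \<bar>h0 z - h0 y\<bar>"
        unfolding z(3) right_diff_distrib[symmetric] using \<open>u < v\<close> by (simp add: abs_mult)
      ultimately show ?thesis by (simp add: right_diff_distrib)
    qed (use uy yv in simp)
  qed (simp_all add: h0_def hper Fhper algebra_simps)
  define \<phi> where "\<phi> x = h0 x + (\<Sum>i\<in>X. c i * saw (x - i))" for x
  define F where "F x = Fh x + (\<Sum>i\<in>X. c i * saw2 (x - i))" for x
  define V where "V = B + (\<Sum>i\<in>X. \<bar>c i\<bar> * 2)"
  obtain \<mu> where pv: "periodic_variation \<phi> F \<mu> V"
    using periodic_variation_add[OF pvh periodic_variation_sum[OF X(1)
        periodic_variation_scale[OF periodic_variation_translate[OF periodic_variation_saw]], of c "\<lambda>i. i"]]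
    unfolding \<phi>_def[abs_def] F_def[abs_def] V_def by blast
  interpret periodic_variation \<phi> F \<mu> V by (rule pv)
  \<comment> \<open>The profile seen by block sums along \<open>Q\<close> that are 1 modulo
    \<open>D\<close>: there \<open>Q * (q - i)\<close> agrees with \<open>q - i\<close> modulo 1, so
    it depends on \<open>Q\<close> no longer.\<close>
  define K where "K t = (\<Sum>i\<in>X. c i * saw2 (q + t - i))" for t
  have Kper: "K (t + 1) = K t" for t
    using saw2_periodic[of "q + t - _"] by (simp add: K_def algebra_simps)
  have Kcont: "isCont K t" for t
  proof -
    have "isCont (\<lambda>t. saw2 (q + t - i)) t" for i
      by (rule isCont_o2[where g = saw2]) (auto intro!: isCont_saw2 continuous_intros)
    then show ?thesis unfolding K_def by (intro continuous_intros) auto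
  qed
  obtain D :: int where D: "1 \<le> D" "\<And>i. i \<in> X \<Longrightarrow> \<exists>m::int. of_int D * (q - i) = of_int m"
  proof (rule common_denominator[of "(\<lambda>i. q - i) ` X"])
    show "(\<lambda>i. q - i) ` X \<subseteq> \<rat>" using X(2) q by (auto intro: Rats_diff)
  qed (use X(1) in auto)
  have lattice: "\<bar>(\<Sum>j<Q. F (q + real j / real Q + s) - F (q + real j / real Q)) - (K (real Q * s) - K 0) / real Q\<bar>
      \<le> \<bar>s\<bar> * W / real Q" if Q: "0 < Q" and dv: "D dvd int Q - 1" for Q s
  proof -
    have part: "(\<Sum>j<Q. saw2 (q + real j / real Q + s - i) - saw2 (q + real j / real Q - i))
        = (saw2 (q + real Q * s - i) - saw2 (q + 0 - i)) / real Q" if i: "i \<in> X" for i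
    proof -
      obtain m :: int where m: "of_int D * (q - i) = of_int m" using D(2)[OF i] by blast
      obtain t where t: "int Q - 1 = D * t" using dv by (auto elim: dvdE)
      have "real Q = 1 + of_int D * of_int t" using arg_cong[OF t, of real_of_int] by simp
      then have "real Q * (q - i) = (q - i) + (of_int D * (q - i)) * of_int t" by (simp add: algebra_simps)
      then have shift: "real Q * (q - i) = (q - i) + of_int (m * t)" unfolding m by simp
      have "(\<Sum>j<Q. saw2 (q + real j / real Q + s - i) - saw2 (q + real j / real Q - i))
        = (\<Sum>j<Q. saw2 ((q - i) + real j / real Q + s) - saw2 ((q - i) + real j / real Q))"
        by (intro sum.cong) (simp_all add: algebra_simps)
      also have "\<dots> = (saw2 (real Q * (q - i) + real Q * s) - saw2 (real Q * (q - i))) / real Q"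
        by (rule saw2_lattice_diff[OF Q])
      also have "real Q * (q - i) + real Q * s = (q + real Q * s - i) + of_int (m * t)" unfolding shift by simp
      also have "real Q * (q - i) = (q + 0 - i) + of_int (m * t)" unfolding shift by simp
      finally show ?thesis unfolding saw2_periodic_int .
    qed
    have "(\<Sum>j<Q. F (q + real j / real Q + s) - F (q + real j / real Q))
        = (\<Sum>j<Q. Fh (q + real j / real Q + s) - Fh (q + real j / real Q))
          + (\<Sum>j<Q. \<Sum>i\<in>X. c i * (saw2 (q + real j / real Q + s - i) - saw2 (q + real j / real Q - i)))"
      unfolding F_def by (simp add: sum.distrib sum_subtractf right_diff_distrib)
    also have "(\<Sum>j<Q. \<Sum>i\<in>X. c i * (saw2 (q + real j / real Q + s - i) - saw2 (q + real j / real Q - i)))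
        = (\<Sum>i\<in>X. c i * ((saw2 (q + real Q * s - i) - saw2 (q + 0 - i)) / real Q))"
      by (subst sum.swap) (simp add: sum_distrib_left[symmetric] part)
    also have "\<dots> = (K (real Q * s) - K 0) / real Q"
      by (simp add: K_def sum_subtractf[symmetric] sum_divide_distrib right_diff_distrib)
    finally have eq: "(\<Sum>j<Q. F (q + real j / real Q + s) - F (q + real j / real Q)) - (K (real Q * s) - K 0) / real Q
       = (\<Sum>j<Q. Fh (q + real j / real Q + s) - Fh (q + real j / real Q))" by simp
    \<comment> \<open>The derivative of \<open>R\<close> is a lattice sum of \<open>h0\<close>, at
      most \<open>W / Q\<close> in size, so a shift by \<open>s\<close> changes \<open>R\<close> by
      at most \<open>\<bar>s\<bar> * W / Q\<close>.\<close>
    define R where "R x = (\<Sum>j<Q. Fh (x + real j / real Q))" for x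
    have Rder: "(R has_real_derivative (\<Sum>j<Q. h0 (x + real j / real Q))) (at x)" for x
      unfolding R_def by (intro DERIV_sum) (simp add: Fhder flip: DERIV_shift)
    have Tle: "\<bar>\<Sum>j<Q. h0 (x + real j / real Q)\<bar> \<le> W / real Q" for x
    proof (rule lattice_sum_le[OF W X(1) _ _ _ Fhder Fhper Q])
      show "h0 (x + 1) = h0 x" for x by (simp add: h0_def hper)
      show "isCont h0 x" for x unfolding h0_def by (intro continuous_intros hcont)
      show "(h0 has_real_derivative g (frac x) - \<Gamma>) (at x)" if "frac x \<notin> X" for x
        unfolding h0_def \<Gamma>_def using DERIV_diff[OF hder[OF that] DERIV_const[of m]] by simp
    qed
    have "norm (R (q + s) - R q) \<le> W / real Q * norm (q + s - q)"
      by (rule field_differentiable_bound[of UNIV R "\<lambda>x. \<Sum>j<Q. h0 (x + real j / real Q)"])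
        (use Rder Tle in auto)
    moreover have "R (q + s) - R q = (\<Sum>j<Q. Fh (q + real j / real Q + s) - Fh (q + real j / real Q))"
      by (simp add: R_def sum_subtractf algebra_simps)
    ultimately show ?thesis unfolding eq by (simp add: mult.commute)
  qed
  obtain t where t: "t \<in> {0<..<1}" "K t \<noteq> K 0"
  proof -
    obtain i0 where "i0 \<in> X" "c i0 \<noteq> 0" using c by blast
    moreover have "X \<subseteq> {0..<1}" using X(2) by blast
    ultimately show thesis
      using saw2_combination_nonconstant[OF X(1), of i0 c q] that unfolding K_def by blast
  qed
  \<comment> \<open>The sign of \<open>K t - K 0\<close> selects the parity. For odd
    \<open>k\<close> the drift is negative, and periodicity identifies \<open>K (- (1 - t))\<close>
    with \<open>K t\<close>.\<close>
  define e where "e \<longleftrightarrow> K 0 < K t"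
  define \<epsilon> where "\<epsilon> = (if e then 1 else - 1 :: real)"
  define \<beta>0 where "\<beta>0 = (if e then t else 1 - t)"
  define gain where "gain \<beta> = \<epsilon> * (K (\<epsilon> * \<beta>) - K 0)" for \<beta>
  have \<beta>0: "0 < \<beta>0" "\<beta>0 < 1" using t by (auto simp: \<beta>0_def)
  have "0 < gain \<beta>0"
  proof (cases e)
    case True
    then show ?thesis by (simp add: gain_def \<epsilon>_def \<beta>0_def e_def)
  next
    case False
    then have "K t < K 0" using t(2) by (simp add: e_def)
    then show ?thesis using False Kper[of "t - 1"] by (simp add: gain_def \<epsilon>_def \<beta>0_def)
  qed
  \<comment> \<open>By continuity half of the gain survives near \<open>\<beta>0\<close>, and that
    half is \<open>3 * \<eta>\<close>.\<close>
  define \<eta> where "\<eta> = gain \<beta>0 / 6"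
  have \<eta>: "0 < \<eta>" using \<open>0 < gain \<beta>0\<close> by (simp add: \<eta>_def)
  have "isCont gain \<beta>0"
  proof -
    have "isCont (\<lambda>\<beta>. K (\<epsilon> * \<beta>)) \<beta>0" by (rule isCont_o2[where g = K]) (auto intro!: Kcont continuous_intros)
    then show ?thesis unfolding gain_def by (intro continuous_intros)
  qed
  then obtain d where d: "0 < d" "\<And>\<beta>. \<bar>\<beta> - \<beta>0\<bar> < d \<Longrightarrow> \<bar>gain \<beta> - gain \<beta>0\<bar> < gain \<beta>0 / 2"
    using \<open>0 < gain \<beta>0\<close> unfolding continuous_at_eps_delta dist_real_def
    by (metis half_gt_zero)
  define d' where "d' = min (d / 2) (min (\<beta>0 / 2) ((1 - \<beta>0) / 2))"
  have d': "0 < d'" "d' < d" "d' < \<beta>0" "d' < 1 - \<beta>0" using d(1) \<beta>0 by (auto simp: d'_def min_def)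
  define \<beta>1 \<beta>2 where "\<beta>1 = \<beta>0 - d'" and "\<beta>2 = \<beta>0 + d'"
  have \<beta>: "0 < \<beta>1" "\<beta>1 < \<beta>2" "\<beta>2 < 1" using d' by (auto simp: \<beta>1_def \<beta>2_def)
  have gain: "3 * \<eta> \<le> (if e then 1 else - 1) * (K ((if e then 1 else - 1) * \<beta>) - K 0)" if "\<beta>1 \<le> \<beta>" "\<beta> \<le> \<beta>2" for \<beta>
  proof -
    have "\<bar>\<beta> - \<beta>0\<bar> < d" using that d' by (simp add: \<beta>1_def \<beta>2_def abs_less_iff)
    from d(2)[OF this] have "3 * \<eta> \<le> gain \<beta>" unfolding \<eta>_def by linarith
    then show ?thesis by (simp add: gain_def \<epsilon>_def)
  qed
  \<comment> \<open>The large digit has to exceed \<open>2 * V / \<eta>\<close> times the preceding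
    digit sum, so that it outweighs the block and Ostrowski errors.\<close>
  define A :: int where "A = max 1 \<lceil>2 * V / \<eta>\<rceil>"
  have A: "1 \<le> A" "2 * V \<le> \<eta> * of_int A"
  proof -
    have "2 * V / \<eta> \<le> of_int A" unfolding A_def by linarith
    then show "2 * V \<le> \<eta> * of_int A" using \<eta> by (simp add: divide_le_eq mult.commute)
  qed (simp add: A_def)
  have S: "S_N f \<alpha> q N = (\<Sum>n=1..N. \<phi> (q + real n * \<alpha>))" if \<alpha>: "\<alpha> \<in> irr" for \<alpha> N
  proof -
    have "f (real n * \<alpha> + q) = \<phi> (q + real n * \<alpha>) + m" if n: "n \<in> {1..N}" for n
    proof -
      \<comment> \<open>For \<open>n \<ge> 1\<close> the orbit points are irrational and miss
        \<open>X\<close>, so the values of \<open>f\<close> at its discontinuities never enter the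
        sum.\<close>
      have "frac (real n * \<alpha> + q) \<notin> X"
      proof
        assume "frac (real n * \<alpha> + q) \<in> X"
        then have "frac (real n * \<alpha> + q) \<in> \<rat>" using X(2) by blast
        then have "real n * \<alpha> + q \<in> \<rat>" by (simp only: frac_in_Rats_iff)
        then have "(real n * \<alpha> + q - q) / real n \<in> \<rat>" using q by (intro Rats_divide Rats_diff) auto
        then have "\<alpha> \<in> \<rat>" using n by simp
        then show False using irrD(3)[OF \<alpha>] by simp
      qed
      from f[OF this] show ?thesis by (simp add: \<phi>_def h0_def add.commute)
    qed
    then have "(\<Sum>n=1..N. f (real n * \<alpha> + q)) = (\<Sum>n=1..N. \<phi> (q + real n * \<alpha>) + m)" by (intro sum.cong) auto
    then show ?thesis by (simp add: S_N_def integral sum.distrib)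
  qed
  show ?thesis
  proof (rule AE_mp[OF AE_good_index[OF D(1) A(1), of e]], intro AE_I2 impI)
    fix \<alpha> :: real
    assume "\<alpha> \<in> {0..<1} \<longrightarrow> \<alpha> \<in> irr \<and> (\<forall>m. \<exists>k\<ge>m. good_index D A e \<alpha> k)" "\<alpha> \<in> {0..<1}"
    then have \<alpha>: "\<alpha> \<in> irr" and good: "\<And>m. \<exists>k\<ge>m. good_index D A e \<alpha> k" by auto
    have "0 < upper_density {N. 1 \<le> N \<and>
        \<eta> / 2 * (\<Sum>i=1..cf_K \<alpha> N. real_of_int (cf_a \<alpha> i)) \<le> (\<Sum>n=1..N. \<phi> (q + real n * \<alpha>))}"
      by (rule large_partial_quotient_density[OF \<alpha> good lattice gain \<beta> \<eta> A])
    then have "0 < upper_density {N. 1 \<le> N \<and>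
        \<eta> / 2 * (\<Sum>i=1..cf_K \<alpha> N. real_of_int (cf_a \<alpha> i)) \<le> S_N f \<alpha> q N}"
      by (simp only: S[OF \<alpha>])
    then show "\<alpha> \<in> irr \<and> (\<exists>C>0. 0 < upper_density {N. 1 \<le> N \<and>
        C * (\<Sum>i=1..cf_K \<alpha> N. real_of_int (cf_a \<alpha> i)) \<le> S_N f \<alpha> q N})"
      using \<alpha> \<eta> by (intro conjI exI[of _ "\<eta> / 2"]) auto
  qed
qed

text \<open>Closure under negation: the lower bound applied to the negated function produces the set
  of large negative sums.\<close>

lemma piecewise_smooth_rat_disc_uminus:
  assumes "piecewise_smooth_rat_disc f"
  shows "piecewise_smooth_rat_disc (\<lambda>x. - f x)"
proof -
  from assms have per: "\<And>x. f (x + 1) = f x" unfolding piecewise_smooth_rat_disc_def by blast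
  from assms obtain X g x0 L where X: "finite X" "X \<noteq> {}" "X \<subseteq> \<rat> \<inter> {0..<1}"
    and bv: "bounded_variation_on g {0..<1}"
    and der: "\<And>x. x \<in> {0..<1} - X \<Longrightarrow> (f has_real_derivative g x) (at x)"
    and L: "x0 \<in> X" "L \<noteq> 0" "((\<lambda>\<delta>. f (x0 - \<delta>) - f (x0 + \<delta>)) \<longlongrightarrow> L) (at_right 0)"
    unfolding piecewise_smooth_rat_disc_def by blast
  have bv': "bounded_variation_on (\<lambda>x. - g x) {0..<1}"
  proof -
    have "\<bar>- a - - b\<bar> = \<bar>a - b\<bar>" for a b :: real by simp
    then show ?thesis using bv unfolding bounded_variation_on_def by simp
  qed
  show ?thesis
    unfolding piecewise_smooth_rat_disc_def
  proof (intro conjI allI exI[of _ X])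
    show "\<exists>g. bounded_variation_on g {0..<1} \<and>
        (\<forall>x\<in>{0..<1} - X. ((\<lambda>x. - f x) has_real_derivative g x) (at x))"
      by (intro exI[of _ "\<lambda>x. - g x"] conjI ballI bv' DERIV_minus der)
    have "((\<lambda>\<delta>. - f (x0 - \<delta>) - - f (x0 + \<delta>)) \<longlongrightarrow> - L) (at_right 0)"
      using tendsto_minus[OF L(3)] by simp
    then show "\<exists>x\<in>X. \<exists>L. L \<noteq> 0 \<and> ((\<lambda>\<delta>. - f (x - \<delta>) - - f (x + \<delta>)) \<longlongrightarrow> L) (at_right 0)"
      using L(2) by (intro bexI[OF _ L(1)] exI[of _ "- L"] conjI) simp_all
  qed (use X per in simp_all)
qed

lemma S_N_uminus: "S_N (\<lambda>x. - f x) \<alpha> q N = - S_N f \<alpha> q N"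
  by (simp add: S_N_def sum_negf)

theorem theorem1p4:
  fixes f :: "real \<Rightarrow> real" and q :: real
  assumes "piecewise_smooth_rat_disc f" and "q \<in> \<rat>"
  shows "AE \<alpha> in lborel. \<alpha> \<in> {0..<1} \<longrightarrow>
           (\<exists>C>0.
              upper_density {N. 1 \<le> N \<and>
                 S_N f \<alpha> q N \<ge> C * (\<Sum>i=1..cf_K \<alpha> N. real_of_int (cf_a \<alpha> i))} > 0 \<and>
              upper_density {N. 1 \<le> N \<and>
                 S_N f \<alpha> q N \<le> - C * (\<Sum>i=1..cf_K \<alpha> N. real_of_int (cf_a \<alpha> i))} > 0)"
proof (rule AE_mp[OF AE_upper_density_ge[OF assms]],
    rule AE_mp[OF AE_upper_density_ge[OF piecewise_smooth_rat_disc_uminus[OF assms(1)] assms(2)]], intro AE_I2 impI)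
  fix \<alpha> :: real
  let ?s = "\<lambda>N. \<Sum>i=1..cf_K \<alpha> N. real_of_int (cf_a \<alpha> i)"
  assume "\<alpha> \<in> {0..<1}"
    and "\<alpha> \<in> {0..<1} \<longrightarrow> \<alpha> \<in> irr \<and> (\<exists>C>0. 0 < upper_density {N. 1 \<le> N \<and> C * ?s N \<le> S_N (\<lambda>x. - f x) \<alpha> q N})"
    and "\<alpha> \<in> {0..<1} \<longrightarrow> \<alpha> \<in> irr \<and> (\<exists>C>0. 0 < upper_density {N. 1 \<le> N \<and> C * ?s N \<le> S_N f \<alpha> q N})"
  then obtain C1 C2 where \<alpha>: "\<alpha> \<in> irr"
    and C1: "0 < C1" "0 < upper_density {N. 1 \<le> N \<and> C1 * ?s N \<le> S_N f \<alpha> q N}"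
    and C2: "0 < C2" "0 < upper_density {N. 1 \<le> N \<and> C2 * ?s N \<le> - S_N f \<alpha> q N}"
    unfolding S_N_uminus by blast
  have s: "0 \<le> ?s N" for N
  proof (rule sum_nonneg)
    fix i assume "i \<in> {1..cf_K \<alpha> N}"
    then show "0 \<le> real_of_int (cf_a \<alpha> i)" using cf_a_ge_1[OF \<alpha>, of "i - 1"] by simp
  qed
  \<comment> \<open>The digit sums are nonnegative, so passing to the smaller constant only enlarges
    both sets.\<close>
  define C where "C = min C1 C2"
  have le: "C * ?s N \<le> C1 * ?s N" "C * ?s N \<le> C2 * ?s N" for N
    using s[of N] by (auto simp: C_def intro!: mult_right_mono)
  have "{N. 1 \<le> N \<and> C1 * ?s N \<le> S_N f \<alpha> q N} \<subseteq> {N. 1 \<le> N \<and> S_N f \<alpha> q N \<ge> C * ?s N}"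
    using le(1) by (auto intro: order_trans)
  from less_le_trans[OF C1(2) upper_density_mono[OF this]]
  have 1: "0 < upper_density {N. 1 \<le> N \<and> S_N f \<alpha> q N \<ge> C * ?s N}" .
  have "{N. 1 \<le> N \<and> C2 * ?s N \<le> - S_N f \<alpha> q N} \<subseteq> {N. 1 \<le> N \<and> S_N f \<alpha> q N \<le> - C * ?s N}"
  proof safe
    fix N assume "C2 * ?s N \<le> - S_N f \<alpha> q N"
    then show "S_N f \<alpha> q N \<le> - C * ?s N" using le(2)[of N] by simp
  qed
  from less_le_trans[OF C2(2) upper_density_mono[OF this]]
  have 2: "0 < upper_density {N. 1 \<le> N \<and> S_N f \<alpha> q N \<le> - C * ?s N}" .
  have "0 < C" using C1(1) C2(1) by (simp add: C_def)
  with 1 2 show "\<exists>C>0. upper_density {N. 1 \<le> N \<and> S_N f \<alpha> q N \<ge> C * ?s N} > 0 \<and>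
      upper_density {N. 1 \<le> N \<and> S_N f \<alpha> q N \<le> - C * ?s N} > 0" by blast
qed

end
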